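(* Let $W$ be a vector space over $\mathbb{C}$ and let $S$ be any compatible set of $G_1$-vertex operators on $W$. Then for any $a^{(1)}(x),\dots,a^{(r)}(x)\in S$, the expression $$Y_{\mathcal{E}}(a^{(1)}(x),x_1)\cdots Y_{\mathcal{E}}(a^{(r)}(x),x_r)1_W$$ is recursively well defined; that is, for all $n_1,\dots,n_r\in\mathbb{Z}$ the iterated product $a^{(1)}(x)_{n_1}\left(a^{(2)}(x)_{n_2}\left(\cdots\left(a^{(r)}(x)_{n_r}1_W\right)\cdots\right)\right)$ is defined, each successive ordered pair being compatible. Furthermore, if we set $$U=\mathrm{span}\{a^{(1)}(x)_{n_1}\cdots a^{(r)}(x)_{n_r}1_W \mid r\ge 0,\ a^{(i)}(x)\in S,\ n_i\in\mathbb{Z}\},$$ then $(U,Y_{\mathcal{E}},1_W)$ carries the structure of a weak axiomatic $G_1$-vertex algebra with $W$ as a natural module, where the vertex operator map $Y_W$ is given by $Y_W(\alpha(x),x_0)=\alpha(x_0)$ for $\alpha(x)\in U$.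
   Context: All vector spaces are over $\mathbb{C}$; $\mathbb{N}$ denotes the nonnegative integers. For a vector space $U$: $U[[x,x^{-1}]]=\{\sum_{n\in\mathbb{Z}}a(n)x^n\}$, $U((x))$ is the space of such series with only finitely many negative powers, and $U((x_1,\dots,x_n))=U[[x_1,\dots,x_n]][x_1^{-1},\dots,x_n^{-1}]$. Binomial convention: for $n\in\mathbb{Z}$, $(x_1\pm x_2)^n$ is expanded in nonnegative powers of the second variable $x_2$; likewise $f(x_0+x_2)$ is expanded in nonnegative powers of $x_2$, and $(-y+x)^n$ in nonnegative powers of $x$. $\mathrm{Res}_x$ is the coefficient of $x^{-1}$. Weak axiomatic $G_1$-vertex algebra: a vector space $V$ with a linear map $Y(\cdot,x):V\to(\mathrm{End}\,V)[[x,x^{-1}]]$, $v\mapsto Y(v,x)=\sum_n v_nx^{-n-1}$, and a vector $\mathbf{1}\in V$ such that: for $u,v\in V$, $u_nv=0$ for $n$ sufficiently large; $Y(\mathbf{1},x)=1$; $Y(v,x)\mathbf{1}\in V[[x]]$ with $\lim_{x\to0}Y(v,x)\mathbf{1}=v$ for $v\in V$; and for $u,v,w\in V$ there exists $l\in\mathbb{N}$ such that $(x_0+x_2)^lY(u,x_0+x_2)Y(v,x_2)w=(x_0+x_2)^lY(Y(u,x_0)v,x_2)w$. Module for a weak axiomatic $G_1$-vertex algebra $V$: a vector space $W$ with a linear map $Y_W(\cdot,x):V\to(\mathrm{End}\,W)[[x,x^{-1}]]$ such that $Y_W(v,x)w\in W((x))$ for $v\in V,w\in W$, $Y_W(\mathbf{1},x)=1_W$,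 and for $u,v\in V$, $w\in W$ there is $l\in\mathbb{N}$ with $(x_0+x_2)^lY_W(u,x_0+x_2)Y_W(v,x_2)w=(x_0+x_2)^lY_W(Y(u,x_0)v,x_2)w$. Elements of $\mathcal{E}_{G_1}(W)=\mathrm{Hom}(W,W((x)))$ are called weak $G_1$-vertex operators on $W$; $1_W$ is the identity operator. An ordered sequence $(\psi^{(1)},\dots,\psi^{(r)})$ in $\mathcal{E}_{G_1}(W)$ is compatible if there is $k\in\mathbb{N}$ with $\left(\prod_{1\le i<j\le r}(x_i-x_j)^k\right)\psi^{(1)}(x_1)\cdots\psi^{(r)}(x_r)\in\mathrm{Hom}(W,W((x_1,\dots,x_r)))$. A set $S$ of weak $G_1$-vertex operators is compatible if every finite ordered sequence in $S$ (repetitions allowed) is compatible; $a(x)\in\mathcal{E}_{G_1}(W)$ is a $G_1$-vertex operator if $\{a(x)\}$ is compatible (so all elements of a compatible set are $G_1$-vertex operators). If $(a(x),b(x))$ is compatible, define $T(a(x)b(y))=(-y+x)^{-k}\left((x-y)^ka(x)b(y)\right)\in\mathrm{Hom}(W,W((y))((x)))$ for any $k\in\mathbb{N}$ with $(x-y)^ka(x)b(y)\in\mathrm{Hom}(W,W((x,y)))$ (this is independent of $k$), and for $n\in\mathbb{Z}$ define $a(x)_nb(x)=\mathrm{Res}_{x_1}\left((x_1-x)^na(x_1)b(x)-(-x+x_1)^nT(a(x_1)b(x))\right)\in\mathcal{E}_{G_1}(W)$, and $Y_{\mathcal{E}}(a(x),x_0)b(x)=\sum_{n\in\mathbb{Z}}a(x)_nb(x)\,x_0^{-n-1}$.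 *)

theory Defs
  imports Complex_Main "HOL-Library.Function_Algebras" "HOL-Library.Groups_Big_Fun"
begin

text \<open>
  A complex vector space \<open>W\<close> is a type \<open>'w\<close> with a scalar multiplication
  \<open>s\<close> satisfying \<^locale>\<open>vector_space\<close>.
  A series in \<open>W[[x, x\<^sup>-\<^sup>1]]\<close> is its coefficient function \<open>int \<Rightarrow> 'w\<close>, where
  \<open>f n\<close> is the coefficient of \<open>x\<^sup>n\<close> (so a mode \<open>v\<^sub>n\<close> sits at exponent \<open>-n-1\<close>).
  A doubly infinite series in \<open>(x, y)\<close> is \<open>f p q\<close>, the coefficient of \<open>x\<^sup>p y\<^sup>q\<close>, and one
  in \<open>x\<^sub>1, \<dots>, x\<^sub>r\<close> is a function of the list of exponents, of length \<open>r\<close>.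
\<close>

definition lower_truncated :: "(int \<Rightarrow> 'w::zero) \<Rightarrow> bool" where
  "lower_truncated f \<longleftrightarrow> (\<exists>N. \<forall>n<N. f n = 0)"

definition lower_truncated_multi :: "nat \<Rightarrow> (int list \<Rightarrow> 'w::zero) \<Rightarrow> bool" where
  "lower_truncated_multi r f \<longleftrightarrow>
     (\<exists>N. \<forall>ms. length ms = r \<and> (\<exists>m\<in>set ms. m < N) \<longrightarrow> f ms = 0)"

subsection \<open>Binomial expansions\<close>

text \<open>
  \<^const>\<open>Sum_any\<close> is the sum over the support of the summand; it is used only where the
  truncation conditions, or the vanishing of the binomial coefficients, make this finite.
\<close>

text \<open>\<open>(x + c y)\<^sup>n f(x, y)\<close> for \<open>c = \<plusminus>1\<close>, expanded in nonnegative powers of \<open>y\<close>.\<close>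

definition binomial_mult ::
  "(complex \<Rightarrow> 'w \<Rightarrow> 'w) \<Rightarrow> complex \<Rightarrow> int \<Rightarrow> (int \<Rightarrow> int \<Rightarrow> 'w::ab_group_add) \<Rightarrow> int \<Rightarrow> int \<Rightarrow> 'w" where
  "binomial_mult s c n f = (\<lambda>p q.
     Sum_any (\<lambda>i::nat. s ((of_int n gchoose i) * c ^ i) (f (p - (n - int i)) (q - int i))))"

text \<open>\<open>(-y + x)\<^sup>n f(x, y)\<close>, expanded in nonnegative powers of \<open>x\<close>.\<close>

definition binomial_mult_swapped ::
  "(complex \<Rightarrow> 'w \<Rightarrow> 'w) \<Rightarrow> int \<Rightarrow> (int \<Rightarrow> int \<Rightarrow> 'w::ab_group_add) \<Rightarrow> int \<Rightarrow> int \<Rightarrow> 'w" where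
  "binomial_mult_swapped s n f = (\<lambda>p q.
     Sum_any (\<lambda>i::nat. s ((of_int n gchoose i) * (-1) powi (n - int i))
                         (f (p - int i) (q - (n - int i)))))"

text \<open>
  \<open>f(x\<^sub>0 + x\<^sub>2, x\<^sub>2)\<close>, expanded in nonnegative powers of \<open>x\<^sub>2\<close>:  the coefficient of
  \<open>x\<^sub>0\<^sup>p x\<^sub>2\<^sup>q\<close> collects, for each \<open>i\<close>, the term \<open>f\<close> at exponents \<open>(p + i, q - i)\<close>, since
  \<open>(x\<^sub>0 + x\<^sub>2)\<^sup>p\<^sup>+\<^sup>i\<close> contributes \<open>binom(p + i, i) x\<^sub>0\<^sup>p x\<^sub>2\<^sup>i\<close>.
\<close>

definition subst_sum ::
  "(complex \<Rightarrow> 'w \<Rightarrow> 'w) \<Rightarrow> (int \<Rightarrow> int \<Rightarrow> 'w::ab_group_add) \<Rightarrow> int \<Rightarrow> int \<Rightarrow> 'w" where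
  "subst_sum s f = (\<lambda>p q.
     Sum_any (\<lambda>i::nat. s (of_int (p + int i) gchoose i) (f (p + int i) (q - int i))))"

subsection \<open>Weak axiomatic \<open>G\<^sub>1\<close>-vertex algebras and their modules\<close>

definition linear_between ::
  "(complex \<Rightarrow> 'v \<Rightarrow> 'v) \<Rightarrow> 'v set \<Rightarrow> (complex \<Rightarrow> 'w \<Rightarrow> 'w) \<Rightarrow> 'w set
    \<Rightarrow> ('v::ab_group_add \<Rightarrow> 'w::ab_group_add) \<Rightarrow> bool" where
  "linear_between s V s' W f \<longleftrightarrow> (\<forall>v\<in>V. f v \<in> W)
     \<and> (\<forall>v\<in>V. \<forall>v'\<in>V. f (v + v') = f v + f v')
     \<and> (\<forall>c. \<forall>v\<in>V. f (s c v) = s' c (f v))"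

definition id_operator :: "'w::zero \<Rightarrow> int \<Rightarrow> 'w" where
  "id_operator w = (\<lambda>n. if n = 0 then w else 0)"

text \<open>
  \<open>(x\<^sub>0 + x\<^sub>2)\<^sup>l Y\<^sub>W(u, x\<^sub>0 + x\<^sub>2) Y\<^sub>W(v, x\<^sub>2) w = (x\<^sub>0 + x\<^sub>2)\<^sup>l Y\<^sub>W(Y(u, x\<^sub>0) v, x\<^sub>2) w\<close>;
  here \<open>Y u v p\<close> is the coefficient of \<open>x\<^sup>p\<close> in \<open>Y(u, x) v\<close>.
\<close>

definition weak_associativity ::
  "('v \<Rightarrow> 'v \<Rightarrow> int \<Rightarrow> 'v) \<Rightarrow> (complex \<Rightarrow> 'w \<Rightarrow> 'w) \<Rightarrow> ('v \<Rightarrow> 'w \<Rightarrow> int \<Rightarrow> 'w::ab_group_add)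
    \<Rightarrow> nat \<Rightarrow> 'v \<Rightarrow> 'v \<Rightarrow> 'w \<Rightarrow> bool" where
  "weak_associativity Y s YW l u v w \<longleftrightarrow>
     binomial_mult s 1 (int l) (subst_sum s (\<lambda>p q. YW u (YW v w q) p))
     = binomial_mult s 1 (int l) (\<lambda>p q. YW (Y u v p) w q)"

text \<open>
  The underlying space is a subspace \<open>V\<close> of an ambient vector space; nothing is required of
  \<open>Y\<close> outside \<open>V\<close>.
\<close>

locale weak_axiomatic_G1_vertex_algebra = vector_space scale
  for scale :: "complex \<Rightarrow> 'v::ab_group_add \<Rightarrow> 'v" +
  fixes V :: "'v set" and Y :: "'v \<Rightarrow> 'v \<Rightarrow> int \<Rightarrow> 'v" and vac :: 'v
  assumes subspace_V: "subspace V"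
    and vac_in: "vac \<in> V"
    and Y_linear: "u \<in> V \<Longrightarrow> linear_between scale V scale V (\<lambda>v. Y u v p)"
    and Y_linear_left: "v \<in> V \<Longrightarrow> linear_between scale V scale V (\<lambda>u. Y u v p)"
    and Y_truncated: "u \<in> V \<Longrightarrow> v \<in> V \<Longrightarrow> lower_truncated (Y u v)"
    and Y_vac: "v \<in> V \<Longrightarrow> Y vac v = id_operator v"
    and creation_regular: "v \<in> V \<Longrightarrow> p < 0 \<Longrightarrow> Y v vac p = 0"
    and creation_limit: "v \<in> V \<Longrightarrow> Y v vac 0 = v"
    and weak_assoc: "u \<in> V \<Longrightarrow> v \<in> V \<Longrightarrow> w \<in> V \<Longrightarrow>
      \<exists>l. weak_associativity Y scale Y l u v w"

locale weak_axiomatic_G1_vertex_algebra_module =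
  weak_axiomatic_G1_vertex_algebra scale V Y vac + W: vector_space scaleW
  for scale :: "complex \<Rightarrow> 'v::ab_group_add \<Rightarrow> 'v" and V Y vac
    and scaleW :: "complex \<Rightarrow> 'w::ab_group_add \<Rightarrow> 'w" +
  fixes W :: "'w set" and YW :: "'v \<Rightarrow> 'w \<Rightarrow> int \<Rightarrow> 'w"
  assumes subspace_W: "W.subspace W"
    and YW_linear: "v \<in> V \<Longrightarrow> linear_between scaleW W scaleW W (\<lambda>w. YW v w p)"
    and YW_linear_left: "w \<in> W \<Longrightarrow> linear_between scale V scaleW W (\<lambda>v. YW v w p)"
    and YW_truncated: "v \<in> V \<Longrightarrow> w \<in> W \<Longrightarrow> lower_truncated (YW v w)"
    and YW_vac: "w \<in> W \<Longrightarrow> YW vac w = id_operator w"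
    and YW_weak_assoc: "u \<in> V \<Longrightarrow> v \<in> V \<Longrightarrow> w \<in> W \<Longrightarrow>
      \<exists>l. weak_associativity Y scaleW YW l u v w"

subsection \<open>Weak \<open>G\<^sub>1\<close>-vertex operators and compatibility\<close>

text \<open>\<open>Hom(W, W((x)))\<close>; the value \<open>a w n\<close> is the coefficient of \<open>x\<^sup>n\<close> in \<open>a(x) w\<close>.\<close>

definition weak_G1_vertex_operators ::
  "(complex \<Rightarrow> 'w \<Rightarrow> 'w) \<Rightarrow> ('w::ab_group_add \<Rightarrow> int \<Rightarrow> 'w) set" where
  "weak_G1_vertex_operators s =
     {a. (\<forall>n. Vector_Spaces.linear s s (\<lambda>w. a w n)) \<and> (\<forall>w. lower_truncated (a w))}"

definition operator_scale ::
  "(complex \<Rightarrow> 'w \<Rightarrow> 'w) \<Rightarrow> complex \<Rightarrow> ('w \<Rightarrow> int \<Rightarrow> 'w) \<Rightarrow> 'w \<Rightarrow> int \<Rightarrow> 'w" where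
  "operator_scale s c a = (\<lambda>w n. s c (a w n))"

text \<open>
  The coefficient of \<open>x\<^sub>1\<^sup>m\<^sup>1 \<dots> x\<^sub>r\<^sup>m\<^sup>r\<close> in \<open>\<psi>\<^sup>(\<^sup>1\<^sup>)(x\<^sub>1) \<dots> \<psi>\<^sup>(\<^sup>r\<^sup>)(x\<^sub>r) w\<close>;
  it is meaningful only when the two lists have equal length.
\<close>

fun operator_product :: "('w::zero \<Rightarrow> int \<Rightarrow> 'w) list \<Rightarrow> 'w \<Rightarrow> int list \<Rightarrow> 'w" where
  "operator_product [] w [] = w"
| "operator_product (\<psi> # \<psi>s) w (m # ms) = \<psi> (operator_product \<psi>s w ms) m"
| "operator_product _ w _ = 0"

text \<open>Multiplication by \<open>x\<^sub>i - x\<^sub>j\<close>, variables being numbered from \<open>0\<close>.\<close>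

definition mult_diff :: "nat \<Rightarrow> nat \<Rightarrow> (int list \<Rightarrow> 'w::ab_group_add) \<Rightarrow> int list \<Rightarrow> 'w" where
  "mult_diff i j f = (\<lambda>ms. f (ms[i := ms ! i - 1]) - f (ms[j := ms ! j - 1]))"

text \<open>Multiplication by the product of \<open>(x\<^sub>i - x\<^sub>j)\<^sup>k\<close> over \<open>i < j < r\<close>.\<close>

definition mult_diffs :: "nat \<Rightarrow> nat \<Rightarrow> (int list \<Rightarrow> 'w::ab_group_add) \<Rightarrow> int list \<Rightarrow> 'w" where
  "mult_diffs r k f =
     fold (\<lambda>(i, j). mult_diff i j ^^ k) [(i, j). i \<leftarrow> [0..<r], j \<leftarrow> [Suc i..<r]] f"

text \<open>
  \<open>\<Prod> (x\<^sub>i - x\<^sub>j)\<^sup>k \<psi>\<^sup>(\<^sup>1\<^sup>)(x\<^sub>1) \<dots> \<psi>\<^sup>(\<^sup>r\<^sup>)(x\<^sub>r) \<in> Hom(W, W((x\<^sub>1, \<dots>, x\<^sub>r)))\<close>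
\<close>

definition compatible_order ::
  "(complex \<Rightarrow> 'w \<Rightarrow> 'w) \<Rightarrow> nat \<Rightarrow> ('w::ab_group_add \<Rightarrow> int \<Rightarrow> 'w) list \<Rightarrow> bool" where
  "compatible_order s k \<psi>s \<longleftrightarrow> (let r = length \<psi>s;
       F = (\<lambda>w. mult_diffs r k (operator_product \<psi>s w))
     in (\<forall>ms. length ms = r \<longrightarrow> Vector_Spaces.linear s s (\<lambda>w. F w ms))
        \<and> (\<forall>w. lower_truncated_multi r (F w)))"

definition compatible_seq ::
  "(complex \<Rightarrow> 'w \<Rightarrow> 'w) \<Rightarrow> ('w::ab_group_add \<Rightarrow> int \<Rightarrow> 'w) list \<Rightarrow> bool" where
  "compatible_seq s \<psi>s \<longleftrightarrow>
     set \<psi>s \<subseteq> weak_G1_vertex_operators s \<and> (\<exists>k. compatible_order s k \<psi>s)"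

definition compatible_set ::
  "(complex \<Rightarrow> 'w \<Rightarrow> 'w) \<Rightarrow> ('w::ab_group_add \<Rightarrow> int \<Rightarrow> 'w) set \<Rightarrow> bool" where
  "compatible_set s S \<longleftrightarrow>
     S \<subseteq> weak_G1_vertex_operators s \<and> (\<forall>\<psi>s. set \<psi>s \<subseteq> S \<longrightarrow> compatible_seq s \<psi>s)"

definition G1_vertex_operators ::
  "(complex \<Rightarrow> 'w \<Rightarrow> 'w) \<Rightarrow> ('w::ab_group_add \<Rightarrow> int \<Rightarrow> 'w) set" where
  "G1_vertex_operators s = {a \<in> weak_G1_vertex_operators s. compatible_set s {a}}"

subsection \<open>The products \<open>a(x)\<^sub>n b(x)\<close>\<close>

text \<open>
  \<open>T(a(x) b(y)) w = (-y + x)\<^sup>-\<^sup>k ((x - y)\<^sup>k a(x) b(y) w)\<close>. Any admissible \<open>k\<close> gives the same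
  series, so one is chosen; the value is meaningful only if \<open>(a(x), b(x))\<close> is compatible.
\<close>

definition T_operator ::
  "(complex \<Rightarrow> 'w \<Rightarrow> 'w) \<Rightarrow> ('w::ab_group_add \<Rightarrow> int \<Rightarrow> 'w) \<Rightarrow> ('w \<Rightarrow> int \<Rightarrow> 'w)
    \<Rightarrow> 'w \<Rightarrow> int \<Rightarrow> int \<Rightarrow> 'w" where
  "T_operator s a b w = (let k = (SOME k. compatible_order s k [a, b])
     in binomial_mult_swapped s (- int k)
          (\<lambda>p q. mult_diffs 2 k (operator_product [a, b] w) [p, q]))"

text \<open>
  \<open>a(x)\<^sub>n b(x) = Res ((x\<^sub>1 - x)\<^sup>n a(x\<^sub>1) b(x) - (-x + x\<^sub>1)\<^sup>n T(a(x\<^sub>1) b(x)))\<close>, the residue being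
  the coefficient of \<open>x\<^sub>1\<^sup>-\<^sup>1\<close>.
\<close>

definition nth_product ::
  "(complex \<Rightarrow> 'w \<Rightarrow> 'w) \<Rightarrow> ('w::ab_group_add \<Rightarrow> int \<Rightarrow> 'w) \<Rightarrow> int \<Rightarrow> ('w \<Rightarrow> int \<Rightarrow> 'w)
    \<Rightarrow> 'w \<Rightarrow> int \<Rightarrow> 'w" where
  "nth_product s a n b = (\<lambda>w m.
     binomial_mult s (-1) n (\<lambda>p q. operator_product [a, b] w [p, q]) (-1) m
     - binomial_mult_swapped s n (T_operator s a b w) (-1) m)"

definition Y_E ::
  "(complex \<Rightarrow> 'w \<Rightarrow> 'w) \<Rightarrow> ('w::ab_group_add \<Rightarrow> int \<Rightarrow> 'w) \<Rightarrow> ('w \<Rightarrow> int \<Rightarrow> 'w)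
    \<Rightarrow> int \<Rightarrow> 'w \<Rightarrow> int \<Rightarrow> 'w" where
  "Y_E s a b = (\<lambda>p. nth_product s a (- p - 1) b)"

text \<open>
  The list \<open>[(a\<^sub>1, n\<^sub>1), \<dots>, (a\<^sub>r, n\<^sub>r)]\<close> encodes the iterated product with factors \<open>a\<^sub>i\<close> and
  modes \<open>n\<^sub>i\<close>, applied to the identity operator.
\<close>

fun iterated_product ::
  "(complex \<Rightarrow> 'w \<Rightarrow> 'w) \<Rightarrow> (('w::ab_group_add \<Rightarrow> int \<Rightarrow> 'w) \<times> int) list \<Rightarrow> 'w \<Rightarrow> int \<Rightarrow> 'w" where
  "iterated_product s [] = id_operator"
| "iterated_product s ((a, n) # ps) = nth_product s a n (iterated_product s ps)"

fun iterated_product_defined ::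
  "(complex \<Rightarrow> 'w \<Rightarrow> 'w) \<Rightarrow> (('w::ab_group_add \<Rightarrow> int \<Rightarrow> 'w) \<times> int) list \<Rightarrow> bool" where
  "iterated_product_defined s [] \<longleftrightarrow> True"
| "iterated_product_defined s ((a, n) # ps) \<longleftrightarrow>
     iterated_product_defined s ps \<and> compatible_seq s [a, iterated_product s ps]"

definition iterated_product_span ::
  "(complex \<Rightarrow> 'w \<Rightarrow> 'w) \<Rightarrow> ('w::ab_group_add \<Rightarrow> int \<Rightarrow> 'w) set \<Rightarrow> ('w \<Rightarrow> int \<Rightarrow> 'w) set" where
  "iterated_product_span s S =
     module.span (operator_scale s) {iterated_product s ps | ps. fst ` set ps \<subseteq> S}"

end

theory Submission
  imports Defs "HOL-Computational_Algebra.Formal_Power_Series"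
begin

text \<open>A compatible pair is governed by \<open>A(x\<^sub>1, x) = (x\<^sub>1 - x)\<^sup>k a(x\<^sub>1) b(x)\<close>: up to the factor
  \<open>z\<^sup>-\<^sup>k\<close>, the series \<open>Y\<^sub>E(a, z) b\<close> is the Taylor expansion \<open>A(x + z, x)\<close>, so \<open>a\<^sub>n b\<close> is a divided
  derivative of \<open>A\<close> restricted to the diagonal. Restricting to \<open>x\<^sub>u = x\<^sub>v\<close> turns \<open>x\<^sub>i - x\<^sub>u\<close> into
  \<open>x\<^sub>i - x\<^sub>v\<close> up to lower derivatives, hence replacing two adjacent members of a compatible
  sequence by their \<open>n\<close>-th product keeps it compatible. By Zorn's lemma \<open>S\<close> lies in a maximal
  compatible set, which is therefore a space closed under all products. For three operators both
  \<open>Y(a, z\<^sub>1) Y(b, z\<^sub>2) c\<close> and \<open>Y(Y(a, z\<^sub>0) b, z\<^sub>2) c\<close> are Taylor expansions of one series, and weak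
  associativity is the substitution \<open>z\<^sub>1 = z\<^sub>0 + z\<^sub>2\<close>.\<close>

subsection \<open>Series in two variables\<close>

text \<open>The diagonal enters through the residue: \<open>a(x1) b(x)\<close> and its
  \<open>T\<close>-transform are the two expansions of \<open>(x1 - x)^(-k) A\<close>, and the two
  expansions of \<open>(x1 - x)^(n-k)\<close> differ by a derivative of a formal delta function. The
  order of that derivative is \<open>k - 1 - n\<close>, the origin of the index
  \<open>int k - 1 - n\<close>.

  What shapes the proof is a lack of uniformity. The number of factors that make \<open>a\<close>
  compatible with a mode of \<open>Y(b, z) c\<close> may grow with the order of the derivative, so
  no single exponent is at hand for the whole series. Arguments on three operators therefore work
  below a bound \<open>J\<close> on that order, carry surplus factors, and remove them once the
  answer is expressed by the three-variable series.

  Maximality replaces an induction over the elements of \<open>U\<close>: only a single insertion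
  into a compatible sequence has to be examined. It does not make \<open>U\<close> closed under
  products, since \<open>U\<close> is generated by multiplying with elements of \<open>S\<close> on
  the left; arbitrary left factors are reached by reading weak associativity backwards.\<close>

lemma Sum_any_nat_Suc:
  fixes g :: "nat \<Rightarrow> 'a::ab_group_add"
  assumes "\<And>i. i > K \<Longrightarrow> g i = 0"
  shows "Sum_any g = g 0 + Sum_any (\<lambda>i. g (Suc i))"
proof -
  have "i \<le> K" if "g i \<noteq> 0" for i
    using assms that by (meson not_le)
  then have zero: "{i. g i \<noteq> 0} \<subseteq> {..K}" "{i. g (Suc i) \<noteq> 0} \<subseteq> {..<K}"
    by (auto simp: less_eq_Suc_le)
  have "Sum_any g = sum g {..K}"
    by (rule Sum_any.expand_superset[OF _ zero(1)]) simp
  also have "\<dots> = g 0 + sum (\<lambda>i. g (Suc i)) {..<K}"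
    by (rule sum.atMost_shift)
  also have "sum (\<lambda>i. g (Suc i)) {..<K} = Sum_any (\<lambda>i. g (Suc i))"
    by (rule Sum_any.expand_superset[OF _ zero(2), symmetric]) simp
  finally show ?thesis .
qed

lemma Sum_any_diff:
  fixes g h :: "'b \<Rightarrow> 'a::ab_group_add"
  assumes "finite {a. g a \<noteq> 0}" "finite {a. h a \<noteq> 0}"
  shows "Sum_any (\<lambda>a. g a - h a) = Sum_any g - Sum_any h"
proof -
  let ?A = "{a. g a \<noteq> 0} \<union> {a. h a \<noteq> 0}"
  have f: "finite ?A" using assms by simp
  have "{a. g a - h a \<noteq> 0} \<subseteq> ?A" by auto
  then show ?thesis
    using f by (simp add: Sum_any.expand_superset[of ?A] sum_subtractf)
qed

lemma Sum_any_additive: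
  fixes g :: "'b \<Rightarrow> 'a::ab_group_add" and h :: "'a \<Rightarrow> 'c::ab_group_add"
  assumes "finite {a. g a \<noteq> 0}" and "\<And>x y. h (x + y) = h x + h y"
  shows "h (Sum_any g) = Sum_any (\<lambda>a. h (g a))"
proof -
  interpret additive h using assms(2) by unfold_locales
  have "{a. h (g a) \<noteq> 0} \<subseteq> {a. g a \<noteq> 0}" using zero by auto
  then have "Sum_any (\<lambda>a. h (g a)) = sum (\<lambda>a. h (g a)) {a. g a \<noteq> 0}"
    using assms(1) by (rule Sum_any.expand_superset[rotated])
  then show ?thesis
    by (simp add: Sum_any.expand_set sum)
qed

text \<open>The value \<open>0\<close> at negative \<open>j\<close> makes Pascal's rule hold for every integer \<open>j\<close>.\<close>

definition zchoose :: "int \<Rightarrow> int \<Rightarrow> complex" where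
  "zchoose p j = (if j < 0 then 0 else of_int p gchoose nat j)"

lemma zchoose_neg [simp]: "j < 0 \<Longrightarrow> zchoose p j = 0"
  by (simp add: zchoose_def)

lemma zchoose_0_right [simp]: "zchoose p 0 = 1"
  by (simp add: zchoose_def)

lemma zchoose_int: "zchoose p (int j) = of_int p gchoose j"
  by (simp add: zchoose_def)

lemma zchoose_add_one: "zchoose (p + 1) j = zchoose p j + zchoose p (j - 1)"
proof (cases "j \<le> 0")
  case True
  then show ?thesis by (cases "j = 0") (auto simp: zchoose_def)
next
  case False
  define i where "i = nat (j - 1)"
  have j: "j = int (Suc i)" "j - 1 = int i" using False by (auto simp: i_def)
  have "zchoose (p + 1) (int (Suc i)) = zchoose p (int i) + zchoose p (int (Suc i))"
    unfolding zchoose_int using gbinomial_Suc_Suc[of "of_int p :: complex" i] by simp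
  then show ?thesis unfolding j(2) unfolding j(1) by (subst add.commute)
qed

lemma zchoose_of_nat: "zchoose (int n) (int k) = of_nat (n choose k)"
  by (simp add: zchoose_def binomial_gbinomial)

lemma zchoose_eq_0: "0 \<le> p \<Longrightarrow> p < j \<Longrightarrow> zchoose p j = 0"
  using zchoose_of_nat[of "nat p" "nat j"] by simp

text \<open>Outside \<open>0..p\<close> both sides are zero by convention, so no range condition on
  \<open>j\<close> remains. This identity lets an expansion of a nonnegative power in one summand be
  read as an expansion in the other.\<close>

lemma zchoose_symmetric:
  assumes "0 \<le> p" shows "zchoose p j = zchoose p (p - j)"
proof (cases "0 \<le> j \<and> j \<le> p")
  case True
  define n k where "n = nat p" and "k = nat j"
  have "p = int n" "j = int k" "k \<le> n" "p - j = int (n - k)"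
    using True by (auto simp: n_def k_def)
  then show ?thesis using binomial_symmetric[of k n] by (simp only: zchoose_of_nat)
next
  case False
  then show ?thesis using zchoose_eq_0[OF assms, of j] zchoose_eq_0[OF assms, of "p - j"]
    by (cases "j < 0") auto
qed

lemma zchoose_minus: 
  "zchoose (- p) (int i) = (-1) ^ i * zchoose (p + int i - 1) (int i)"
  by (simp add: zchoose_int gbinomial_minus)

text \<open>Multiplying by a variable lowers the exponent at which a coefficient is read, so
  \<open>diff2\<close> is multiplication by \<open>x1 - x2\<close> and \<open>sum2\<close> is
  multiplication by \<open>x1 + x2\<close>.\<close>

definition diff2 :: "(int \<Rightarrow> int \<Rightarrow> 'w::ab_group_add) \<Rightarrow> int \<Rightarrow> int \<Rightarrow> 'w" where
  "diff2 g = (\<lambda>p q. g (p - 1) q - g p (q - 1))"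

definition sum2 :: "(int \<Rightarrow> int \<Rightarrow> 'w::ab_group_add) \<Rightarrow> int \<Rightarrow> int \<Rightarrow> 'w" where
  "sum2 g = (\<lambda>p q. g (p - 1) q + g p (q - 1))"

text \<open>Setting \<open>x1 = x2\<close> collects all terms of one total degree, so this is what a
  restriction to the diagonal needs. It is weaker than \<open>trunc2\<close>: a series in many
  variables can be restricted in two of them before it is known to be truncated in the
  others.\<close>

definition finite_diag :: "(int \<Rightarrow> int \<Rightarrow> 'w::zero) \<Rightarrow> bool" where
  "finite_diag g \<longleftrightarrow> (\<forall>c. finite {p. g p (c - p) \<noteq> 0})"

definition trunc2 :: "(int \<Rightarrow> int \<Rightarrow> 'w::zero) \<Rightarrow> bool" where
  "trunc2 g \<longleftrightarrow> (\<exists>N. \<forall>p q. p < N \<or> q < N \<longrightarrow> g p q = 0)"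

text \<open>The one-sided bounds match the two expansions: \<open>binomial_mult\<close> runs through
  nonnegative powers of the second variable, \<open>binomial_mult_swapped\<close> through those of
  the first.\<close>

definition bounded_snd :: "(int \<Rightarrow> int \<Rightarrow> 'w::zero) \<Rightarrow> bool" where
  "bounded_snd g \<longleftrightarrow> (\<exists>N. \<forall>p. \<forall>q<N. g p q = 0)"

definition bounded_fst :: "(int \<Rightarrow> int \<Rightarrow> 'w::zero) \<Rightarrow> bool" where
  "bounded_fst g \<longleftrightarrow> (\<exists>N. \<forall>p<N. \<forall>q. g p q = 0)"

lemma trunc2_iff: "trunc2 g \<longleftrightarrow> bounded_fst g \<and> bounded_snd g"
proof
  assume "bounded_fst g \<and> bounded_snd g"
  then obtain N M where N: "\<And>p q. p < N \<Longrightarrow> g p q = 0" and M: "\<And>p q. q < M \<Longrightarrow> g p q = 0"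
    by (auto simp: bounded_fst_def bounded_snd_def)
  have "\<forall>p q. p < min N M \<or> q < min N M \<longrightarrow> g p q = 0"
    using N M by (meson min_less_iff_conj)
  then show "trunc2 g" unfolding trunc2_def by blast
qed (auto simp: trunc2_def bounded_fst_def bounded_snd_def)

lemma trunc2_imp_finite_diag:
  assumes "trunc2 g" shows "finite_diag g"
proof -
  obtain N where N: "\<And>p q. p < N \<or> q < N \<Longrightarrow> g p q = 0" using assms by (auto simp: trunc2_def)
  have "{p. g p (c - p) \<noteq> 0} \<subseteq> {N..c-N}" for c
  proof
    fix p assume "p \<in> {p. g p (c - p) \<noteq> 0}"
    then have "\<not> (p < N \<or> c - p < N)" using N by blast
    then show "p \<in> {N..c-N}" by auto
  qed
  then show ?thesis unfolding finite_diag_def by (meson finite_atLeastAtMost_int finite_subset)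
qed

lemma fin2D: "finite_diag g \<Longrightarrow> finite {p. g p (c - p) \<noteq> 0}"
  by (simp add: finite_diag_def)

lemma finite_diag_shift_fst:
  assumes "finite_diag g" shows "finite_diag (\<lambda>p q. g (p - 1) q)"
proof -
  have "finite ((\<lambda>p. p - 1) -` {p. g p ((c - 1) - p) \<noteq> 0})" for c :: int
    by (rule finite_vimageI[OF fin2D[OF assms]]) (simp add: inj_def)
  then show ?thesis by (simp add: finite_diag_def vimage_def)
qed

lemma finite_diag_shift_snd:
  assumes "finite_diag g" shows "finite_diag (\<lambda>p q. g p (q - 1))"
proof -
  have eq: "c - p - 1 = (c - 1) - p" for c p :: int
    by simp
  show ?thesis unfolding finite_diag_def eq using fin2D[OF assms] by blast
qed

lemma finite_diag_zero_unless:
  assumes "finite_diag f" "finite_diag g" "\<And>p q. f p q = 0 \<Longrightarrow> g p q = 0 \<Longrightarrow> h p q = 0"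
  shows "finite_diag h"
proof -
  have "{p. h p (c - p) \<noteq> 0} \<subseteq> {p. f p (c - p) \<noteq> 0} \<union> {p. g p (c - p) \<noteq> 0}" for c
    using assms(3) by auto
  then show ?thesis using assms(1,2) unfolding finite_diag_def by (meson finite_UnI finite_subset)
qed

lemma finite_diag_diff2: "finite_diag g \<Longrightarrow> finite_diag (diff2 g)"
  unfolding diff2_def
  by (rule finite_diag_zero_unless[OF finite_diag_shift_fst finite_diag_shift_snd]) auto

lemma bounded_snd_diff2:
  assumes "bounded_snd g" shows "bounded_snd (diff2 g)"
proof -
  obtain N where "\<And>p q. q < N \<Longrightarrow> g p q = 0" using assms by (auto simp: bounded_snd_def)
  then have "\<forall>p. \<forall>q<N. diff2 g p q = 0" by (simp add: diff2_def)
  then show ?thesis unfolding bounded_snd_def by blast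
qed

lemma bounded_snd_sum2:
  assumes "bounded_snd g" shows "bounded_snd (sum2 g)"
proof -
  obtain N where "\<And>p q. q < N \<Longrightarrow> g p q = 0" using assms by (auto simp: bounded_snd_def)
  then have "\<forall>p. \<forall>q<N. sum2 g p q = 0" by (simp add: sum2_def)
  then show ?thesis unfolding bounded_snd_def by blast
qed

lemma bounded_fst_diff2:
  assumes "bounded_fst g" shows "bounded_fst (diff2 g)"
proof -
  obtain N where "\<And>p q. p < N \<Longrightarrow> g p q = 0" using assms by (auto simp: bounded_fst_def)
  then have "\<forall>p<N. \<forall>q. diff2 g p q = 0" by (simp add: diff2_def)
  then show ?thesis unfolding bounded_fst_def by blast
qed

lemma funpow_preserves:
  assumes "\<And>x. P x \<Longrightarrow> P (h x)" "P x" shows "P ((h ^^ k) x)"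
  using assms by (induction k) auto

locale series_space = vector_space s for s :: "complex \<Rightarrow> 'w::ab_group_add \<Rightarrow> 'w"
begin

text \<open>The coefficient of \<open>x\<^sup>m\<close> in the \<open>j\<close>-th divided derivative of \<open>g(x\<^sub>1, x\<^sub>2)\<close> in \<open>x\<^sub>1\<close>, restricted
  to \<open>x\<^sub>1 = x\<^sub>2 = x\<close>; it makes sense when \<open>g\<close> has finitely many terms of each total degree.\<close>

definition res2 :: "int \<Rightarrow> (int \<Rightarrow> int \<Rightarrow> 'w) \<Rightarrow> int \<Rightarrow> 'w" where
  "res2 j g m = Sum_any (\<lambda>p. s (zchoose p j) (g p (m + j - p)))"

lemma finite_res2: "finite_diag g \<Longrightarrow> finite {p. s (h p) (g p (c - p)) \<noteq> 0}"
  by (rule finite_subset[OF _ fin2D[of g c]]) auto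

lemma res2_neg [simp]: "j < 0 \<Longrightarrow> res2 j g m = 0"
  by (simp add: res2_def)

lemma res2_shift_snd: "res2 j (\<lambda>p q. g p (q - 1)) m = res2 j g (m - 1)"
  by (simp add: res2_def algebra_simps)

lemma res2_add:
  "finite_diag f \<Longrightarrow> finite_diag g \<Longrightarrow> res2 j (\<lambda>p q. f p q + g p q) m = res2 j f m + res2 j g m"
  unfolding res2_def scale_right_distrib by (rule Sum_any.distrib; rule finite_res2)

lemma res2_diff:
  "finite_diag f \<Longrightarrow> finite_diag g \<Longrightarrow> res2 j (\<lambda>p q. f p q - g p q) m = res2 j f m - res2 j g m"
  unfolding res2_def scale_right_diff_distrib by (rule Sum_any_diff; rule finite_res2)

lemma res2_additive:
  assumes "finite_diag f" "\<And>x y. h (x + y) = h x + h y" "\<And>c x. h (s c x) = s c (h x)"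
  shows "h (res2 j f m) = res2 j (\<lambda>p q. h (f p q)) m"
  unfolding res2_def
  by (subst Sum_any_additive[where h=h]) (simp_all only: assms(2,3) finite_res2[OF assms(1)])

text \<open>Leibniz rule for the product of \<open>x1\<close> and \<open>g\<close>: the derivative
  hits \<open>x1\<close> at most once. On coefficients it is Pascal's rule.\<close>

lemma res2_shift_fst:
  assumes "finite_diag g"
  shows "res2 j (\<lambda>p q. g (p - 1) q) m = res2 j g (m - 1) + res2 (j - 1) g m"
proof -
  have eq: "m + (j - 1) = m - 1 + j" by simp
  have "res2 j (\<lambda>p q. g (p - 1) q) m = Sum_any (\<lambda>p. s (zchoose (p + 1) j) (g p (m - 1 + j - p)))"
    unfolding res2_def
    by (rule Sum_any.reindex_cong[of "\<lambda>p. p + 1"])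
      (auto simp: fun_eq_iff algebra_simps intro!: bijI' exI[of _ "_ - 1"])
  also have "\<dots> = Sum_any (\<lambda>p. s (zchoose p j) (g p (m - 1 + j - p)) + s (zchoose p (j - 1)) (g p (m - 1 + j - p)))"
    by (simp add: zchoose_add_one scale_left_distrib)
  also have "\<dots> = res2 j g (m - 1) + res2 (j - 1) g m"
    unfolding res2_def eq by (rule Sum_any.distrib; rule finite_res2[OF assms])
  finally show ?thesis .
qed

text \<open>The factor \<open>x1 - x2\<close> vanishes on the diagonal, so only the Leibniz term in
  which it has been differentiated survives. Trading factors for orders in this way is the main
  computational device.\<close>

lemma res2_diff2: "finite_diag g \<Longrightarrow> res2 j (diff2 g) m = res2 (j - 1) g m"
  by (simp add: diff2_def res2_diff finite_diag_shift_fst finite_diag_shift_snd res2_shift_fst res2_shift_snd)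

lemma res2_diff2_pow: "finite_diag g \<Longrightarrow> res2 j ((diff2 ^^ k) g) m = res2 (j - int k) g m"
  by (induction k arbitrary: g) (simp_all add: funpow_Suc_right finite_diag_diff2 res2_diff2 algebra_simps del: funpow.simps)

section \<open>Binomial expansions as repeated multiplication by one linear factor\<close>

lemma binomial_mult_0 [simp]: "binomial_mult s c 0 g = g"
proof (intro ext)
  fix p q
  have "(\<lambda>i. s ((of_int 0 gchoose i) * c ^ i) (g (p - (0 - int i)) (q - int i))) =
    (\<lambda>i. if i = 0 then g p q else 0)"
    by (auto simp: gbinomial_0_left)
  then show "binomial_mult s c 0 g p q = g p q"
    unfolding binomial_mult_def by (simp only: Sum_any.delta)
qed

text \<open>One factor \<open>x + c y\<close> moves from the power to the series, by Pascal's rule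
  for an arbitrary integer exponent. For negative \<open>n\<close> the expansion is infinite, and
  the bound in the second variable keeps every sum that is split finite.\<close>

lemma binomial_mult_step:
  assumes "bounded_snd g"
  shows "binomial_mult s c n g = binomial_mult s c (n - 1) (\<lambda>p q. g (p - 1) q + s c (g p (q - 1)))"
proof (intro ext)
  fix p q
  obtain N where N: "\<And>p q. q < N \<Longrightarrow> g p q = 0" using assms by (auto simp: bounded_snd_def)
  define h where "h i = g (p - n + int i) (q - int i)" for i :: nat
  define K where "K = nat (q - N)"
  have h: "h i = 0" if "i > K" for i
    using that unfolding h_def K_def by (intro N) auto
  have fin: "finite {i. s (t i) (h i) \<noteq> 0}" for t
    by (rule finite_subset[of _ "{..K}"]) (use h in \<open>auto simp: not_less[symmetric]\<close>)
  have fin': "finite {i. s (t i) (h (Suc i)) \<noteq> 0}" for t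
    by (rule finite_subset[of _ "{..K}"]) (use h in \<open>auto simp: not_less[symmetric]\<close>)
  let ?N = "of_int n :: complex"
  have gb: "?N gchoose Suc i = ((?N - 1) gchoose Suc i) + ((?N - 1) gchoose i)" for i
    using gbinomial_Suc_Suc[of "?N - 1" i] by simp
  have "binomial_mult s c n g p q = Sum_any (\<lambda>i. s ((?N gchoose i) * c ^ i) (h i))"
    unfolding binomial_mult_def h_def by (simp add: algebra_simps)
  also have "\<dots> = h 0 + Sum_any (\<lambda>i. s ((?N gchoose Suc i) * c ^ Suc i) (h (Suc i)))"
    by (subst Sum_any_nat_Suc[where K=K]) (simp_all add: h)
  also have "\<dots> = h 0 + Sum_any (\<lambda>i. s (((?N - 1) gchoose Suc i) * c ^ Suc i) (h (Suc i))
        + s (((?N - 1) gchoose i) * c ^ Suc i) (h (Suc i)))"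
    by (simp only: gb distrib_right scale_left_distrib)
  also have "\<dots> = h 0 + Sum_any (\<lambda>i. s (((?N - 1) gchoose Suc i) * c ^ Suc i) (h (Suc i)))
        + Sum_any (\<lambda>i. s (((?N - 1) gchoose i) * c ^ Suc i) (h (Suc i)))"
    by (subst Sum_any.distrib) (simp_all only: fin' add.assoc)
  also have "h 0 + Sum_any (\<lambda>i. s (((?N - 1) gchoose Suc i) * c ^ Suc i) (h (Suc i)))
     = Sum_any (\<lambda>i. s (((?N - 1) gchoose i) * c ^ i) (h i))"
    by (subst Sum_any_nat_Suc[where K=K and g="\<lambda>i. s (((?N - 1) gchoose i) * c ^ i) (h i)"]) (simp_all add: h)
  also have "\<dots> + Sum_any (\<lambda>i. s (((?N - 1) gchoose i) * c ^ Suc i) (h (Suc i)))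
     = Sum_any (\<lambda>i. s (((?N - 1) gchoose i) * c ^ i) (h i) + s (((?N - 1) gchoose i) * c ^ Suc i) (h (Suc i)))"
    by (subst Sum_any.distrib) (simp_all only: fin fin')
  also have "\<dots> = binomial_mult s c (n - 1) (\<lambda>p q. g (p - 1) q + s c (g p (q - 1))) p q"
    unfolding binomial_mult_def h_def
    by (simp add: scale_right_distrib algebra_simps)
  finally show "binomial_mult s c n g p q = binomial_mult s c (n - 1) (\<lambda>p q. g (p - 1) q + s c (g p (q - 1))) p q" .
qed

lemma binomial_mult_diff2:
  assumes "bounded_snd g"
  shows "binomial_mult s (-1) n g = binomial_mult s (-1) (n - int k) ((diff2 ^^ k) g)"
  using assms
proof (induction k arbitrary: g n)
  case (Suc k)
  have "binomial_mult s (-1) n g = binomial_mult s (-1) (n - 1) (diff2 g)"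
    by (subst binomial_mult_step[OF Suc.prems]) (simp add: diff2_def)
  also have "\<dots> = binomial_mult s (-1) (n - 1 - int k) ((diff2 ^^ k) (diff2 g))"
    by (rule Suc.IH[OF bounded_snd_diff2[OF Suc.prems]])
  finally show ?case by (simp add: funpow_swap1 algebra_simps)
qed simp

lemma binomial_mult_sum2:
  assumes "bounded_snd g"
  shows "binomial_mult s 1 (int k) g = (sum2 ^^ k) g"
  using assms
proof (induction k arbitrary: g)
  case (Suc k)
  have "binomial_mult s 1 (int (Suc k)) g = binomial_mult s 1 (int k) (sum2 g)"
    by (subst binomial_mult_step[OF Suc.prems]) (simp add: sum2_def)
  also have "\<dots> = (sum2 ^^ k) (sum2 g)"
    by (rule Suc.IH[OF bounded_snd_sum2[OF Suc.prems]])
  finally show ?case by (simp add: funpow_swap1)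
qed simp

lemma binomial_mult_swapped_0 [simp]: "binomial_mult_swapped s 0 g = g"
proof (intro ext)
  fix p q
  have "(\<lambda>i. s ((of_int 0 gchoose i) * (-1) powi (0 - int i)) (g (p - int i) (q - (0 - int i)))) =
    (\<lambda>i. if i = 0 then g p q else 0)"
    by (auto simp: gbinomial_0_left)
  then show "binomial_mult_swapped s 0 g p q = g p q"
    unfolding binomial_mult_swapped_def by (simp only: Sum_any.delta)
qed

lemma binomial_mult_swapped_step:
  assumes "bounded_fst g"
  shows "binomial_mult_swapped s n g = binomial_mult_swapped s (n - 1) (diff2 g)"
proof (intro ext)
  fix p q
  obtain N where N: "\<And>p q. p < N \<Longrightarrow> g p q = 0" using assms by (auto simp: bounded_fst_def)
  define h where "h i = g (p - int i) (q - n + int i)" for i :: nat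
  define K where "K = nat (p - N)"
  have h: "h i = 0" if "i > K" for i
    using that unfolding h_def K_def by (intro N) auto
  have fin: "finite {i. s (t i) (h i) \<noteq> 0}" for t
    by (rule finite_subset[of _ "{..K}"]) (use h in \<open>auto simp: not_less[symmetric]\<close>)
  have fin': "finite {i. s (t i) (h (Suc i)) \<noteq> 0}" for t
    by (rule finite_subset[of _ "{..K}"]) (use h in \<open>auto simp: not_less[symmetric]\<close>)
  let ?N = "of_int n :: complex"
  have gb: "?N gchoose Suc i = ((?N - 1) gchoose Suc i) + ((?N - 1) gchoose i)" for i
    using gbinomial_Suc_Suc[of "?N - 1" i] by simp
  define e where "e i = (-1 :: complex) powi (n - int i)" for i
  have eS: "e i = - e (Suc i)" for i
  proof -
    have "e i = (-1) powi ((n - int (Suc i)) + 1)" by (simp add: e_def)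
    also have "\<dots> = - e (Suc i)" by (subst power_int_add) (simp_all add: e_def)
    finally show ?thesis .
  qed
  have e': "(-1 :: complex) powi (n - 1 - int i) = e (Suc i)" for i
    by (simp add: e_def algebra_simps)
  have combine: "s (c * e i) (h i) + s (c * e (Suc i)) (h (Suc i)) =
      s (c * e (Suc i)) (diff2 g (p - int i) (q - (n - 1 - int i)))" for c i
    unfolding eS[of i] diff2_def h_def by (simp add: scale_right_diff_distrib algebra_simps)
  have "binomial_mult_swapped s n g p q = Sum_any (\<lambda>i. s ((?N gchoose i) * e i) (h i))"
    unfolding binomial_mult_swapped_def h_def e_def by (simp add: algebra_simps)
  also have "\<dots> = s (e 0) (h 0) + Sum_any (\<lambda>i. s ((?N gchoose Suc i) * e (Suc i)) (h (Suc i)))"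
    by (subst Sum_any_nat_Suc[where K=K]) (simp_all add: h)
  also have "\<dots> = s (e 0) (h 0) + Sum_any (\<lambda>i. s (((?N - 1) gchoose Suc i) * e (Suc i)) (h (Suc i))
        + s (((?N - 1) gchoose i) * e (Suc i)) (h (Suc i)))"
    by (simp only: gb distrib_right scale_left_distrib)
  also have "\<dots> = s (e 0) (h 0) + Sum_any (\<lambda>i. s (((?N - 1) gchoose Suc i) * e (Suc i)) (h (Suc i)))
        + Sum_any (\<lambda>i. s (((?N - 1) gchoose i) * e (Suc i)) (h (Suc i)))"
    by (subst Sum_any.distrib) (simp_all only: fin' add.assoc)
  also have "s (e 0) (h 0) + Sum_any (\<lambda>i. s (((?N - 1) gchoose Suc i) * e (Suc i)) (h (Suc i)))
     = Sum_any (\<lambda>i. s (((?N - 1) gchoose i) * e i) (h i))"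
    by (subst Sum_any_nat_Suc[where K=K and g="\<lambda>i. s (((?N - 1) gchoose i) * e i) (h i)"]) (simp_all add: h)
  also have "\<dots> + Sum_any (\<lambda>i. s (((?N - 1) gchoose i) * e (Suc i)) (h (Suc i)))
     = Sum_any (\<lambda>i. s (((?N - 1) gchoose i) * e i) (h i) + s (((?N - 1) gchoose i) * e (Suc i)) (h (Suc i)))"
    by (subst Sum_any.distrib) (simp_all only: fin fin')
  also have "\<dots> = binomial_mult_swapped s (n - 1) (diff2 g) p q"
    unfolding binomial_mult_swapped_def e' combine by simp
  finally show "binomial_mult_swapped s n g p q = binomial_mult_swapped s (n - 1) (diff2 g) p q" .
qed

lemma binomial_mult_swapped_diff2:
  assumes "bounded_fst g"
  shows "binomial_mult_swapped s n g = binomial_mult_swapped s (n - int k) ((diff2 ^^ k) g)"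
  using assms
proof (induction k arbitrary: g n)
  case (Suc k)
  have "binomial_mult_swapped s n g = binomial_mult_swapped s (n - 1) (diff2 g)"
    by (rule binomial_mult_swapped_step[OF Suc.prems])
  also have "\<dots> = binomial_mult_swapped s (n - 1 - int k) ((diff2 ^^ k) (diff2 g))"
    by (rule Suc.IH[OF bounded_fst_diff2[OF Suc.prems]])
  finally show ?case by (simp add: funpow_swap1 algebra_simps)
qed simp

lemma bounded_fst_binomial_mult_swapped:
  assumes "bounded_fst g" shows "bounded_fst (binomial_mult_swapped s n g)"
proof -
  obtain N where N: "\<And>p q. p < N \<Longrightarrow> g p q = 0" using assms by (auto simp: bounded_fst_def)
  have "\<forall>p<N. \<forall>q. binomial_mult_swapped s n g p q = 0"
    by (simp add: binomial_mult_swapped_def N)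
  then show ?thesis unfolding bounded_fst_def by blast
qed

text \<open>Multiplication by \<open>x1 - x2\<close> commutes with expanding, and then the step
  lemma is read from right to left. This composes the factor \<open>(-x + x1)^n\<close> of the
  residue with the negative power hidden inside \<open>T\<close>.\<close>

lemma diff2_binomial_mult_swapped:
  assumes "bounded_fst g"
  shows "diff2 (binomial_mult_swapped s n g) = binomial_mult_swapped s (n + 1) g"
proof -
  obtain N where N: "\<And>p q. p < N \<Longrightarrow> g p q = 0" using assms by (auto simp: bounded_fst_def)
  have fin: "finite {i. s (t i) (g (p - int i) (r i)) \<noteq> 0}" for t p r
  proof (rule finite_subset[of _ "{..nat (p - N)}"])
    show "{i. s (t i) (g (p - int i) (r i)) \<noteq> 0} \<subseteq> {..nat (p - N)}"
    proof (rule subsetI, rule ccontr)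
      fix i assume i: "i \<in> {i. s (t i) (g (p - int i) (r i)) \<noteq> 0}" "i \<notin> {..nat (p - N)}"
      then have "p - int i < N" by auto
      with N i(1) show False by simp
    qed
  qed simp
  have "diff2 (binomial_mult_swapped s n g) = binomial_mult_swapped s n (diff2 g)"
  proof (intro ext)
    fix p q
    show "diff2 (binomial_mult_swapped s n g) p q = binomial_mult_swapped s n (diff2 g) p q"
      unfolding diff2_def binomial_mult_swapped_def
      by (subst Sum_any_diff[symmetric]) (simp_all only: fin scale_right_diff_distrib, simp add: algebra_simps)
  qed
  also have "\<dots> = binomial_mult_swapped s (n + 1) g"
    using binomial_mult_swapped_step[OF assms, of "n + 1"] by simp
  finally show ?thesis .
qed

lemma diff2_pow_binomial_mult_swapped:
  assumes "bounded_fst g"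
  shows "(diff2 ^^ k) (binomial_mult_swapped s n g) = binomial_mult_swapped s (n + int k) g"
  by (induction k) (simp_all add: diff2_binomial_mult_swapped[OF assms] algebra_simps)

text \<open>The coefficient of \<open>x\<^sub>1\<^sup>-\<^sup>1\<^sup>-\<^sup>p\<close> in the difference of the two expansions of \<open>(x\<^sub>1 - x)\<^sup>N\<close> is
  \<open>binom(p, - N - 1)\<close> times a power of \<open>x\<close>, whatever the sign of \<open>p\<close>.\<close>

lemma residue_difference:
  assumes "trunc2 A"
  shows "binomial_mult s (-1) N A (-1) m - binomial_mult_swapped s N A (-1) m = res2 (- N - 1) A m"
proof (cases "N \<ge> 0")
  case True
  then obtain k where N: "N = int k" by (metis zero_le_imp_eq_int)
  have A: "bounded_fst A" "bounded_snd A" using assms by (simp_all add: trunc2_iff)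
  \<comment> \<open>For a nonnegative power both expansions are the same polynomial multiple of
    \<open>A\<close>, and on the right the order \<open>- N - 1\<close> is negative, so both sides
    are zero.\<close>
  show ?thesis
    using binomial_mult_diff2[OF A(2), of N k] binomial_mult_swapped_diff2[OF A(1), of N k]
    by (simp add: N)
next
  case False
  define j where "j = nat (- 1 - N)"
  have N: "N = - 1 - int j" using False by (simp add: j_def)
  define G where "G p = s (zchoose p (int j)) (A p (m + int j - p))" for p
  define P where "P = {p. G p \<noteq> 0}"
  have fin: "finite P"
    unfolding P_def G_def by (rule finite_res2[OF trunc2_imp_finite_diag[OF assms]])
  \<comment> \<open>Powers of \<open>x1\<close> from \<open>0\<close> to \<open>j - 1\<close> are
    killed by a derivative of order \<open>j\<close>. Of the rest, the powers from \<open>j\<close>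
    on come from the first expansion, the negative ones from the second.\<close>
  have split: "P = (P \<inter> {int j..}) \<union> (P \<inter> {..<0})"
  proof -
    have "G p = 0" if "0 \<le> p" "p < int j" for p using zchoose_eq_0[OF that] by (simp add: G_def)
    then have "\<not> (0 \<le> p \<and> p < int j)" if "p \<in> P" for p using that by (auto simp: P_def)
    then show ?thesis by (auto simp: not_le not_less)
  qed
  \<comment> \<open>With \<open>N = - 1 - int j\<close>, upper negation turns the signed
    coefficients of both expansions into \<open>zchoose p (int j)\<close>: at
    \<open>p = int j + int i\<close> for the first and, with a minus sign, at
    \<open>p = - 1 - int i\<close> for the second.\<close>
  have c1: "(of_int N gchoose i) * (- 1) ^ i = zchoose (int j + int i) (int j)" for i
  proof -
    have "of_int N gchoose i = zchoose (- (1 + int j)) (int i)"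
      by (simp add: N zchoose_int)
    also have "\<dots> = (- 1) ^ i * zchoose (int j + int i) (int i)"
      by (subst zchoose_minus) (simp add: algebra_simps)
    finally show ?thesis
      using zchoose_symmetric[of "int j + int i" "int j"]
      by (simp add: power_mult_distrib[symmetric])
  qed
  have c2: "(of_int N gchoose i) * (- 1) powi (N - int i) = - zchoose (- 1 - int i) (int j)" for i
  proof -
    have inv: "inverse ((- 1 :: complex) ^ k) = (- 1) ^ k" for k
      by (simp add: power_inverse[symmetric])
    have "(- 1 :: complex) powi (N - int i) = (-1) powi N / (-1) ^ i"
      by (simp add: power_int_diff)
    also have "(- 1 :: complex) powi N = - ((- 1) ^ j)"
    proof -
      have "(- 1 :: complex) powi N = inverse ((-1) powi (int (Suc j)))"
        unfolding N power_int_minus[symmetric] by simp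
      then show ?thesis by (simp add: power_int_of_nat inv del: of_nat_Suc)
    qed
    finally have "(of_int N gchoose i :: complex) * (- 1) powi (N - int i) =
        - ((-1) ^ j * ((of_int N gchoose i) * (- 1) ^ i))"
      by (simp add: divide_inverse inv mult_ac)
    also have "\<dots> = - ((-1) ^ j * zchoose (int j + int i) (int j))"
      by (simp only: c1)
    also have "\<dots> = - zchoose (- (1 + int i)) (int j)"
      by (subst zchoose_minus) (simp add: algebra_simps)
    finally show ?thesis by (simp add: algebra_simps)
  qed
  have "binomial_mult s (-1) N A (-1) m = Sum_any (\<lambda>i. G (int j + int i))"
    unfolding binomial_mult_def c1 by (simp add: G_def N algebra_simps)
  also have "\<dots> = sum G (P \<inter> {int j..})"
    unfolding Sum_any.expand_set
    by (rule sum.reindex_bij_witness[of _ "\<lambda>p. nat (p - int j)" "\<lambda>i. int j + int i"])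
      (auto simp: P_def)
  finally have 1: "binomial_mult s (-1) N A (-1) m = sum G (P \<inter> {int j..})" .
  have "binomial_mult_swapped s N A (-1) m = Sum_any (\<lambda>i. - G (- 1 - int i))"
    unfolding binomial_mult_swapped_def c2 by (simp add: G_def N algebra_simps)
  also have "\<dots> = sum (\<lambda>p. - G p) (P \<inter> {..<0})"
    unfolding Sum_any.expand_set
    by (rule sum.reindex_bij_witness[of _ "\<lambda>p. nat (- 1 - p)" "\<lambda>i. - 1 - int i"])
      (auto simp: P_def)
  finally have 2: "binomial_mult_swapped s N A (-1) m = - sum G (P \<inter> {..<0})"
    by (simp add: sum_negf)
  have "res2 (- N - 1) A m = sum G P"
    unfolding res2_def Sum_any.expand_set P_def G_def N by simp
  also have "\<dots> = sum G (P \<inter> {int j..}) + sum G (P \<inter> {..<0})"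
    by (subst split, rule sum.union_disjoint) (use fin in auto)
  finally show ?thesis using 1 2 by simp
qed

end

subsection \<open>Series in named variables\<close>

text \<open>Exponents are indexed by variable names rather than by list positions, so that removing or
  inserting a variable does not renumber the others.\<close>

definition shift_var :: "nat \<Rightarrow> ((nat \<Rightarrow> int) \<Rightarrow> 'w) \<Rightarrow> (nat \<Rightarrow> int) \<Rightarrow> 'w" where
  "shift_var x f = (\<lambda>e. f (e(x := e x - 1)))"

definition var_diff :: "nat \<Rightarrow> nat \<Rightarrow> ((nat \<Rightarrow> int) \<Rightarrow> 'w::ab_group_add) \<Rightarrow> (nat \<Rightarrow> int) \<Rightarrow> 'w" where
  "var_diff x y f = (\<lambda>e. shift_var x f e - shift_var y f e)"

abbreviation var_diffs :: "(nat \<times> nat) list \<Rightarrow> ((nat \<Rightarrow> int) \<Rightarrow> 'w::ab_group_add) \<Rightarrow> (nat \<Rightarrow> int) \<Rightarrow> 'w" where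
  "var_diffs L \<equiv> fold (\<lambda>(x, y). var_diff x y) L"

definition trunc :: "nat set \<Rightarrow> ((nat \<Rightarrow> int) \<Rightarrow> 'w::zero) \<Rightarrow> bool" where
  "trunc V f \<longleftrightarrow> (\<exists>N. \<forall>e. (\<exists>v\<in>V. e v < N) \<longrightarrow> f e = 0)"

definition sect :: "nat \<Rightarrow> nat \<Rightarrow> ((nat \<Rightarrow> int) \<Rightarrow> 'w) \<Rightarrow> (nat \<Rightarrow> int) \<Rightarrow> int \<Rightarrow> int \<Rightarrow> 'w" where
  "sect u v f e = (\<lambda>p q. f (e(u := p, v := q)))"

definition finite_diag_in :: "nat \<Rightarrow> nat \<Rightarrow> ((nat \<Rightarrow> int) \<Rightarrow> 'w::zero) \<Rightarrow> bool" where
  "finite_diag_in u v f \<longleftrightarrow> (\<forall>e. finite_diag (sect u v f e))"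

definition offdiag :: "nat set \<Rightarrow> (nat \<times> nat) set" where
  "offdiag V = {(x, y). x \<in> V \<and> y \<in> V \<and> x \<noteq> y}"

lemma shift_var_commute: "shift_var x (shift_var y f) = shift_var y (shift_var x f)"
  by (cases "x = y") (auto simp: shift_var_def fun_upd_twist)

lemma var_diff_commute: "var_diff x y (var_diff x' y' f) = var_diff x' y' (var_diff x y f)"
proof
  fix e
  have "var_diff x y (var_diff x' y' f) e = (shift_var x (shift_var x' f) e - shift_var x (shift_var y' f) e) - (shift_var y (shift_var x' f) e - shift_var y (shift_var y' f) e)" for x y x' y'
    by (simp add: var_diff_def shift_var_def)
  note * = this[of x y x' y'] this[of x' y' x y]
  show "var_diff x y (var_diff x' y' f) e = var_diff x' y' (var_diff x y f) e"
    unfolding * shift_var_commute[of x'] shift_var_commute[of y'] by simp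
qed

lemma var_diff_swap: "var_diff y x f = (\<lambda>e. - var_diff x y f e)"
  by (simp add: var_diff_def)

lemma var_diff_minus: "var_diff x y (\<lambda>e. - f e) = (\<lambda>e. - var_diff x y f e)"
  by (simp add: var_diff_def shift_var_def)

lemma var_diff_add: "var_diff x y (\<lambda>e. f e + g e) = (\<lambda>e. var_diff x y f e + var_diff x y g e)"
  by (simp add: var_diff_def shift_var_def algebra_simps)

lemma var_diffs_minus: "var_diffs L (\<lambda>e. - f e) = (\<lambda>e. - var_diffs L f e)"
  by (induction L arbitrary: f) (auto simp: var_diff_minus)

lemma var_diffs_add: "var_diffs L (\<lambda>e. f e + g e) = (\<lambda>e. var_diffs L f e + var_diffs L g e)"
  by (induction L arbitrary: f g) (auto simp: var_diff_add)

lemma var_diffs_zero [simp]: "var_diffs L (\<lambda>e. 0) = (\<lambda>e. 0)"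
  by (induction L) (auto simp: var_diff_def shift_var_def)

lemma var_diff_additive:
  assumes "\<And>x y. h (x + y) = h x + h y"
  shows "var_diff x y (\<lambda>e. h (f e)) = (\<lambda>e. h (var_diff x y f e))"
proof -
  interpret additive h using assms by unfold_locales
  show ?thesis by (simp add: var_diff_def shift_var_def diff)
qed

lemma var_diffs_additive:
  assumes "\<And>x y. h (x + y) = h x + h y"
  shows "var_diffs L (\<lambda>e. h (f e)) = (\<lambda>e. h (var_diffs L f e))"
  by (induction L arbitrary: f) (auto simp: var_diff_additive[of h, OF assms])

lemma var_diffs_var_diff: "var_diffs L (var_diff x y f) = var_diff x y (var_diffs L f)"
proof (induction L arbitrary: f)
  case (Cons l L)
  then show ?case using var_diff_commute[of "fst l" "snd l" x y f] by (simp add: case_prod_beta)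
qed simp

lemma var_diffs_var_diff_pow: "var_diffs L ((var_diff x y ^^ k) f) = (var_diff x y ^^ k) (var_diffs L f)"
  by (induction k arbitrary: f) (auto simp: var_diffs_var_diff)

lemma var_diffs_replicate: "var_diffs (replicate k (x, y)) = var_diff x y ^^ k"
  by (induction k) (auto simp: fun_eq_iff funpow_swap1)

lemma var_diffs_mset: "mset L = mset L' \<Longrightarrow> var_diffs L = var_diffs L'"
  by (rule fold_multiset_equiv) (auto simp: fun_eq_iff var_diff_commute)

lemma trunc_zero_unless:
  assumes "trunc V f" "trunc V g" "\<And>e. f e = 0 \<Longrightarrow> g e = 0 \<Longrightarrow> h e = 0"
  shows "trunc V h"
proof -
  obtain N M where "\<forall>e. (\<exists>v\<in>V. e v < N) \<longrightarrow> f e = 0" "\<forall>e. (\<exists>v\<in>V. e v < M) \<longrightarrow> g e = 0"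
    using assms(1,2) unfolding trunc_def by blast
  then have "\<forall>e. (\<exists>v\<in>V. e v < min N M) \<longrightarrow> h e = 0" using assms(3) by (metis min_less_iff_conj)
  then show ?thesis unfolding trunc_def by blast
qed

lemma trunc_add: "trunc V f \<Longrightarrow> trunc V g \<Longrightarrow> trunc V (\<lambda>e. f e + g e)"
  for f :: "(nat \<Rightarrow> int) \<Rightarrow> 'w::ab_group_add"
  by (rule trunc_zero_unless[of V f g]) auto

lemma trunc_diff: "trunc V f \<Longrightarrow> trunc V g \<Longrightarrow> trunc V (\<lambda>e. f e - g e)"
  for f :: "(nat \<Rightarrow> int) \<Rightarrow> 'w::ab_group_add"
  by (rule trunc_zero_unless[of V f g]) auto

lemma trunc_minus_iff [simp]: "trunc V (\<lambda>e. - f e) \<longleftrightarrow> trunc V f"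
  for f :: "(nat \<Rightarrow> int) \<Rightarrow> 'w::ab_group_add"
  by (simp add: trunc_def)

lemma trunc_zero: "trunc V (\<lambda>e. 0)"
  by (simp add: trunc_def)

lemma trunc_shift_var:
  assumes "trunc V f" shows "trunc V (shift_var x f)"
proof -
  obtain N where N: "\<And>e. (\<exists>v\<in>V. e v < N) \<Longrightarrow> f e = 0"
    using assms unfolding trunc_def by blast
  have "shift_var x f e = 0" if "v \<in> V" "e v < N" for e v
    unfolding shift_var_def by (rule N) (use that in \<open>auto intro!: bexI[of _ v]\<close>)
  then show ?thesis unfolding trunc_def by blast
qed

lemma trunc_var_diff: "trunc V f \<Longrightarrow> trunc V (var_diff x y f)"
  unfolding var_diff_def by (intro trunc_diff trunc_shift_var)

lemma trunc_var_diff_pow: "trunc V f \<Longrightarrow> trunc V ((var_diff x y ^^ k) f)"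
  by (rule funpow_preserves[of "trunc V", OF trunc_var_diff])

lemma trunc_var_diffs: "trunc V f \<Longrightarrow> trunc V (var_diffs L f)"
  by (induction L arbitrary: f) (auto simp: trunc_var_diff)

lemma sect_var_diff: "u \<noteq> v \<Longrightarrow> sect u v (var_diff u v f) e = diff2 (sect u v f e)"
  by (auto simp: sect_def var_diff_def shift_var_def diff2_def fun_eq_iff fun_upd_twist)

lemma sect_var_diff_pow: "u \<noteq> v \<Longrightarrow> sect u v ((var_diff u v ^^ k) f) e = (diff2 ^^ k) (sect u v f e)"
  by (induction k) (auto simp: sect_var_diff)

lemma sect_shift_var_u: "u \<noteq> v \<Longrightarrow> sect u v (shift_var u f) e = (\<lambda>p q. sect u v f e (p - 1) q)"
  by (auto simp: sect_def shift_var_def fun_upd_twist)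

lemma sect_shift_var_v: "u \<noteq> v \<Longrightarrow> sect u v (shift_var v f) e = (\<lambda>p q. sect u v f e p (q - 1))"
  by (auto simp: sect_def shift_var_def fun_upd_twist)

lemma sect_shift_var_other: "x \<noteq> u \<Longrightarrow> x \<noteq> v \<Longrightarrow> sect u v (shift_var x f) e = sect u v f (e(x := e x - 1))"
  by (auto simp: sect_def shift_var_def fun_upd_twist)

lemma finite_diag_in_shift_var:
  assumes "u \<noteq> v" "finite_diag_in u v f" shows "finite_diag_in u v (shift_var x f)"
  using assms unfolding finite_diag_in_def
  by (cases "x = u"; cases "x = v")
    (auto simp: sect_shift_var_u sect_shift_var_v sect_shift_var_other finite_diag_shift_fst finite_diag_shift_snd)

lemma finite_diag_in_zero_unless:
  assumes "finite_diag_in u v f" "finite_diag_in u v g" "\<And>e. f e = 0 \<Longrightarrow> g e = 0 \<Longrightarrow> h e = 0"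
  shows "finite_diag_in u v h"
  using assms unfolding finite_diag_in_def sect_def by (blast intro: finite_diag_zero_unless)

lemma finite_diag_in_var_diff: "u \<noteq> v \<Longrightarrow> finite_diag_in u v f \<Longrightarrow> finite_diag_in u v (var_diff x y f)"
  unfolding var_diff_def by (rule finite_diag_in_zero_unless[OF finite_diag_in_shift_var[of u v f x] finite_diag_in_shift_var[of u v f y]]) auto

lemma finite_diag_in_var_diff_pow: "u \<noteq> v \<Longrightarrow> finite_diag_in u v f \<Longrightarrow> finite_diag_in u v ((var_diff x y ^^ k) f)"
  by (rule funpow_preserves[of "finite_diag_in u v", OF finite_diag_in_var_diff])

lemma trunc_imp_finite_diag_in:
  assumes "trunc V f" "u \<in> V" "v \<in> V" "u \<noteq> v" shows "finite_diag_in u v f"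
  unfolding finite_diag_in_def
proof
  fix e
  obtain N where N: "\<And>e. (\<exists>v\<in>V. e v < N) \<Longrightarrow> f e = 0"
    using assms(1) unfolding trunc_def by blast
  have "\<forall>p q. p < N \<or> q < N \<longrightarrow> sect u v f e p q = 0"
  proof (intro allI impI)
    fix p q :: int assume "p < N \<or> q < N"
    then show "sect u v f e p q = 0"
      unfolding sect_def using assms(2-4) by (intro N) (auto intro: bexI[of _ u] bexI[of _ v])
  qed
  then have "trunc2 (sect u v f e)" unfolding trunc2_def by blast
  then show "finite_diag (sect u v f e)" by (rule trunc2_imp_finite_diag)
qed

section \<open>Restriction to a diagonal in many variables\<close>

context series_space
begin

text \<open>The variable \<open>u\<close> is merged into \<open>v\<close>: the value ignores
  \<open>e u\<close>, and \<open>e v\<close> is the exponent of the merged variable. All other names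
  stay, so factors in the remaining variables keep their meaning.\<close>

definition dres :: "nat \<Rightarrow> nat \<Rightarrow> int \<Rightarrow> ((nat \<Rightarrow> int) \<Rightarrow> 'w) \<Rightarrow> (nat \<Rightarrow> int) \<Rightarrow> 'w" where
  "dres u v j f = (\<lambda>e. res2 j (sect u v f e) (e v))"

lemma dres_neg [simp]: "j < 0 \<Longrightarrow> dres u v j f = (\<lambda>e. 0)"
  by (simp add: dres_def)

lemma dres_shift_var_other:
  assumes "u \<noteq> v" "x \<noteq> u"
  shows "dres u v j (shift_var x f) = shift_var x (dres u v j f)"
proof (cases "x = v")
  case True
  have "sect u v f (e(v := e v - 1)) = sect u v f e" for e
    using assms by (simp add: sect_def fun_upd_twist)
  then show ?thesis using assms True
    by (simp add: dres_def sect_shift_var_v res2_shift_snd) (simp add: shift_var_def)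
next
  case False
  then show ?thesis using assms
    by (simp add: dres_def sect_shift_var_other) (simp add: shift_var_def)
qed

lemma dres_shift_var_u:
  assumes "u \<noteq> v" "finite_diag_in u v f"
  shows "dres u v j (shift_var u f) = (\<lambda>e. shift_var v (dres u v j f) e + dres u v (j - 1) f e)"
proof
  fix e
  have "sect u v f (e(v := e v - 1)) = sect u v f e" using assms by (simp add: sect_def fun_upd_twist)
  then show "dres u v j (shift_var u f) e = shift_var v (dres u v j f) e + dres u v (j - 1) f e"
    using assms by (simp add: dres_def sect_shift_var_u res2_shift_fst finite_diag_in_def) (simp add: shift_var_def)
qed

lemma dres_diff:
  assumes "finite_diag_in u v f" "finite_diag_in u v g"
  shows "dres u v j (\<lambda>e. f e - g e) = (\<lambda>e. dres u v j f e - dres u v j g e)"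
proof
  fix e
  have "sect u v (\<lambda>e. f e - g e) e = (\<lambda>p q. sect u v f e p q - sect u v g e p q)"
    by (simp add: sect_def)
  then show "dres u v j (\<lambda>e. f e - g e) e = dres u v j f e - dres u v j g e"
    using assms by (simp add: dres_def res2_diff finite_diag_in_def)
qed

lemma dres_minus: "dres u v j (\<lambda>e. - f e) = (\<lambda>e. - dres u v j f e)"
  by (simp add: dres_def sect_def res2_def Sum_any.expand_set sum_negf)

lemma dres_var_diff_other:
  assumes "u \<noteq> v" "finite_diag_in u v f" "x \<noteq> u" "y \<noteq> u"
  shows "dres u v j (var_diff x y f) = var_diff x y (dres u v j f)"
  using assms unfolding var_diff_def
  by (simp add: dres_diff finite_diag_in_shift_var dres_shift_var_other)

lemma dres_var_diff_uv:
  assumes "u \<noteq> v" "finite_diag_in u v f"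
  shows "dres u v j (var_diff u v f) = dres u v (j - 1) f"
  using assms unfolding var_diff_def
  by (simp add: dres_diff finite_diag_in_shift_var dres_shift_var_other dres_shift_var_u)

lemma dres_var_diff_uv_pow:
  assumes "u \<noteq> v" "finite_diag_in u v f"
  shows "dres u v j ((var_diff u v ^^ k) f) = dres u v (j - int k) f"
  by (induction k arbitrary: j) (simp_all add: assms finite_diag_in_var_diff_pow dres_var_diff_uv algebra_simps)

text \<open>Leibniz rule again: on the diagonal \<open>x - x_u\<close> becomes
  \<open>x - x_v\<close>, and its derivative in \<open>x_u\<close> is \<open>-1\<close>.\<close>

lemma dres_var_diff_xu:
  assumes "u \<noteq> v" "finite_diag_in u v f" "x \<noteq> u"
  shows "dres u v j (var_diff x u f) = (\<lambda>e. var_diff x v (dres u v j f) e - dres u v (j - 1) f e)"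
  using assms unfolding var_diff_def
  by (simp add: dres_diff finite_diag_in_shift_var dres_shift_var_other dres_shift_var_u algebra_simps)

lemma trunc_dres:
  assumes "trunc V f" "u \<in> V" "v \<in> V" "u \<noteq> v"
  shows "trunc (V - {u}) (dres u v j f)"
proof -
  obtain N where N: "\<And>e. (\<exists>v\<in>V. e v < N) \<Longrightarrow> f e = 0"
    using assms(1) unfolding trunc_def by blast
  \<comment> \<open>The merged variable collects exponents \<open>p\<close> and \<open>q\<close>
    with \<open>p + q = e v + j\<close>; if this is below \<open>2 * N\<close>, one of them lies
    below \<open>N\<close>.\<close>
  define M where "M = min N (2 * N - j)"
  have "dres u v j f e = 0" if "x \<in> V - {u}" "e x < M" for e x
  proof -
    have "f (e(u := p, v := e v + j - p)) = 0" for p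
    proof (cases "x = v")
      case True
      then have "p < N \<or> e v + j - p < N" using that by (auto simp: M_def)
      then show ?thesis using assms by (intro N) (auto intro: bexI[of _ u] bexI[of _ v])
    next
      case False
      then show ?thesis using assms that by (intro N) (auto simp: M_def intro!: bexI[of _ x])
    qed
    then show ?thesis by (simp add: dres_def res2_def sect_def)
  qed
  then show ?thesis unfolding trunc_def by blast
qed

text \<open>Since \<open>x - x\<^sub>u = (x - x\<^sub>v) - (x\<^sub>u - x\<^sub>v)\<close>, and \<open>x\<^sub>u - x\<^sub>v\<close> acts on \<^term>\<open>dres u v j\<close> by lowering \<open>j\<close>,
  each factor \<open>x - x\<^sub>u\<close> is traded for \<open>j + 1\<close> factors \<open>x - x\<^sub>v\<close>.\<close>

lemma trunc_var_diffs_dres: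
  assumes "u \<in> V" "v \<in> V" "u \<noteq> v" "set L \<subseteq> offdiag V"
  shows "\<exists>L'. set L' \<subseteq> offdiag (V - {u}) \<and>
    (\<forall>f. finite_diag_in u v f \<longrightarrow> trunc V (var_diffs L f) \<longrightarrow> (\<forall>j\<le>J. trunc (V - {u}) (var_diffs L' (dres u v j f))))"
  using assms(4)
proof (induction L arbitrary: J)
  case Nil
  then show ?case using assms trunc_dres by (intro exI[of _ "[]"]) auto
next
  case (Cons l L)
  obtain x y where l: "l = (x, y)" "x \<in> V" "y \<in> V" "x \<noteq> y"
    using Cons.prems by (auto simp: offdiag_def)
  have L: "set L \<subseteq> offdiag V" using Cons.prems by simp
  show ?case
  proof (cases "x = u \<or> y = u")
    case False
    obtain L' where L': "set L' \<subseteq> offdiag (V - {u})"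
      and IH: "\<And>f j. finite_diag_in u v f \<Longrightarrow> trunc V (var_diffs L f) \<Longrightarrow> j \<le> J \<Longrightarrow> trunc (V - {u}) (var_diffs L' (dres u v j f))"
      using Cons.IH[OF L, of J] by blast
    have "trunc (V - {u}) (var_diffs (l # L') (dres u v j f))"
      if "finite_diag_in u v f" "trunc V (var_diffs (l # L) f)" "j \<le> J" for f j
      using IH[of "var_diff x y f" j] that False assms(3) by (simp add: l finite_diag_in_var_diff dres_var_diff_other)
    moreover have "set (l # L') \<subseteq> offdiag (V - {u})" using L' l False by (auto simp: offdiag_def)
    ultimately show ?thesis by (intro exI[of _ "l # L'"]) blast
  next
    case True
    define z where "z = (if x = u then y else x)"
    have z: "z \<in> V" "z \<noteq> u" using True l by (auto simp: z_def)
    have zu: "trunc V (var_diffs L (var_diff z u f))" if "trunc V (var_diffs (l # L) f)" for f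
      using that True l var_diff_swap[of z u f] by (auto simp: z_def var_diffs_minus)
    show ?thesis
    proof (cases "z = v")
      case True
      \<comment> \<open>The factor \<open>x_v - x_u\<close> leaves no factor behind but lowers the
        order by one. The derivative of order \<open>j\<close> is thus recovered from order
        \<open>j + 1\<close>, so the induction hypothesis is taken at the bound
        \<open>J + 1\<close>.\<close>
      obtain L' where L': "set L' \<subseteq> offdiag (V - {u})"
        and IH: "\<And>f j. finite_diag_in u v f \<Longrightarrow> trunc V (var_diffs L f) \<Longrightarrow> j \<le> J + 1 \<Longrightarrow> trunc (V - {u}) (var_diffs L' (dres u v j f))"
        using Cons.IH[OF L, of "J + 1"] by blast
      have "trunc (V - {u}) (var_diffs L' (dres u v j f))"
        if "finite_diag_in u v f" "trunc V (var_diffs (l # L) f)" "j \<le> J" for f j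
      proof -
        have "dres u v (j + 1) (var_diff v u f) = (\<lambda>e. - dres u v j f e)"
          using dres_var_diff_uv[OF assms(3) that(1), of "j + 1"] by (simp add: var_diff_swap[of v u] dres_minus)
        then show ?thesis
          using IH[of "var_diff v u f" "j + 1"] zu[OF that(2)] that True assms(3) by (simp add: finite_diag_in_var_diff var_diffs_minus)
      qed
      then show ?thesis using L' by blast
    next
      case False
      obtain L' where L': "set L' \<subseteq> offdiag (V - {u})"
        and IH: "\<And>f j. finite_diag_in u v f \<Longrightarrow> trunc V (var_diffs L f) \<Longrightarrow> j \<le> J \<Longrightarrow> trunc (V - {u}) (var_diffs L' (dres u v j f))"
        using Cons.IH[OF L, of J] by blast
      let ?R = "replicate (nat (J + 1)) (z, v)"
      have "trunc (V - {u}) (var_diffs (?R @ L') (dres u v j f))"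
        if f: "finite_diag_in u v f" "trunc V (var_diffs (l # L) f)" and j: "j \<le> J" for f j
      proof -
        \<comment> \<open>Here \<open>n\<close> stands for the derivative of order
          \<open>n - 1\<close>, so the base case is the vanishing derivative of order
          \<open>-1\<close>. Each further order costs one more factor, since exchanging
          \<open>x_z - x_u\<close> for \<open>x_z - x_v\<close> leaves the next lower derivative as
          an error.\<close>
        have *: "int n \<le> J + 1 \<Longrightarrow> trunc (V - {u}) ((var_diff z v ^^ n) (var_diffs L' (dres u v (int n - 1) f)))" for n
        proof (induction n)
          case 0
          then show ?case by (simp add: trunc_zero)
        next
          case (Suc n)
          let ?D = "\<lambda>j. dres u v j f"
          have "var_diff z v (?D (int n)) = (\<lambda>e. dres u v (int n) (var_diff z u f) e + ?D (int n - 1) e)"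
            using dres_var_diff_xu[OF assms(3) f(1) z(2), of "int n"] by simp
          then have "(var_diff z v ^^ Suc n) (var_diffs L' (?D (int n))) =
            (\<lambda>e. (var_diff z v ^^ n) (var_diffs L' (dres u v (int n) (var_diff z u f))) e + (var_diff z v ^^ n) (var_diffs L' (?D (int n - 1))) e)"
            by (simp add: funpow_swap1 var_diffs_var_diff[symmetric] var_diffs_add var_diffs_add[of "replicate n (z, v)", unfolded var_diffs_replicate])
          moreover have "trunc (V - {u}) ((var_diff z v ^^ n) (var_diffs L' (dres u v (int n) (var_diff z u f))))"
            using Suc.prems by (intro trunc_var_diff_pow IH finite_diag_in_var_diff assms(3) f(1) zu[OF f(2)]) simp
          ultimately show ?case using Suc by (simp add: trunc_add)
        qed
        show ?thesis
        proof (cases "j < 0")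
          case True
          then show ?thesis by (simp only: dres_neg var_diffs_zero trunc_zero)
        next
          case False
          then have "nat (J + 1) = nat (J - j) + nat (j + 1)" using j by simp
          then have "var_diffs (?R @ L') (dres u v j f) =
              (var_diff z v ^^ nat (J - j)) ((var_diff z v ^^ nat (j + 1)) (var_diffs L' (dres u v j f)))"
            by (simp add: var_diffs_replicate var_diffs_var_diff_pow funpow_add del: replicate_add)
          then show ?thesis using *[of "nat (j + 1)"] j False by (simp add: trunc_var_diff_pow)
        qed
      qed
      moreover have "set (?R @ L') \<subseteq> offdiag (V - {u})"
        using L' z False assms by (auto simp: offdiag_def)
      ultimately show ?thesis by (intro exI[of _ "?R @ L'"]) blast
    qed
  qed
qed

end

subsection \<open>Compatibility in named variables\<close>

definition named_product :: "nat list \<Rightarrow> ('w::zero \<Rightarrow> int \<Rightarrow> 'w) list \<Rightarrow> 'w \<Rightarrow> (nat \<Rightarrow> int) \<Rightarrow> 'w" where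
  "named_product vs \<psi>s w = (\<lambda>e. operator_product \<psi>s w (map e vs))"

definition product2 :: "('w \<Rightarrow> int \<Rightarrow> 'w) \<Rightarrow> ('w \<Rightarrow> int \<Rightarrow> 'w) \<Rightarrow> 'w \<Rightarrow> int \<Rightarrow> int \<Rightarrow> 'w" where
  "product2 a b w = (\<lambda>p q. a (b w q) p)"

definition pairs :: "nat \<Rightarrow> (nat \<times> nat) list" where
  "pairs r = [(i, j). i \<leftarrow> [0..<r], j \<leftarrow> [Suc i..<r]]"

lemma set_pairs: "set (pairs r) = {(i, j). i < j \<and> j < r}"
  by (fastforce simp: pairs_def)

lemma operator_product_append:
  "length ms = length \<psi>s \<Longrightarrow>
    operator_product (\<psi>s @ \<phi>s) w (ms @ ms') = operator_product \<psi>s (operator_product \<phi>s w ms') ms"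
  by (induction \<psi>s arbitrary: ms) (auto simp: length_Suc_conv)

lemma map_nth_upt: "length ms = r \<Longrightarrow> map (\<lambda>i. ms ! i) [0..<r] = ms"
  using map_nth[of ms] by simp

lemma lower_truncated_multi_iff:
  "lower_truncated_multi r f \<longleftrightarrow> trunc {..<r} (\<lambda>e. f (map e [0..<r]))"
proof
  assume "lower_truncated_multi r f"
  then obtain N where N: "\<And>ms. length ms = r \<Longrightarrow> (\<exists>m\<in>set ms. m < N) \<Longrightarrow> f ms = 0"
    unfolding lower_truncated_multi_def by blast
  have "f (map e [0..<r]) = 0" if "\<exists>v\<in>{..<r}. e v < N" for e
    by (rule N) (use that in auto)
  then show "trunc {..<r} (\<lambda>e. f (map e [0..<r]))" unfolding trunc_def by blast
next
  assume "trunc {..<r} (\<lambda>e. f (map e [0..<r]))"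
  then obtain N where N: "\<And>e. \<exists>v\<in>{..<r}. e v < N \<Longrightarrow> f (map e [0..<r]) = 0"
    unfolding trunc_def by blast
  have "f ms = 0" if "length ms = r" "\<exists>m\<in>set ms. m < N" for ms
  proof -
    have "\<exists>v\<in>{..<r}. ms ! v < N" using that by (auto simp: in_set_conv_nth)
    from N[OF this] show ?thesis using map_nth_upt[OF that(1)] by simp
  qed
  then show "lower_truncated_multi r f" unfolding lower_truncated_multi_def by blast
qed

lemma mult_diff_lift:
  assumes "i < r" "j < r"
  shows "mult_diff i j f (map e [0..<r]) = var_diff i j (\<lambda>e. f (map e [0..<r])) e"
proof -
  have "(map e [0..<r])[i := x] = map (e(i := x)) [0..<r]" if "i < r" for i x
    using that by (intro nth_equalityI) (auto simp: nth_list_update)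
  then show ?thesis using assms by (simp add: mult_diff_def var_diff_def shift_var_def)
qed

lemma mult_diff_pow_lift:
  assumes "i < r" "j < r"
  shows "(mult_diff i j ^^ k) f (map e [0..<r]) = (var_diff i j ^^ k) (\<lambda>e. f (map e [0..<r])) e"
proof (induction k arbitrary: e)
  case (Suc k)
  then show ?case by (simp add: mult_diff_lift[OF assms])
qed simp

lemma mult_diffs_lift:
  "mult_diffs r k f (map e [0..<r]) =
    var_diffs (concat (map (replicate k) (pairs r))) (\<lambda>e. f (map e [0..<r])) e"
proof -
  have "fold (\<lambda>(i, j). mult_diff i j ^^ k) P f (map e [0..<r]) =
      var_diffs (concat (map (replicate k) P)) (\<lambda>e. f (map e [0..<r])) e"
    if "set P \<subseteq> set (pairs r)" for P
    using that
  proof (induction P arbitrary: f)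
    case (Cons p P)
    obtain i j where p: "p = (i, j)" "i < r" "j < r" using Cons.prems by (auto simp: set_pairs)
    then show ?case using Cons by (simp add: mult_diff_pow_lift var_diffs_replicate)
  qed simp
  from this[of "pairs r"] show ?thesis by (simp add: mult_diffs_def pairs_def)
qed

lemma count_concat_replicate: "p \<in> set P \<Longrightarrow> k \<le> count (mset (concat (map (replicate k) P))) p"
  by (induction P) auto

text \<open>Factors may occur in either orientation and with any multiplicity; a uniform exponent \<open>k\<close> can be
  recovered because further factors preserve truncation.\<close>

definition comp_named :: "nat list \<Rightarrow> ('w::ab_group_add \<Rightarrow> int \<Rightarrow> 'w) list \<Rightarrow> bool" where
  "comp_named vs \<psi>s \<longleftrightarrow>
    (\<exists>L. set L \<subseteq> offdiag (set vs) \<and> (\<forall>w. trunc (set vs) (var_diffs L (named_product vs \<psi>s w))))"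

lemma var_diffs_rename:
  assumes "inj h"
  shows "var_diffs (map (map_prod h h) L) (\<lambda>e. f (e \<circ> h)) = (\<lambda>e. var_diffs L f (e \<circ> h))"
proof (induction L arbitrary: f)
  case (Cons l L)
  have "(e(h x := y)) \<circ> h = (e \<circ> h)(x := y)" for e :: "nat \<Rightarrow> int" and x y
    using assms by (auto simp: fun_eq_iff inj_def)
  then have "var_diff (h x) (h y) (\<lambda>e. f (e \<circ> h)) = (\<lambda>e. var_diff x y f (e \<circ> h))" for x y
    by (simp add: var_diff_def shift_var_def)
  then show ?case using Cons[of "var_diff (fst l) (snd l) f"] by (cases l) (simp add: o_def)
qed simp

lemma trunc_rename:
  assumes "inj h"
  shows "trunc (h ` V) (\<lambda>e. f (e \<circ> h)) \<longleftrightarrow> trunc V f"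
proof
  assume "trunc (h ` V) (\<lambda>e. f (e \<circ> h))"
  then obtain N where N: "\<And>e. \<exists>v\<in>h ` V. e v < N \<Longrightarrow> f (e \<circ> h) = 0"
    unfolding trunc_def by blast
  have "f e = 0" if "\<exists>v\<in>V. e v < N" for e
    using N[of "e \<circ> inv h"] that assms by (auto simp: comp_assoc)
  then show "trunc V f" unfolding trunc_def by blast
next
  assume "trunc V f"
  then obtain N where N: "\<And>e. \<exists>v\<in>V. e v < N \<Longrightarrow> f e = 0"
    unfolding trunc_def by blast
  have "f (e \<circ> h) = 0" if "\<exists>v\<in>h ` V. e v < N" for e
    using that by (intro N) auto
  then show "trunc (h ` V) (\<lambda>e. f (e \<circ> h))" unfolding trunc_def by blast
qed

text \<open>Merging two variables leaves a gap in the numbering; independence of names closes it.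
  For the converse direction the factor list is pulled back along \<open>inv h\<close>.\<close>

lemma comp_named_rename:
  assumes "inj h"
  shows "comp_named (map h vs) \<psi>s \<longleftrightarrow> comp_named vs \<psi>s"
proof -
  have op: "named_product (map h vs) \<psi>s w = (\<lambda>e. named_product vs \<psi>s w (e \<circ> h))" for w
    by (simp add: named_product_def)
  have *: "trunc (set (map h vs)) (var_diffs (map (map_prod h h) L) (named_product (map h vs) \<psi>s w)) \<longleftrightarrow>
      trunc (set vs) (var_diffs L (named_product vs \<psi>s w))" for L w
    unfolding op var_diffs_rename[OF assms] using trunc_rename[OF assms] by simp
  show ?thesis
  proof
    assume "comp_named vs \<psi>s"
    then obtain L where L: "set L \<subseteq> offdiag (set vs)" "\<forall>w. trunc (set vs) (var_diffs L (named_product vs \<psi>s w))"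
      unfolding comp_named_def by blast
    have "set (map (map_prod h h) L) \<subseteq> offdiag (set (map h vs))"
      using L(1) assms by (fastforce simp: offdiag_def inj_def)
    then show "comp_named (map h vs) \<psi>s" using L(2) * unfolding comp_named_def by blast
  next
    assume "comp_named (map h vs) \<psi>s"
    then obtain L where L: "set L \<subseteq> offdiag (set (map h vs))"
      "\<forall>w. trunc (set (map h vs)) (var_diffs L (named_product (map h vs) \<psi>s w))"
      unfolding comp_named_def by blast
    define L0 where "L0 = map (map_prod (inv h) (inv h)) L"
    have "map_prod h h (map_prod (inv h) (inv h) l) = l" if "l \<in> set L" for l
      using subsetD[OF L(1) that] by (auto simp: offdiag_def f_inv_into_f)
    then have eq: "map (map_prod h h) L0 = L"
      by (simp add: L0_def map_idI)
    have "set L0 \<subseteq> offdiag (set vs)"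
      using L(1) assms by (fastforce simp: offdiag_def L0_def)
    then show "comp_named vs \<psi>s" using L(2) *[of L0] unfolding comp_named_def eq by blast
  qed
qed

section \<open>Positional compatibility translated into named variables\<close>

context series_space
begin

abbreviation "operators \<equiv> weak_G1_vertex_operators s"

lemma linear_iff_raw:
  "Vector_Spaces.linear s s h \<longleftrightarrow> (\<forall>x y. h (x + y) = h x + h y) \<and> (\<forall>c x. h (s c x) = s c (h x))"
  by (simp add: Vector_Spaces.linear_iff vector_space_axioms)

lemma operator_add: "a \<in> operators \<Longrightarrow> a (x + y) n = a x n + a y n"
  by (simp add: weak_G1_vertex_operators_def linear_iff_raw)

lemma operator_scale: "a \<in> operators \<Longrightarrow> a (s c x) n = s c (a x n)"
  by (simp add: weak_G1_vertex_operators_def linear_iff_raw)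

lemma operator_zero: "a \<in> operators \<Longrightarrow> a 0 n = 0"
  using operator_scale[of a 0 0 n] by simp

lemma operator_truncated: "a \<in> operators \<Longrightarrow> \<exists>N. \<forall>n<N. a w n = 0"
  by (simp add: weak_G1_vertex_operators_def lower_truncated_def)

lemma operator_I:
  assumes "\<And>x y n. a (x + y) n = a x n + a y n" "\<And>c x n. a (s c x) n = s c (a x n)"
    "\<And>w. \<exists>N. \<forall>n<N. a w n = 0"
  shows "a \<in> operators"
  using assms by (simp add: weak_G1_vertex_operators_def linear_iff_raw lower_truncated_def)

lemma operator_product_add:
  "set \<psi>s \<subseteq> operators \<Longrightarrow> operator_product \<psi>s (x + y) ms = operator_product \<psi>s x ms + operator_product \<psi>s y ms"
  by (induction \<psi>s x ms rule: operator_product.induct) (auto simp: operator_add)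

lemma operator_product_scale:
  "set \<psi>s \<subseteq> operators \<Longrightarrow> operator_product \<psi>s (s c x) ms = s c (operator_product \<psi>s x ms)"
  by (induction \<psi>s x ms rule: operator_product.induct) (auto simp: operator_scale)

lemma operator_product_zero:
  "set \<psi>s \<subseteq> operators \<Longrightarrow> operator_product \<psi>s 0 ms = 0"
  using operator_product_scale[of \<psi>s 0 0] by simp

text \<open>The linearity clause is inherited: products of linear operators are linear in
  \<open>w\<close>, and multiplying by differences of variables is additive and commutes with
  scalars.\<close>

lemma compatible_order_iff_truncated:
  assumes "set \<psi>s \<subseteq> operators" and r: "r = length \<psi>s"
  shows "compatible_order s k \<psi>s \<longleftrightarrow>
    (\<forall>w. lower_truncated_multi r (mult_diffs r k (operator_product \<psi>s w)))"
proof -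
  let ?L = "concat (map (replicate k) (pairs r))"
  have F: "mult_diffs r k (operator_product \<psi>s w) (map e [0..<r]) = var_diffs ?L (named_product [0..<r] \<psi>s w) e" for w e
    unfolding named_product_def by (rule mult_diffs_lift)
  have add: "named_product [0..<r] \<psi>s (x + y) = (\<lambda>e. named_product [0..<r] \<psi>s x e + named_product [0..<r] \<psi>s y e)" for x y
    by (simp add: named_product_def operator_product_add[OF assms(1)])
  have scale: "named_product [0..<r] \<psi>s (s c x) = (\<lambda>e. s c (named_product [0..<r] \<psi>s x e))" for c x
    by (simp add: named_product_def operator_product_scale[OF assms(1)])
  have "Vector_Spaces.linear s s (\<lambda>w. mult_diffs r k (operator_product \<psi>s w) ms)" if "length ms = r" for ms
    using F[of _ "\<lambda>i. ms ! i"] map_nth_upt[OF that]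
    by (simp add: linear_iff_raw add scale var_diffs_add var_diffs_additive[of "s c" for c] scale_right_distrib)
  then show ?thesis
    unfolding compatible_order_def Let_def r[symmetric] by blast
qed

lemma compatible_order_iff:
  assumes "set \<psi>s \<subseteq> operators" and r: "r = length \<psi>s"
  shows "compatible_order s k \<psi>s \<longleftrightarrow>
    (\<forall>w. trunc {..<r} (var_diffs (concat (map (replicate k) (pairs r))) (named_product [0..<r] \<psi>s w)))"
  unfolding compatible_order_iff_truncated[OF assms] lower_truncated_multi_iff mult_diffs_lift named_product_def ..

lemma var_diffs_orient:
  "trunc V (var_diffs (map (\<lambda>(x, y). (min x y, max x y)) L) f) \<longleftrightarrow> trunc V (var_diffs L f)"
proof (induction L arbitrary: f)
  case (Cons l L)
  obtain x y where l: "l = (x, y)" by (cases l)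
  show ?case
    using Cons[of "var_diff x y f"] Cons[of "var_diff y x f"] var_diff_swap[of x y f]
    by (cases "x \<le> y") (auto simp: l var_diffs_minus min_def max_def)
qed simp

lemma compatible_seq_iff:
  assumes "set \<psi>s \<subseteq> operators"
  shows "compatible_seq s \<psi>s \<longleftrightarrow> comp_named [0..<length \<psi>s] \<psi>s"
proof
  let ?r = "length \<psi>s"
  assume "compatible_seq s \<psi>s"
  then obtain k where "compatible_order s k \<psi>s" unfolding compatible_seq_def by blast
  then have "\<forall>w. trunc {..<?r} (var_diffs (concat (map (replicate k) (pairs ?r))) (named_product [0..<?r] \<psi>s w))"
    using compatible_order_iff[OF assms refl] by blast
  moreover have "set (concat (map (replicate k) (pairs ?r))) \<subseteq> offdiag {..<?r}"
    by (auto simp: set_pairs offdiag_def)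
  ultimately show "comp_named [0..<?r] \<psi>s"
    unfolding comp_named_def set_upt atLeast0LessThan by blast
next
  let ?r = "length \<psi>s"
  assume "comp_named [0..<?r] \<psi>s"
  then obtain L where L: "set L \<subseteq> offdiag {..<?r}" "\<And>w. trunc {..<?r} (var_diffs L (named_product [0..<?r] \<psi>s w))"
    unfolding comp_named_def set_upt atLeast0LessThan by blast
  define L' where "L' = map (\<lambda>(x, y). (min x y, max x y)) L"
  \<comment> \<open>No pair occurs in \<open>L'\<close> more often than its length, so the uniform
    product with exponent \<open>k\<close> contains \<open>L'\<close> as a sub-multiset. The
    remaining factors \<open>R\<close> do not disturb truncation.\<close>
  define k where "k = length L'"
  let ?P = "concat (map (replicate k) (pairs ?r))"
  have "set L' \<subseteq> set (pairs ?r)"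
    using L(1) by (fastforce simp: L'_def set_pairs offdiag_def min_def max_def)
  have "count (mset L') p \<le> count (mset ?P) p" for p
  proof (cases "p \<in> set L'")
    case True
    then have "p \<in> set (pairs ?r)" using \<open>set L' \<subseteq> set (pairs ?r)\<close> by blast
    then have "k \<le> count (mset ?P) p" by (rule count_concat_replicate)
    moreover have "count (mset L') p \<le> k" unfolding k_def by (metis count_le_size size_mset)
    ultimately show ?thesis by simp
  next
    case False
    then have "count (mset L') p = 0" by (metis count_eq_zero_iff set_mset_mset)
    then show ?thesis by linarith
  qed
  then obtain R where R: "mset ?P = mset (L' @ R)"
    by (metis ex_mset mset_append mset_subset_eqI subset_mset.add_diff_inverse)
  have "trunc {..<?r} (var_diffs ?P (named_product [0..<?r] \<psi>s w))" for w
    unfolding var_diffs_mset[OF R] using L(2)[of w] by (simp add: trunc_var_diffs L'_def var_diffs_orient)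
  then have "compatible_order s k \<psi>s" using compatible_order_iff[OF assms refl] by blast
  then show "compatible_seq s \<psi>s" using assms unfolding compatible_seq_def by blast
qed

end

subsection \<open>Inserting operators into compatible sequences\<close>

text \<open>Renames the standard variables so that \<open>n\<close> becomes free for an operator to
  be inserted at that position.\<close>

definition skip :: "nat \<Rightarrow> nat \<Rightarrow> nat" where
  "skip n i = (if i < n then i else Suc i)"

lemma inj_skip: "inj (skip n)"
  by (auto simp: inj_def skip_def split: if_splits)

lemma map_skip:
  assumes "n \<le> r" shows "map (skip n) [0..<r] = [0..<n] @ [Suc n..<Suc r]"
proof -
  have "[0..<r] = [0..<n] @ [n..<r]" using upt_add_eq_append[of 0 n "r - n"] assms by simp
  moreover have "map (skip n) [n..<r] = map Suc [n..<r]" by (auto simp: skip_def)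
  moreover have "map (skip n) [0..<n] = [0..<n]" by (auto simp: skip_def intro: map_idI)
  ultimately show ?thesis by (simp add: map_Suc_upt)
qed

lemma diff2_pow_add:
  "(diff2 ^^ k) (\<lambda>p q. f p q + g p q) = (\<lambda>p q. (diff2 ^^ k) f p q + (diff2 ^^ k) g p q)"
proof (induction k)
  case (Suc k)
  show ?case unfolding funpow.simps o_apply Suc by (simp add: diff2_def algebra_simps)
qed simp

lemma diff2_pow_additive:
  assumes "\<And>x y. h (x + y) = h x + h y"
  shows "(diff2 ^^ k) (\<lambda>p q. h (f p q)) = (\<lambda>p q. h ((diff2 ^^ k) f p q))"
proof (induction k)
  case (Suc k)
  interpret additive h using assms by unfold_locales
  show ?case using Suc by (simp add: diff2_def diff)
qed simp

lemma finite_diag_additive: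
  assumes "finite_diag f" "h 0 = 0" shows "finite_diag (\<lambda>p q. h (f p q))"
  by (rule finite_diag_zero_unless[OF assms(1) assms(1)]) (simp add: assms)

lemma lower_truncated_multi_2:
  "lower_truncated_multi 2 f \<longleftrightarrow> trunc2 (\<lambda>p q. f [p, q])"
proof
  assume "lower_truncated_multi 2 f"
  then obtain N where N: "\<And>ms. length ms = 2 \<Longrightarrow> (\<exists>m\<in>set ms. m < N) \<Longrightarrow> f ms = 0"
    unfolding lower_truncated_multi_def by blast
  have "\<forall>p q. p < N \<or> q < N \<longrightarrow> f [p, q] = 0" by (intro allI impI N) auto
  then show "trunc2 (\<lambda>p q. f [p, q])" unfolding trunc2_def by blast
next
  assume "trunc2 (\<lambda>p q. f [p, q])"
  then obtain N where N: "\<And>p q. p < N \<or> q < N \<Longrightarrow> f [p, q] = 0" unfolding trunc2_def by blast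
  have "f ms = 0" if ms: "length ms = 2" "\<exists>m\<in>set ms. m < N" for ms
  proof -
    obtain p ms' where "ms = p # ms'" "length ms' = 1" using ms(1) by (cases ms) auto
    moreover then obtain q where "ms' = [q]" by (cases ms') auto
    ultimately show ?thesis using ms(2) by (auto intro: N)
  qed
  then show "lower_truncated_multi 2 f" unfolding lower_truncated_multi_def by blast
qed

lemma mult_diffs_2: "mult_diffs 2 k f [p, q] = (diff2 ^^ k) (\<lambda>p q. f [p, q]) p q"
proof -
  have "pairs 2 = [(0, 1)]" by (simp add: pairs_def numeral_2_eq_2)
  then have "mult_diffs 2 k f = (mult_diff 0 1 ^^ k) f"
    unfolding mult_diffs_def pairs_def[symmetric] by simp
  moreover have "(mult_diff 0 1 ^^ k) f [p, q] = (diff2 ^^ k) (\<lambda>p q. f [p, q]) p q" for p q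
  proof (induction k arbitrary: p q)
    case (Suc k)
    then show ?case by (simp add: mult_diff_def diff2_def)
  qed simp
  ultimately show ?thesis by simp
qed

section \<open>The n-th product as a divided derivative on the diagonal\<close>

context series_space
begin

lemma product2_add: "a \<in> operators \<Longrightarrow> b \<in> operators \<Longrightarrow> product2 a b (x + y) = (\<lambda>p q. product2 a b x p q + product2 a b y p q)"
  by (simp add: product2_def operator_add)

lemma product2_scale: "a \<in> operators \<Longrightarrow> b \<in> operators \<Longrightarrow> product2 a b (s c x) = (\<lambda>p q. s c (product2 a b x p q))"
  by (simp add: product2_def operator_scale)

lemma bounded_snd_product2:
  assumes "a \<in> operators" "b \<in> operators" shows "bounded_snd (product2 a b w)"
proof -
  obtain N where "\<forall>n<N. b w n = 0" using operator_truncated[OF assms(2)] by blast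
  then have "\<forall>p. \<forall>q<N. product2 a b w p q = 0" by (simp add: product2_def operator_zero[OF assms(1)])
  then show ?thesis unfolding bounded_snd_def by blast
qed

lemma compatible_order_pair_iff:
  assumes "a \<in> operators" "b \<in> operators"
  shows "compatible_order s k [a, b] \<longleftrightarrow> (\<forall>w. trunc2 ((diff2 ^^ k) (product2 a b w)))"
proof -
  have "set [a, b] \<subseteq> operators" "2 = length [a, b]" using assms by auto
  from compatible_order_iff_truncated[OF this] show ?thesis
    by (simp add: lower_truncated_multi_2 mult_diffs_2 product2_def)
qed

text \<open>Both terms of the defining residue become expansions of the same power
  \<open>n - k0\<close> applied to the same \<open>A\<close>, where \<open>k0\<close> is the
  exponent chosen inside \<open>T_operator\<close>; then \<open>residue_difference\<close> applies.
  The statement holds for every admissible \<open>k\<close>, so the choice is invisible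
  afterwards.\<close>

lemma nth_product_eq:
  assumes ab: "a \<in> operators" "b \<in> operators" and k: "compatible_order s k [a, b]"
  shows "nth_product s a n b w m = res2 (int k - 1 - n) ((diff2 ^^ k) (product2 a b w)) m"
proof -
  define k0 where "k0 = (SOME k. compatible_order s k [a, b])"
  have k0: "compatible_order s k0 [a, b]" unfolding k0_def using k by (rule someI)
  define f where "f = product2 a b w"
  define A where "A k = (diff2 ^^ k) f" for k
  have A: "trunc2 (A k)" "trunc2 (A k0)"
    using k k0 compatible_order_pair_iff[OF ab] by (auto simp: A_def f_def)
  have shift: "A (k + k0) = (diff2 ^^ k0) (A k)"
    by (simp add: A_def add.commute[of k] funpow_add)
  have idx: "int (k + k0) - 1 - n - int k0 = int k - 1 - n" by simp
  have T: "T_operator s a b w = binomial_mult_swapped s (- int k0) (A k0)"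
    unfolding T_operator_def Let_def k0_def[symmetric] mult_diffs_2 by (simp add: A_def f_def product2_def)
  have bA: "bounded_fst (A k0)" using A(2) by (simp add: trunc2_iff)
  have "nth_product s a n b w m =
      binomial_mult s (-1) n f (-1) m - binomial_mult_swapped s n (T_operator s a b w) (-1) m"
    by (simp add: nth_product_def f_def product2_def)
  also have "binomial_mult s (-1) n f = binomial_mult s (-1) (n - int k0) (A k0)"
    unfolding A_def f_def by (rule binomial_mult_diff2[OF bounded_snd_product2[OF ab]])
  also have "binomial_mult_swapped s n (T_operator s a b w) = binomial_mult_swapped s (n - int k0) (A k0)"
    unfolding T
    by (subst binomial_mult_swapped_diff2[OF bounded_fst_binomial_mult_swapped[OF bA], of _ _ k0])
      (simp add: diff2_pow_binomial_mult_swapped[OF bA])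
  also have "binomial_mult s (-1) (n - int k0) (A k0) (-1) m - binomial_mult_swapped s (n - int k0) (A k0) (-1) m
      = res2 (int k0 - 1 - n) (A k0) m"
    using residue_difference[OF A(2), of "n - int k0" m] by (simp add: algebra_simps)
  \<comment> \<open>The exponents \<open>k0\<close> and \<open>k\<close> are compared through
    \<open>k + k0\<close>: each extra factor lowers the order by one, exactly compensated by the
    shift of the index.\<close>
  also have "\<dots> = res2 (int (k + k0) - 1 - n) (A (k + k0)) m"
    using res2_diff2_pow[OF trunc2_imp_finite_diag[OF A(2)], of "int (k + k0) - 1 - n" k m]
    by (simp add: A_def funpow_add algebra_simps)
  also have "\<dots> = res2 (int k - 1 - n) (A k) m"
    unfolding shift by (subst res2_diff2_pow[OF trunc2_imp_finite_diag[OF A(1)]]) (simp only: idx)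
  finally show ?thesis by (simp add: A_def f_def)
qed

lemma res2_truncated:
  assumes "trunc2 A" shows "\<exists>N. \<forall>m<N. res2 j A m = 0"
proof -
  obtain N where N: "\<And>p q. p < N \<or> q < N \<Longrightarrow> A p q = 0" using assms unfolding trunc2_def by blast
  have "res2 j A m = 0" if "m < 2 * N - j" for m
  proof -
    have "A p (m + j - p) = 0" for p using that by (intro N) linarith
    then show ?thesis by (simp add: res2_def)
  qed
  then show ?thesis by blast
qed

lemma nth_product_operator:
  assumes ab: "a \<in> operators" "b \<in> operators" and k: "compatible_order s k [a, b]"
  shows "nth_product s a n b \<in> operators"
proof (rule operator_I)
  have A: "trunc2 ((diff2 ^^ k) (product2 a b w))" for w
    using k compatible_order_pair_iff[OF ab] by blast
  note eq = nth_product_eq[OF ab k]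
  show "nth_product s a n b (x + y) m = nth_product s a n b x m + nth_product s a n b y m" for x y m
    unfolding eq product2_add[OF ab] diff2_pow_add by (rule res2_add; rule trunc2_imp_finite_diag[OF A])
  show "nth_product s a n b (s c x) m = s c (nth_product s a n b x m)" for c x m
    unfolding eq product2_scale[OF ab]
    by (simp add: diff2_pow_additive[of "s c" for c] scale_right_distrib scale_left_commute
        res2_additive[OF trunc2_imp_finite_diag[OF A]])
  show "\<exists>N. \<forall>m<N. nth_product s a n b w m = 0" for w
    unfolding eq by (rule res2_truncated[OF A])
qed

lemma named_product_split:
  assumes "length A = length pre"
  shows "named_product (A @ x # B) (pre @ c # post) w e =
    operator_product pre (c (operator_product post w (map e B)) (e x)) (map e A)"
  using assms by (simp add: named_product_def operator_product_append)

lemma named_product_append: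
  assumes "length A = length pre"
  shows "named_product (A @ B) (pre @ post) w e = operator_product pre (operator_product post w (map e B)) (map e A)"
  using assms by (simp add: named_product_def operator_product_append)

lemma compatible_seq_skip_iff:
  assumes "set pre \<subseteq> operators" "set post \<subseteq> operators"
  shows "compatible_seq s (pre @ post) \<longleftrightarrow>
    comp_named ([0..<length pre] @ [Suc (length pre)..<Suc (length pre + length post)]) (pre @ post)"
  using compatible_seq_iff[of "pre @ post"] assms
    comp_named_rename[OF inj_skip, of "length pre" "[0..<length pre + length post]" "pre @ post"]
  by (simp add: map_skip del: upt_Suc)

lemma compatible_seq_insert_iff:
  assumes "set pre \<subseteq> operators" "c \<in> operators" "set post \<subseteq> operators"
  shows "compatible_seq s (pre @ c # post) \<longleftrightarrow>
    comp_named ([0..<length pre] @ length pre # [Suc (length pre)..<Suc (length pre + length post)]) (pre @ c # post)"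
proof -
  have "[0..<Suc (length pre + length post)] =
      [0..<length pre] @ length pre # [Suc (length pre)..<Suc (length pre + length post)]"
    using upt_add_eq_append[of 0 "length pre" "Suc (length post)"] by (simp add: upt_conv_Cons del: upt_Suc)
  then show ?thesis
    using compatible_seq_iff[of "pre @ c # post"] assms by (simp del: upt_Suc)
qed

section \<open>Compatibility after inserting the identity, a linear combination or a product\<close>

lemma id_operator_operator: "id_operator \<in> operators"
  by (rule operator_I) (auto simp: id_operator_def)

lemma var_diffs_delta:
  fixes f :: "(nat \<Rightarrow> int) \<Rightarrow> 'w"
  assumes "set L \<subseteq> offdiag V" "x \<notin> V"
  shows "var_diffs L (\<lambda>e. if e x = 0 then f e else 0) = (\<lambda>e. if e x = 0 then var_diffs L f e else 0)"
  using assms(1)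
proof (induction L arbitrary: f)
  case (Cons l L)
  obtain y z where l: "l = (y, z)" "y \<noteq> x" "z \<noteq> x" using Cons.prems assms(2) by (auto simp: offdiag_def)
  then have "var_diff y z (\<lambda>e. if e x = 0 then f e else 0) = (\<lambda>e. if e x = 0 then var_diff y z f e else 0)"
    by (auto simp: var_diff_def shift_var_def)
  moreover have "var_diffs (l # L) g = var_diffs L (var_diff y z g)" for g :: "(nat \<Rightarrow> int) \<Rightarrow> 'w"
    by (simp add: l)
  moreover have "set L \<subseteq> offdiag V" using Cons.prems by simp
  ultimately show ?case by (simp only: Cons.IH)
qed (simp only: fold_simps)

text \<open>The identity contributes a variable that occurs only with exponent \<open>0\<close>. No
  new factors are needed; the lower bound merely has to become at most \<open>0\<close>.\<close>

lemma compatible_seq_insert_id: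
  assumes "set pre \<subseteq> operators" "set post \<subseteq> operators" "compatible_seq s (pre @ post)"
  shows "compatible_seq s (pre @ id_operator # post)"
proof -
  let ?x = "length pre" and ?A = "[0..<length pre]" and ?B = "[Suc (length pre)..<Suc (length pre + length post)]"
  let ?V = "set (?A @ ?B)"
  obtain L where L: "set L \<subseteq> offdiag ?V" "\<And>w. trunc ?V (var_diffs L (named_product (?A @ ?B) (pre @ post) w))"
    using assms(3) compatible_seq_skip_iff[OF assms(1,2)] unfolding comp_named_def by blast
  have x: "?x \<notin> ?V" by (simp del: upt_Suc)
  have "named_product (?A @ ?x # ?B) (pre @ id_operator # post) w =
      (\<lambda>e. if e ?x = 0 then named_product (?A @ ?B) (pre @ post) w e else 0)" for w
    by (auto simp: named_product_split named_product_append id_operator_def operator_product_zero[OF assms(1)] simp del: upt_Suc)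
  then have var_diffs: "var_diffs L (named_product (?A @ ?x # ?B) (pre @ id_operator # post) w) =
      (\<lambda>e. if e ?x = 0 then var_diffs L (named_product (?A @ ?B) (pre @ post) w) e else 0)" for w
    by (simp only: var_diffs_delta[OF L(1) x])
  have "trunc (insert ?x ?V) (\<lambda>e. if e ?x = 0 then f e else 0)" if f: "trunc ?V f" for f :: "(nat \<Rightarrow> int) \<Rightarrow> 'w"
  proof -
    obtain N where N: "\<And>e. \<exists>v\<in>?V. e v < N \<Longrightarrow> f e = 0" using f unfolding trunc_def by blast
    have "(if e ?x = 0 then f e else 0) = 0" if "\<exists>v\<in>insert ?x ?V. e v < min N 0" for e
      using that by (auto intro!: N)
    then show ?thesis unfolding trunc_def by blast
  qed
  then have "\<forall>w. trunc (set (?A @ ?x # ?B)) (var_diffs L (named_product (?A @ ?x # ?B) (pre @ id_operator # post) w))"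
    using L(2) unfolding var_diffs by simp
  moreover have "set L \<subseteq> offdiag (set (?A @ ?x # ?B))" using L(1) unfolding offdiag_def by auto
  ultimately show ?thesis
    using compatible_seq_insert_iff[OF assms(1) id_operator_operator assms(2)] unfolding comp_named_def by blast
qed

text \<open>The factors serving \<open>a\<close> and those serving \<open>b\<close> are used
  together, each list being harmless for the other summand.\<close>

lemma compatible_seq_insert_add:
  assumes "set pre \<subseteq> operators" "a \<in> operators" "b \<in> operators" "a + b \<in> operators" "set post \<subseteq> operators"
    "compatible_seq s (pre @ a # post)" "compatible_seq s (pre @ b # post)"
  shows "compatible_seq s (pre @ (a + b) # post)"
proof -
  let ?N = "[0..<length pre] @ length pre # [Suc (length pre)..<Suc (length pre + length post)]"
  obtain L where L: "set L \<subseteq> offdiag (set ?N)" "\<And>w. trunc (set ?N) (var_diffs L (named_product ?N (pre @ a # post) w))"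
    using assms(6) compatible_seq_insert_iff[OF assms(1,2,5)] unfolding comp_named_def by blast
  obtain L' where L': "set L' \<subseteq> offdiag (set ?N)" "\<And>w. trunc (set ?N) (var_diffs L' (named_product ?N (pre @ b # post) w))"
    using assms(7) compatible_seq_insert_iff[OF assms(1,3,5)] unfolding comp_named_def by blast
  have eq: "named_product ?N (pre @ (a + b) # post) w = (\<lambda>e. named_product ?N (pre @ a # post) w e + named_product ?N (pre @ b # post) w e)" for w
    by (rule ext) (simp add: named_product_split operator_product_add[OF assms(1)] del: upt_Suc)
  have "var_diffs (L @ L') f = var_diffs (L' @ L) f" for f :: "(nat \<Rightarrow> int) \<Rightarrow> 'w"
    by (rule fun_cong[OF var_diffs_mset]) simp
  then have "trunc (set ?N) (var_diffs (L @ L') (named_product ?N (pre @ (a + b) # post) w))" for w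
    unfolding eq var_diffs_add using L(2) L'(2) by (intro trunc_add) (simp_all add: trunc_var_diffs del: upt_Suc, metis fold_append o_def trunc_var_diffs)
  moreover have "set (L @ L') \<subseteq> offdiag (set ?N)" using L L' by simp
  ultimately show ?thesis
    using compatible_seq_insert_iff[OF assms(1,4,5)] unfolding comp_named_def by blast
qed

lemma compatible_seq_insert_scale:
  assumes "set pre \<subseteq> operators" "a \<in> operators" "operator_scale s c a \<in> operators" "set post \<subseteq> operators"
    "compatible_seq s (pre @ a # post)"
  shows "compatible_seq s (pre @ operator_scale s c a # post)"
proof -
  let ?N = "[0..<length pre] @ length pre # [Suc (length pre)..<Suc (length pre + length post)]"
  obtain L where L: "set L \<subseteq> offdiag (set ?N)" "\<And>w. trunc (set ?N) (var_diffs L (named_product ?N (pre @ a # post) w))"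
    using assms(5) compatible_seq_insert_iff[OF assms(1,2,4)] unfolding comp_named_def by blast
  have eq: "named_product ?N (pre @ operator_scale s c a # post) w = (\<lambda>e. s c (named_product ?N (pre @ a # post) w e))" for w
    by (rule ext) (simp add: named_product_split operator_product_scale[OF assms(1)] operator_scale_def del: upt_Suc)
  have "trunc (set ?N) (var_diffs L (named_product ?N (pre @ operator_scale s c a # post) w))" for w
    unfolding eq var_diffs_additive[of "s c", OF scale_right_distrib]
    by (rule trunc_zero_unless[OF L(2)[of w] L(2)[of w]]) simp
  then show ?thesis
    using L(1) compatible_seq_insert_iff[OF assms(1,3,4)] unfolding comp_named_def by blast
qed

text \<open>The product takes over the name \<open>v\<close> of \<open>b\<close>, and the name
  \<open>u\<close> of \<open>a\<close> becomes the gap. The exponent \<open>k\<close> of the pair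
  alone makes the restriction to \<open>x_u = x_v\<close> meaningful; the factor list of the long
  sequence is needed only for truncation in all variables.\<close>

lemma compatible_seq_insert_nth_product:
  assumes "set pre \<subseteq> operators" and ab: "a \<in> operators" "b \<in> operators" and "set post \<subseteq> operators"
    and seq: "compatible_seq s (pre @ a # b # post)" and k: "compatible_order s k [a, b]"
  shows "compatible_seq s (pre @ nth_product s a n b # post)"
proof -
  define c where "c = nth_product s a n b"
  define u v where "u = length pre" and "v = Suc u"
  define A B where "A = [0..<u]" and "B = [Suc v..<Suc (v + length post)]"
  let ?F = "named_product (A @ u # v # B) (pre @ a # b # post)"
  let ?G = "\<lambda>w. (var_diff u v ^^ k) (?F w)"
  have c: "c \<in> operators" unfolding c_def by (rule nth_product_operator[OF ab k])
  have uv: "u \<noteq> v" "u \<notin> set A" "u \<notin> set B" "v \<notin> set A" "v \<notin> set B"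
    by (auto simp: A_def B_def v_def)
  have len: "length A = length pre" by (simp add: A_def u_def)
  have "comp_named (A @ u # v # B) (pre @ a # b # post)"
    using seq compatible_seq_insert_iff[of pre a "b # post"] assms
    by (simp add: A_def B_def u_def v_def upt_conv_Cons del: upt_Suc)
  then obtain L where L: "set L \<subseteq> offdiag (set (A @ u # v # B))"
    "\<And>w. trunc (set (A @ u # v # B)) (var_diffs L (?F w))"
    unfolding comp_named_def by blast
  have A2: "trunc2 ((diff2 ^^ k) (product2 a b w))" for w
    using k compatible_order_pair_iff[OF ab] by blast
  let ?h = "\<lambda>e x. operator_product pre x (map e A)"
  let ?w = "\<lambda>w e. operator_product post w (map e B)"
  have upd: "map (e(u := p, v := q)) A = map e A" "map (e(u := p, v := q)) B = map e B" for e :: "nat \<Rightarrow> int" and p q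
    using uv by auto
  have "sect u v (?F w) e = (\<lambda>p q. ?h e (product2 a b (?w w e) p q))" for w e
    unfolding sect_def named_product_split[OF len] list.map operator_product.simps upd product2_def using uv(1) by simp
  then have sect: "sect u v (?G w) e = (\<lambda>p q. ?h e ((diff2 ^^ k) (product2 a b (?w w e)) p q))" for w e
    using diff2_pow_additive[of "?h e", OF operator_product_add[OF assms(1)]]
    by (simp add: sect_var_diff_pow[OF uv(1)])
  \<comment> \<open>The operators in \<open>pre\<close> act on each coefficient separately and send
    zero to zero, so they cannot enlarge the support in \<open>x_u\<close> and
    \<open>x_v\<close>.\<close>
  have fin: "finite_diag_in u v (?G w)" for w
    unfolding finite_diag_in_def sect
    by (intro allI finite_diag_additive[where h = "?h e" for e, OF trunc2_imp_finite_diag[OF A2]]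
        operator_product_zero[OF assms(1)])
  have G: "dres u v (int k - 1 - n) (?G w) = named_product (A @ v # B) (pre @ c # post) w" for w
  proof
    fix e
    have "dres u v (int k - 1 - n) (?G w) e = ?h e (res2 (int k - 1 - n) ((diff2 ^^ k) (product2 a b (?w w e))) (e v))"
      unfolding dres_def sect
      by (rule res2_additive[where h = "?h e", symmetric, OF trunc2_imp_finite_diag[OF A2]
            operator_product_add[OF assms(1)] operator_product_scale[OF assms(1)]])
    then show "dres u v (int k - 1 - n) (?G w) e = named_product (A @ v # B) (pre @ c # post) w e"
      by (simp add: named_product_split[OF len] c_def nth_product_eq[OF ab k])
  qed
  obtain L' where L': "set L' \<subseteq> offdiag (set (A @ u # v # B) - {u})"
    "\<And>f j. finite_diag_in u v f \<Longrightarrow> trunc (set (A @ u # v # B)) (var_diffs L f) \<Longrightarrow> j \<le> int k - 1 - n \<Longrightarrow>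
      trunc (set (A @ u # v # B) - {u}) (var_diffs L' (dres u v j f))"
    using trunc_var_diffs_dres[of u "set (A @ u # v # B)" v L "int k - 1 - n"] uv(1) L(1) by auto
  have V: "set (A @ u # v # B) - {u} = set (A @ v # B)" using uv by auto
  \<comment> \<open>The \<open>k\<close> factors defining \<open>?G\<close> commute with those in
    \<open>L\<close>, hence \<open>L\<close> also truncates \<open>?G\<close>.\<close>
  have "trunc (set (A @ v # B)) (var_diffs L' (named_product (A @ v # B) (pre @ c # post) w))" for w
    using L'(2)[OF fin, of w "int k - 1 - n"] L(2)[of w] unfolding V G by (simp add: var_diffs_var_diff_pow trunc_var_diff_pow)
  then have "comp_named (A @ v # B) (pre @ c # post)"
    using L'(1) unfolding V comp_named_def by blast
  then show ?thesis
    using compatible_seq_skip_iff[of pre "c # post"] assms(1,4) c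
    by (simp add: A_def B_def u_def v_def upt_conv_Cons c_def del: upt_Suc)
qed

end

subsection \<open>Substitution and weak associativity on the module\<close>

lemma zchoose_0_left: "zchoose 0 j = (if j = 0 then 1 else 0)"
  using zchoose_eq_0[of 0 j] by (cases "j < 0") auto

lemma zchoose_Vandermonde:
  "(\<Sum>i\<le>q. zchoose m (int i) * zchoose n (int q - int i)) = zchoose (m + n) (int q)"
proof -
  have "zchoose n (int q - int i) = of_int n gchoose (q - i)" if "i \<le> q" for i
    using zchoose_int[of n "q - i"] that by (simp add: of_nat_diff)
  then show ?thesis
    using gbinomial_Vandermonde[of "of_int m :: complex" "of_int n" q]
    by (simp add: zchoose_int atLeast0AtMost)
qed

text \<open>Trinomial revision. For negative \<open>p\<close> both sides vanish: either
  \<open>p + i\<close> is negative, or it lies in \<open>0..i - 1\<close> and the first binomial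
  coefficient is zero.\<close>

lemma zchoose_trinomial:
  "zchoose (p + int i) (int i) * zchoose n (p + int i) = zchoose n p * zchoose (n - p) (int i)"
proof (cases "p \<ge> 0")
  case True
  then obtain k where p: "p = int k" by (metis zero_le_imp_eq_int)
  have "(of_int n gchoose (k + i)) * (of_nat (k + i) gchoose k :: complex) =
      (of_int n gchoose k) * (of_int n - of_nat k gchoose (k + i - k))"
    by (rule gbinomial_trinomial_revision) simp
  moreover have "(of_nat (k + i) gchoose k :: complex) = of_nat (k + i) gchoose i"
    using gbinomial_of_nat_symmetric[of k "k + i"] by simp
  ultimately show ?thesis
    by (simp add: p zchoose_def nat_add_distrib mult.commute)
next
  case False
  then show ?thesis
    using zchoose_eq_0[of "p + int i" "int i"] by (cases "p + int i < 0") auto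
qed

text \<open>Both sides are the coefficient of \<open>z0^p z2^q\<close> in
  \<open>(1 + z0 + z2)^n (1 + z2)^n'\<close>: on the left \<open>(1 + z1)^n\<close> is expanded in
  \<open>z1 = z0 + z2\<close>, on the right \<open>1 + z2\<close> is kept together. This is the
  numerical content of weak associativity.\<close>

lemma zchoose_sum:
  "(\<Sum>i\<le>q. zchoose (p + int i) (int i) * (zchoose n (p + int i) * zchoose n' (int q - int i)))
    = zchoose n p * zchoose (n - p + n') (int q)"
proof -
  have "(\<Sum>i\<le>q. zchoose (p + int i) (int i) * (zchoose n (p + int i) * zchoose n' (int q - int i)))
    = (\<Sum>i\<le>q. zchoose n p * (zchoose (n - p) (int i) * zchoose n' (int q - int i)))"
    by (rule sum.cong) (simp_all add: mult.assoc[symmetric] zchoose_trinomial)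
  then show ?thesis by (simp add: sum_distrib_left[symmetric] zchoose_Vandermonde)
qed

lemma funpow_sum2_local:
  assumes "\<And>p q'. q - int l \<le> q' \<Longrightarrow> f p q' = g p q'"
  shows "(sum2 ^^ l) f p q = (sum2 ^^ l) g p q"
  using assms
proof (induction l arbitrary: p q)
  case (Suc l)
  have "(sum2 ^^ l) f (p - 1) q = (sum2 ^^ l) g (p - 1) q"
    by (rule Suc.IH) (rule Suc.prems, simp)
  moreover have "(sum2 ^^ l) f p (q - 1) = (sum2 ^^ l) g p (q - 1)"
    by (rule Suc.IH) (rule Suc.prems, simp)
  ultimately show ?case by (simp add: sum2_def[of "(sum2 ^^ l) f"] sum2_def[of "(sum2 ^^ l) g"])
qed simp

lemma sum2_pow_shift: "(sum2 ^^ l) (\<lambda>p q. f (p + a) (q + b)) = (\<lambda>p q. (sum2 ^^ l) f (p + a) (q + b))"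
proof (induction l)
  case (Suc l)
  show ?case unfolding funpow.simps o_apply Suc
    by (simp add: sum2_def algebra_simps)
qed simp

lemma sum2_pow_additive:
  assumes "\<And>x y. h (x + y) = h x + h y"
  shows "(\<lambda>p q. h ((sum2 ^^ l) f p q)) = (sum2 ^^ l) (\<lambda>p q. h (f p q))"
proof (induction l)
  case (Suc l)
  show ?case unfolding funpow.simps o_apply Suc[symmetric]
    by (simp add: sum2_def assms)
qed simp

lemma bounded_snd_diff2_pow: "bounded_snd f \<Longrightarrow> bounded_snd ((diff2 ^^ k) f)"
  by (rule funpow_preserves[of bounded_snd, OF bounded_snd_diff2])

context series_space
begin

text \<open>A nonnegative power reads only finitely many coefficients, so the series may be cut off
  below \<open>q - int l\<close> without changing the value at \<open>q\<close>. No bound on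
  \<open>g\<close> is assumed, as is required for \<open>Y(Y(u, x0) v, x2) w\<close>, whose lower
  bound in \<open>x2\<close> may depend on the power of \<open>x0\<close>.\<close>

lemma binomial_mult_nat: "binomial_mult s 1 (int l) g = (sum2 ^^ l) g"
proof (intro ext)
  fix p q
  define g' where "g' = (\<lambda>p q'. if q' < q - int l then 0 else g p q')"
  have b: "bounded_snd g'" unfolding bounded_snd_def g'_def by (intro exI[of _ "q - int l"]) simp
  have "of_int (int l) gchoose i = (0 :: complex)" if "\<not> i \<le> l" for i
    using that by (simp add: gbinomial_binomial binomial_gbinomial[symmetric])
  then have "s ((of_int (int l) gchoose i) * 1 ^ i) (g (p - (int l - int i)) (q - int i)) =
      s ((of_int (int l) gchoose i) * 1 ^ i) (g' (p - (int l - int i)) (q - int i))" for i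
    by (cases "i \<le> l") (simp_all add: g'_def)
  then have "binomial_mult s 1 (int l) g p q = binomial_mult s 1 (int l) g' p q"
    unfolding binomial_mult_def by (rule Sum_any.cong)
  also have "\<dots> = (sum2 ^^ l) g' p q" unfolding binomial_mult_sum2[OF b] ..
  also have "\<dots> = (sum2 ^^ l) g p q" by (rule funpow_sum2_local) (simp add: g'_def)
  finally show "binomial_mult s 1 (int l) g p q = (sum2 ^^ l) g p q" .
qed

section \<open>The substitution \<open>x1 = x0 + x2\<close>\<close>

lemma subst_sum_zchoose:
  "subst_sum s f p q = Sum_any (\<lambda>i. s (zchoose (p + int i) (int i)) (f (p + int i) (q - int i)))"
  by (simp add: subst_sum_def zchoose_def)

lemma finite_subst_sum:
  assumes "bounded_snd f" shows "finite {i. s (t i) (f (r i) (q - int i)) \<noteq> 0}"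
proof -
  obtain N where N: "\<And>p q. q < N \<Longrightarrow> f p q = 0" using assms by (auto simp: bounded_snd_def)
  show ?thesis
  proof (rule finite_subset[of _ "{..nat (q - N)}"])
    show "{i. s (t i) (f (r i) (q - int i)) \<noteq> 0} \<subseteq> {..nat (q - N)}"
    proof (rule subsetI, rule ccontr)
      fix i assume i: "i \<in> {i. s (t i) (f (r i) (q - int i)) \<noteq> 0}" "i \<notin> {..nat (q - N)}"
      then have "q - int i < N" by auto
      with N i(1) show False by simp
    qed
  qed simp
qed

lemma bounded_snd_shift_fst: "bounded_snd f \<Longrightarrow> bounded_snd (\<lambda>p q. f (p - a) q)"
  unfolding bounded_snd_def by blast

text \<open>Under the substitution a factor \<open>x1\<close> becomes \<open>x0 + x2\<close>; on
  coefficients this is Pascal's rule.\<close>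

lemma subst_sum_shift_fst:
  assumes "bounded_snd f"
  shows "subst_sum s (\<lambda>p q. f (p - 1) q) = sum2 (subst_sum s f)"
proof (intro ext)
  fix p q
  obtain N where N: "\<And>p q. q < N \<Longrightarrow> f p q = 0" using assms by (auto simp: bounded_snd_def)
  define h where "h i = f (p - 1 + int i) (q - int i)" for i :: nat
  define K where "K = nat (q - N)"
  have h: "h i = 0" if "i > K" for i
    using that unfolding h_def K_def by (intro N) auto
  have fin: "finite {i. s (t i) (h (Suc i)) \<noteq> 0}" for t
    unfolding h_def using finite_subst_sum[OF assms, of t _ "q - 1"] by (simp add: algebra_simps)
  let ?z = "\<lambda>n (i::nat). zchoose n (int i)"
  have pas: "?z (p + int (Suc i)) (Suc i) = ?z (p - 1 + int (Suc i)) (Suc i) + ?z (p + int i) i" for i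
    using zchoose_add_one[of "p + int i" "int (Suc i)"] by (simp add: algebra_simps)
  have "subst_sum s (\<lambda>p q. f (p - 1) q) p q = Sum_any (\<lambda>i. s (?z (p + int i) i) (h i))"
    unfolding subst_sum_zchoose h_def by (simp add: algebra_simps)
  also have "\<dots> = h 0 + Sum_any (\<lambda>i. s (?z (p + int (Suc i)) (Suc i)) (h (Suc i)))"
    by (subst Sum_any_nat_Suc[where K=K]) (simp_all add: h)
  also have "\<dots> = h 0 + Sum_any (\<lambda>i. s (?z (p - 1 + int (Suc i)) (Suc i)) (h (Suc i)) + s (?z (p + int i) i) (h (Suc i)))"
    unfolding pas scale_left_distrib ..
  also have "\<dots> = h 0 + Sum_any (\<lambda>i. s (?z (p - 1 + int (Suc i)) (Suc i)) (h (Suc i)))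
      + Sum_any (\<lambda>i. s (?z (p + int i) i) (h (Suc i)))"
    by (subst Sum_any.distrib) (simp_all only: fin add.assoc)
  also have "h 0 + Sum_any (\<lambda>i. s (?z (p - 1 + int (Suc i)) (Suc i)) (h (Suc i)))
      = Sum_any (\<lambda>i. s (?z (p - 1 + int i) i) (h i))"
    by (subst Sum_any_nat_Suc[where K=K and g="\<lambda>i. s (?z (p - 1 + int i) i) (h i)"]) (simp_all add: h)
  also have "\<dots> = subst_sum s f (p - 1) q"
    unfolding subst_sum_zchoose h_def ..
  also have "Sum_any (\<lambda>i. s (?z (p + int i) i) (h (Suc i))) = subst_sum s f p (q - 1)"
    unfolding subst_sum_zchoose h_def by (simp add: algebra_simps)
  finally show "subst_sum s (\<lambda>p q. f (p - 1) q) p q = sum2 (subst_sum s f) p q"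
    by (simp add: sum2_def)
qed

lemma subst_sum_shift_fst_pow:
  assumes "bounded_snd f"
  shows "subst_sum s (\<lambda>p q. f (p - int l) q) = (sum2 ^^ l) (subst_sum s f)"
proof (induction l)
  case (Suc l)
  have "subst_sum s (\<lambda>p q. f (p - int (Suc l)) q) = subst_sum s (\<lambda>p q. (\<lambda>p q. f (p - int l) q) (p - 1) q)"
    by (simp add: algebra_simps)
  also have "\<dots> = sum2 (subst_sum s (\<lambda>p q. f (p - int l) q))"
    by (rule subst_sum_shift_fst[OF bounded_snd_shift_fst[OF assms]])
  finally show ?case using Suc by simp
qed simp

lemma subst_sum_shift_snd: "subst_sum s (\<lambda>p q. f p (q + c)) p q = subst_sum s f p (q + c)"
  unfolding subst_sum_zchoose by (simp add: algebra_simps)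

text \<open>Under the substitution \<open>x1 - x2\<close> becomes \<open>x0\<close>. Powers of
  \<open>x1 - x2\<close> thus turn into mere shifts of the first exponent.\<close>

lemma subst_sum_diff2:
  assumes "bounded_snd f"
  shows "subst_sum s (diff2 f) p q = subst_sum s f (p - 1) q"
proof -
  have "subst_sum s (diff2 f) p q = subst_sum s (\<lambda>p q. f (p - 1) q) p q - subst_sum s (\<lambda>p q. f p (q + (- 1))) p q"
    unfolding subst_sum_def diff2_def scale_right_diff_distrib
    by (subst Sum_any_diff) (use finite_subst_sum[OF assms] finite_subst_sum[OF assms, of _ _ "q - 1"] in \<open>simp_all add: algebra_simps\<close>)
  also have "\<dots> = sum2 (subst_sum s f) p q - subst_sum s f p (q - 1)"
    by (simp only: subst_sum_shift_fst[OF assms] subst_sum_shift_snd) simp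
  finally show ?thesis by (simp add: sum2_def)
qed

lemma subst_sum_diff2_pow:
  assumes "bounded_snd f"
  shows "subst_sum s ((diff2 ^^ k) f) (p + int k) q = subst_sum s f p q"
proof (induction k)
  case (Suc k)
  have "subst_sum s ((diff2 ^^ Suc k) f) (p + int (Suc k)) q = subst_sum s ((diff2 ^^ k) f) (p + int (Suc k) - 1) q"
    using subst_sum_diff2[OF bounded_snd_diff2_pow[OF assms]] by simp
  also have "p + int (Suc k) - 1 = p + int k" by simp
  finally show ?case using Suc by simp
qed simp

text \<open>For nonnegative powers of \<open>x1\<close> the expansions of \<open>(x0 + x2)^n\<close>
  in powers of \<open>x2\<close> and of \<open>x0\<close> coincide, by symmetry of binomial
  coefficients. Negative powers would separate the substitution from the Taylor expansion; removing
  them is the purpose of the factor \<open>(x0 + x2)^l\<close> in weak associativity.\<close>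

lemma subst_sum_eq_res2:
  assumes "trunc2 B" "\<And>p q. p < 0 \<Longrightarrow> B p q = 0"
  shows "subst_sum s B p q = res2 p B q"
proof (cases "p \<ge> 0")
  case True
  define G where "G n = s (zchoose n p) (B n (q + p - n))" for n
  define P where "P = {n. G n \<noteq> 0}"
  have G0: "G n = 0" if "n < p" for n
    using assms(2)[of n] zchoose_eq_0[of n p] that by (cases "n < 0") (auto simp: G_def)
  have "subst_sum s B p q = Sum_any (\<lambda>i. G (p + int i))"
    unfolding subst_sum_zchoose G_def
    using zchoose_symmetric[of "p + int i" "int i" for i] True by (simp add: algebra_simps)
  also have "\<dots> = sum G P"
    unfolding Sum_any.expand_set
    by (rule sum.reindex_bij_witness[of _ "\<lambda>n. nat (n - p)" "\<lambda>i. p + int i"])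
      (use G0 in \<open>auto simp: P_def not_less[symmetric]\<close>)
  finally show ?thesis by (simp add: res2_def Sum_any.expand_set P_def G_def)
next
  case False
  have "s (zchoose (p + int i) (int i)) (B (p + int i) (q - int i)) = 0" for i
    using assms(2)[of "p + int i"] zchoose_eq_0[of "p + int i" "int i"] False
    by (cases "p + int i < 0") auto
  then have "subst_sum s B p q = 0" unfolding subst_sum_zchoose by (simp only: Sum_any.neutral)
  then show ?thesis using False by simp
qed

lemma sum2_pow_res2:
  assumes "trunc2 A"
  shows "(sum2 ^^ l) (\<lambda>p q. res2 (c + p) A q) = (\<lambda>p q. res2 (c + p) (\<lambda>p q. A (p - int l) q) q)"
proof (induction l)
  case (Suc l)
  have "finite_diag (\<lambda>p q. A (p - int l) q)" for l
    by (induction l) (use finite_diag_shift_fst trunc2_imp_finite_diag[OF assms] in \<open>force simp: algebra_simps\<close>)+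
  then have "res2 j (\<lambda>p q. A (p - int (Suc l)) q) q = res2 j (\<lambda>p q. A (p - int l) q) (q - 1) + res2 (j - 1) (\<lambda>p q. A (p - int l) q) q" for j q
    using res2_shift_fst[of "\<lambda>p q. A (p - int l) q" j q] by (simp add: algebra_simps)
  then show ?case unfolding funpow.simps o_apply Suc by (simp add: sum2_def algebra_simps)
qed simp

text \<open>Up to the common factor \<open>x0^(-k)\<close>, one side substitutes
  \<open>x1 = x0 + x2\<close> into \<open>A\<close> and the other Taylor expands \<open>A\<close>.
  They agree as soon as \<open>x1^l\<close> has cleared the negative powers of
  \<open>x1\<close>.\<close>

lemma weak_associativity_pair:
  assumes ab: "a \<in> operators" "b \<in> operators" and k: "compatible_order s k [a, b]"
  shows "\<exists>l. weak_associativity (Y_E s) s (\<lambda>\<alpha>. \<alpha>) l a b w"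
proof -
  define f where "f = product2 a b w"
  define A where "A = (diff2 ^^ k) f"
  have A: "trunc2 A" using k compatible_order_pair_iff[OF ab] by (simp add: A_def f_def)
  have f: "bounded_snd f" unfolding f_def by (rule bounded_snd_product2[OF ab])
  obtain N where N: "\<And>p q. p < N \<or> q < N \<Longrightarrow> A p q = 0" using A unfolding trunc2_def by blast
  \<comment> \<open>The least natural number for which \<open>x1^l A\<close> is seen from the bound
    \<open>N\<close> to have no negative powers of \<open>x1\<close>. The bound, and hence
    \<open>l\<close>, depends on \<open>w\<close>.\<close>
  define l where "l = nat (- N)"
  define B where "B = (\<lambda>p q. A (p - int l) q)"
  have B0: "B p q = 0" if "p < 0" for p q using that by (auto simp: B_def l_def intro!: N)
  have "\<forall>p q. p < min 0 N \<or> q < min 0 N \<longrightarrow> B p q = 0"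
    using B0 N by (auto simp: B_def)
  then have B: "trunc2 B" unfolding trunc2_def by blast
  have bA: "bounded_snd A" using A by (simp add: trunc2_iff)
  have "(sum2 ^^ l) (subst_sum s f) p q = (sum2 ^^ l) (\<lambda>p q. Y_E s a b p w q) p q" for p q
  proof -
    have "subst_sum s f = (\<lambda>p q. subst_sum s A (p + int k) (q + 0))"
      using subst_sum_diff2_pow[OF f, of k] by (simp add: A_def fun_eq_iff)
    then have "(sum2 ^^ l) (subst_sum s f) p q = (sum2 ^^ l) (subst_sum s A) (p + int k) q"
      by (simp only: sum2_pow_shift) simp
    also have "\<dots> = subst_sum s B (p + int k) q"
      unfolding B_def subst_sum_shift_fst_pow[OF bA] ..
    also have "\<dots> = res2 (int k + p) B q"
      using subst_sum_eq_res2[OF B B0] by (simp add: add.commute)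
    also have "\<dots> = (sum2 ^^ l) (\<lambda>p q. res2 (int k + p) A q) p q"
      unfolding sum2_pow_res2[OF A] B_def ..
    also have "(\<lambda>p q. res2 (int k + p) A q) = (\<lambda>p q. Y_E s a b p w q)"
      unfolding Y_E_def nth_product_eq[OF ab k] A_def f_def by simp
    finally show ?thesis .
  qed
  then have "weak_associativity (Y_E s) s (\<lambda>\<alpha>. \<alpha>) l a b w"
    unfolding weak_associativity_def binomial_mult_nat f_def product2_def by (simp add: fun_eq_iff)
  then show ?thesis ..
qed

end

subsection \<open>Products of three operators\<close>

lemma var_diff_pow_commute: "(var_diff x y ^^ i) ((var_diff x' y' ^^ j) f) = (var_diff x' y' ^^ j) ((var_diff x y ^^ i) f)"
  using var_diffs_var_diff_pow[of "replicate i (x, y)" j x' y' f] by (simp add: var_diffs_replicate)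

lemma trunc_imp_trunc2:
  assumes "trunc V f" "u \<in> V" "v \<in> V" "u \<noteq> v" shows "trunc2 (sect u v f e)"
proof -
  obtain N where N: "\<And>e. (\<exists>v\<in>V. e v < N) \<Longrightarrow> f e = 0"
    using assms(1) unfolding trunc_def by blast
  have "\<forall>p q. p < N \<or> q < N \<longrightarrow> sect u v f e p q = 0"
  proof (intro allI impI)
    fix p q :: int assume "p < N \<or> q < N"
    then show "sect u v f e p q = 0"
      unfolding sect_def using assms(2-4) by (intro N) (auto intro: bexI[of _ u] bexI[of _ v])
  qed
  then show ?thesis unfolding trunc2_def by blast
qed

context series_space
begin

text \<open>With two names left, every factor is the same difference up to sign, so only the number
  of factors counts.\<close>

lemma trunc_var_diffs_pair:
  assumes "x < y" "set L \<subseteq> offdiag {x, y}"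
  shows "trunc V (var_diffs L f) \<longleftrightarrow> trunc V ((var_diff x y ^^ length L) f)"
proof -
  have "map (\<lambda>(x, y). (min x y, max x y)) L = replicate (length L) (x, y)"
    by (rule replicate_eqI) (use assms in \<open>auto simp: offdiag_def\<close>)
  then show ?thesis using var_diffs_orient[of V L f] by (simp add: var_diffs_replicate)
qed

lemma dres_var_diff_other_pow:
  assumes "u \<noteq> v" "finite_diag_in u v f" "x \<noteq> u" "y \<noteq> u"
  shows "dres u v j ((var_diff x y ^^ k) f) = (var_diff x y ^^ k) (dres u v j f)"
  by (induction k) (simp_all add: dres_var_diff_other finite_diag_in_var_diff_pow assms)

lemma trunc_dres_var_diff_pow:
  assumes uv: "u \<noteq> v" "x \<noteq> u" "x \<noteq> v" and X: "finite_diag_in u v X"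
    and tr: "\<And>j. j \<le> J \<Longrightarrow> trunc V (dres u v j X)" and "j \<le> J"
  shows "trunc V (dres u v j ((var_diff x u ^^ i) X))"
  using assms(6)
proof (induction i arbitrary: j)
  case 0
  then show ?case using tr by simp
next
  case (Suc i)
  have "dres u v j ((var_diff x u ^^ Suc i) X) =
      (\<lambda>e. var_diff x v (dres u v j ((var_diff x u ^^ i) X)) e - dres u v (j - 1) ((var_diff x u ^^ i) X) e)"
    using dres_var_diff_xu[OF uv(1) finite_diag_in_var_diff_pow[OF uv(1) X] uv(2)] by simp
  then show ?case using Suc by (simp add: trunc_diff trunc_var_diff)
qed

text \<open>In Taylor coordinates \<open>x = x_v + z1\<close> and \<open>x_u = x_v + z2\<close> the
  difference \<open>x - x_u\<close> equals \<open>z1 - z2\<close>; multiplying the generating series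
  of the orders by \<open>z1 - z2\<close> inserts a factor \<open>x - x_u\<close> into
  \<open>X\<close>. Only equal or smaller \<open>q\<close> are read, so a formula for
  \<open>F\<close> below the bound \<open>J\<close> suffices.\<close>

lemma diff2_pow_dres:
  assumes uvx: "u \<noteq> v" "x \<noteq> u" "x \<noteq> v" "x \<in> V" "v \<in> V" and X: "finite_diag_in u v X"
    and tr: "\<And>j. j \<le> J \<Longrightarrow> trunc V (dres u v j X)"
    and F: "\<And>p q. c + q \<le> J \<Longrightarrow> F p q = dres x v (d + p) (dres u v (c + q) X) e"
    and q: "c + q \<le> J"
  shows "(diff2 ^^ i) F p q = dres x v (d + p) (dres u v (c + q) ((var_diff x u ^^ i) X)) e"
  using q
proof (induction i arbitrary: p q)
  case 0
  then show ?case using F by simp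
next
  case (Suc i)
  let ?X = "(var_diff x u ^^ i) X"
  have fin: "finite_diag_in x v (dres u v j ?X)" if "j \<le> J" for j
    using trunc_imp_finite_diag_in[OF trunc_dres_var_diff_pow[OF uvx(1-3) X tr that]] uvx by blast
  have "dres x v (d + p) (dres u v (c + q) ((var_diff x u ^^ Suc i) X)) =
      dres x v (d + p) (\<lambda>e. var_diff x v (dres u v (c + q) ?X) e - dres u v (c + q - 1) ?X e)"
    using dres_var_diff_xu[OF uvx(1) finite_diag_in_var_diff_pow[OF uvx(1) X] uvx(2)] by simp
  also have "\<dots> = (\<lambda>e. dres x v (d + p) (var_diff x v (dres u v (c + q) ?X)) e - dres x v (d + p) (dres u v (c + q - 1) ?X) e)"
    using Suc.prems uvx by (intro dres_diff finite_diag_in_var_diff fin) auto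
  also have "dres x v (d + p) (var_diff x v (dres u v (c + q) ?X)) = dres x v (d + p - 1) (dres u v (c + q) ?X)"
    using Suc.prems uvx by (intro dres_var_diff_uv fin) auto
  finally show ?case
    using Suc.IH[of q "p - 1"] Suc.IH[of "q - 1" p] Suc.prems
    by (simp add: diff2_def[of "(diff2 ^^ i) F"] algebra_simps)
qed

lemma trunc_dres_var_diff_pow':
  assumes uv: "u \<noteq> v" "x \<noteq> u" "x \<noteq> v" and X: "finite_diag_in u v X"
    and tr: "\<And>j. j \<le> J \<Longrightarrow> trunc V (dres u v j X)" and "j \<le> J"
  shows "trunc V (dres u v j ((var_diff u x ^^ i) X))"
  using assms(6)
proof (induction i arbitrary: j)
  case 0
  then show ?case using tr by simp
next
  case (Suc i)
  have "dres u v j ((var_diff u x ^^ Suc i) X) =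
      (\<lambda>e. dres u v (j - 1) ((var_diff u x ^^ i) X) e - var_diff x v (dres u v j ((var_diff u x ^^ i) X)) e)"
    using dres_var_diff_xu[OF uv(1) finite_diag_in_var_diff_pow[OF uv(1) X] uv(2)] by (simp add: var_diff_swap[of u x] dres_minus)
  then show ?case using Suc by (simp add: trunc_diff trunc_var_diff)
qed

text \<open>Here the coordinates are nested, \<open>x_u = x_v + z0\<close> and
  \<open>x_v = x + z2\<close>, so the factor inserted by \<open>z0 + z2\<close> is
  \<open>x_u - x\<close>.\<close>

lemma sum2_pow_dres:
  assumes uvx: "u \<noteq> v" "x \<noteq> u" "x \<noteq> v" "x \<in> V" "v \<in> V" and X: "finite_diag_in u v X"
    and tr: "\<And>j. j \<le> J \<Longrightarrow> trunc V (dres u v j X)"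
    and G: "\<And>p q. c + p \<le> J \<Longrightarrow> G p q = dres v x (d + q) (dres u v (c + p) X) e"
    and p: "c + p \<le> J"
  shows "(sum2 ^^ i) G p q = dres v x (d + q) (dres u v (c + p) ((var_diff u x ^^ i) X)) e"
  using p
proof (induction i arbitrary: p q)
  case 0
  then show ?case using G by simp
next
  case (Suc i)
  let ?X = "(var_diff u x ^^ i) X"
  have fin: "finite_diag_in v x (dres u v j ?X)" if "j \<le> J" for j
    using trunc_imp_finite_diag_in[OF trunc_dres_var_diff_pow'[OF uvx(1-3) X tr that]] uvx by blast
  have "dres v x (d + q) (dres u v (c + p) ((var_diff u x ^^ Suc i) X)) =
      dres v x (d + q) (\<lambda>e. dres u v (c + p - 1) ?X e - var_diff x v (dres u v (c + p) ?X) e)"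
    using dres_var_diff_xu[OF uvx(1) finite_diag_in_var_diff_pow[OF uvx(1) X] uvx(2)] by (simp add: var_diff_swap[of u x] dres_minus)
  also have "\<dots> = (\<lambda>e. dres v x (d + q) (dres u v (c + p - 1) ?X) e - dres v x (d + q) (var_diff x v (dres u v (c + p) ?X)) e)"
    using Suc.prems uvx by (intro dres_diff finite_diag_in_var_diff fin) auto
  also have "dres v x (d + q) (var_diff x v (dres u v (c + p) ?X)) = (\<lambda>e. - dres v x (d + q - 1) (dres u v (c + p) ?X) e)"
    unfolding var_diff_swap[of x v] dres_minus using Suc.prems uvx
    by (subst dres_var_diff_uv) (auto intro!: fin)
  finally show ?case
    using Suc.IH[of "p - 1" q] Suc.IH[of p "q - 1"] Suc.prems
    by (simp add: sum2_def[of "(sum2 ^^ i) G"] algebra_simps)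
qed

text \<open>A restriction of order \<open>j\<close> lowers the total degree by \<open>j\<close>, so
  all contributing terms of \<open>B\<close> have degree \<open>S\<close>; truncation then confines
  two exponents to \<open>I\<close>. Both orders of restriction become sums over the same finite
  square, ready to be compared coefficient by coefficient.\<close>

lemma dres_dres_eq:
  assumes N: "\<And>e. \<exists>v\<in>{0, 1, 2}. e v < N \<Longrightarrow> B e = 0"
    and S: "S = e 2 + p + q" and I: "I = {N..S - 2 * N}"
    and C: "\<And>n n'. C n n' = B (e(0 := n, 1 := n', 2 := S - n - n'))"
  shows "dres 0 2 p (dres 1 2 q B) e = (\<Sum>n\<in>I. \<Sum>n'\<in>I. s (zchoose n p * zchoose n' q) (C n n'))"
    and "dres 1 2 q (dres 0 1 p B) e = (\<Sum>n\<in>I. \<Sum>n'\<in>I. s (zchoose n p * zchoose (n - p + n') q) (C n n'))"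
proof -
  have "C n n' = 0" if "\<not> (n \<in> I \<and> n' \<in> I)" for n n'
    unfolding C by (rule N) (use that in \<open>auto simp: I\<close>)
  then have C0: "n \<in> I" "n' \<in> I" if "C n n' \<noteq> 0" for n n'
    using that by blast+
  have fin: "finite I" by (simp add: I)
  have sub: "{n. s (t n) (\<Sum>n'\<in>J. s (u n') (D n n')) \<noteq> 0} \<subseteq> A"
    if D: "\<And>n n'. D n n' \<noteq> 0 \<Longrightarrow> n \<in> A" for t u :: "int \<Rightarrow> complex" and D A and J :: "int set"
  proof (rule subsetI, rule ccontr)
    fix n assume n: "n \<in> {n. s (t n) (\<Sum>n'\<in>J. s (u n') (D n n')) \<noteq> 0}" "n \<notin> A"
    then have "D n n' = 0" for n' using D by blast
    then show False using n(1) by simp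
  qed
  have I1: "Sum_any (\<lambda>n. s (t n) (C n' n)) = (\<Sum>n\<in>I. s (t n) (C n' n))" for t n'
    by (rule Sum_any.expand_superset[OF fin]) (use C0(2) in auto)
  have "dres 0 2 p (dres 1 2 q B) e = Sum_any (\<lambda>n. s (zchoose n p) (Sum_any (\<lambda>n'. s (zchoose n' q) (C n n'))))"
    unfolding dres_def res2_def sect_def C S
    by (simp add: fun_upd_twist algebra_simps)
  also have "\<dots> = (\<Sum>n\<in>I. s (zchoose n p) (\<Sum>n'\<in>I. s (zchoose n' q) (C n n')))"
    unfolding I1
    by (rule Sum_any.expand_superset[OF fin sub[OF C0(1)]])
  finally show "dres 0 2 p (dres 1 2 q B) e = (\<Sum>n\<in>I. \<Sum>n'\<in>I. s (zchoose n p * zchoose n' q) (C n n'))"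
    by (simp add: scale_sum_right)
  \<comment> \<open>The exponent of the intermediate merged variable is
    \<open>m = n + n' - p\<close>, and \<open>R\<close> is the range left to it when
    \<open>n\<close>, \<open>n'\<close> and \<open>S - n - n'\<close> are all at least
    \<open>N\<close>.\<close>
  define R where "R = {2 * N - p..e 2 + q - N}"
  have finR: "finite R" by (simp add: R_def)
  have "C n (m + p - n) = 0" if "m \<notin> R" for n m
    unfolding C by (rule N) (use that in \<open>auto simp: R_def S\<close>)
  then have R: "m \<in> R" if "C n (m + p - n) \<noteq> 0" for n m
    using that by blast
  have "dres 1 2 q (dres 0 1 p B) e = Sum_any (\<lambda>m. s (zchoose m q) (Sum_any (\<lambda>n. s (zchoose n p) (C n (m + p - n)))))"
    unfolding dres_def res2_def sect_def C S
    by (simp add: fun_upd_twist algebra_simps)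
  also have "(\<lambda>m. Sum_any (\<lambda>n. s (zchoose n p) (C n (m + p - n)))) = (\<lambda>m. \<Sum>n\<in>I. s (zchoose n p) (C n (m + p - n)))"
    by (intro ext Sum_any.expand_superset fin) (use C0(1) in auto)
  also have "Sum_any (\<lambda>m. s (zchoose m q) (\<Sum>n\<in>I. s (zchoose n p) (C n (m + p - n)))) =
      (\<Sum>m\<in>R. s (zchoose m q) (\<Sum>n\<in>I. s (zchoose n p) (C n (m + p - n))))"
    by (rule Sum_any.expand_superset[OF finR sub[OF R]])
  also have "\<dots> = (\<Sum>n\<in>I. \<Sum>m\<in>R. s (zchoose n p * zchoose m q) (C n (m + p - n)))"
    by (simp add: scale_sum_right sum.swap[of _ I R] mult.commute)
  also have "\<dots> = (\<Sum>n\<in>I. \<Sum>n'\<in>I. s (zchoose n p * zchoose (n - p + n') q) (C n n'))"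
  proof (rule sum.cong[OF refl])
    fix n
    have "(\<Sum>m\<in>R. s (zchoose n p * zchoose m q) (C n (m + p - n))) =
        Sum_any (\<lambda>m. s (zchoose n p * zchoose m q) (C n (m + p - n)))"
      by (rule Sum_any.expand_superset[OF finR, symmetric]) (use R in auto)
    also have "\<dots> = Sum_any (\<lambda>n'. s (zchoose n p * zchoose (n - p + n') q) (C n n'))"
      by (rule Sum_any.reindex_cong[of "\<lambda>n'. n - p + n'"])
        (auto simp: fun_eq_iff bij_plus)
    finally show "(\<Sum>m\<in>R. s (zchoose n p * zchoose m q) (C n (m + p - n))) =
      (\<Sum>n'\<in>I. s (zchoose n p * zchoose (n - p + n') q) (C n n'))"
      unfolding I1 .
  qed
  finally show "dres 1 2 q (dres 0 1 p B) e = (\<Sum>n\<in>I. \<Sum>n'\<in>I. s (zchoose n p * zchoose (n - p + n') q) (C n n'))" .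
qed

text \<open>Both sides are coefficients of Taylor expansions of \<open>B\<close>, in \<open>(x + z\<^sub>1, x + z\<^sub>2, x)\<close> and in
  \<open>(x + z\<^sub>2 + z\<^sub>0, x + z\<^sub>2, x)\<close>.\<close>

lemma subst_sum_dres:
  assumes "trunc {0, 1, 2} B"
  shows "subst_sum s (\<lambda>p q. dres 0 2 p (dres 1 2 q B) e) p q = dres 1 2 q (dres 0 1 p B) e"
proof (cases "q < 0")
  case True
  then show ?thesis by (simp add: subst_sum_def dres_def res2_def sect_def)
next
  case False
  obtain N where N: "\<And>e. \<exists>v\<in>{0, 1, 2}. e v < N \<Longrightarrow> B e = 0"
    using assms unfolding trunc_def by blast
  define r where "r = nat q"
  have q: "q = int r" using False by (simp add: r_def)
  define S where "S = e 2 + p + q"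
  define I where "I = {N..S - 2 * N}"
  define C where "C n n' = B (e(0 := n, 1 := n', 2 := S - n - n'))" for n n'
  have H: "dres 0 2 (p + int i) (dres 1 2 (q - int i) B) e =
      (\<Sum>n\<in>I. \<Sum>n'\<in>I. s (zchoose n (p + int i) * zchoose n' (q - int i)) (C n n'))" for i
    by (rule dres_dres_eq(1)[where C = C, OF N _ I_def]) (simp_all add: S_def C_def)
  have zero: "dres 1 2 (q - int i) B = (\<lambda>e. 0)" if "r < i" for i
    using that by (simp add: q)
  have "subst_sum s (\<lambda>p q. dres 0 2 p (dres 1 2 q B) e) p q =
      Sum_any (\<lambda>i. s (zchoose (p + int i) (int i)) (dres 0 2 (p + int i) (dres 1 2 (q - int i) B) e))"
    unfolding subst_sum_zchoose ..
  also have "\<dots> = (\<Sum>i\<le>r. s (zchoose (p + int i) (int i)) (dres 0 2 (p + int i) (dres 1 2 (q - int i) B) e))"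
  proof (rule Sum_any.expand_superset)
    have "dres 0 2 (p + int i) (dres 1 2 (q - int i) B) e = 0" if "r < i" for i
      unfolding zero[OF that] by (simp add: dres_def res2_def sect_def)
    then show "{i. s (zchoose (p + int i) (int i)) (dres 0 2 (p + int i) (dres 1 2 (q - int i) B) e) \<noteq> 0} \<subseteq> {..r}"
      by (auto simp: not_less[symmetric])
  qed simp
  also have "\<dots> = (\<Sum>i\<le>r. \<Sum>n\<in>I. \<Sum>n'\<in>I.
      s (zchoose (p + int i) (int i) * (zchoose n (p + int i) * zchoose n' (q - int i))) (C n n'))"
    unfolding H by (simp add: scale_sum_right)
  also have "\<dots> = (\<Sum>n\<in>I. \<Sum>n'\<in>I. \<Sum>i\<le>r.
      s (zchoose (p + int i) (int i) * (zchoose n (p + int i) * zchoose n' (q - int i))) (C n n'))"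
    by (subst sum.swap) (subst (2) sum.swap, simp)
  also have "\<dots> = (\<Sum>n\<in>I. \<Sum>n'\<in>I. s (zchoose n p * zchoose (n - p + n') q) (C n n'))"
    unfolding scale_sum_left[symmetric] q zchoose_sum ..
  also have "\<dots> = dres 1 2 q (dres 0 1 p B) e"
    by (rule dres_dres_eq(2)[where C = C, OF N _ I_def, symmetric]) (simp_all add: S_def C_def)
  finally show ?thesis .
qed

end

section \<open>Iterated vertex operators as double Taylor expansions\<close>

context series_space
begin

lemma Y_E_eq:
  assumes "a \<in> operators" "b \<in> operators" "compatible_order s k [a, b]"
  shows "Y_E s a b p w m = res2 (int k + p) ((diff2 ^^ k) (product2 a b w)) m"
  unfolding Y_E_def nth_product_eq[OF assms] by simp

lemma Y_E_operator:
  assumes "a \<in> operators" "b \<in> operators" "compatible_order s k [a, b]"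
  shows "Y_E s a b p \<in> operators"
  unfolding Y_E_def by (rule nth_product_operator[OF assms])

text \<open>The order \<open>int k + p\<close> is negative. The bound does not depend on
  \<open>w\<close>, so the truncation holds for operators and not merely for their values.\<close>

lemma Y_E_neg:
  assumes "a \<in> operators" "b \<in> operators" "compatible_order s k [a, b]" "p < - int k"
  shows "Y_E s a b p = 0"
  using assms(4) by (simp add: fun_eq_iff Y_E_eq[OF assms(1-3)])

text \<open>The names \<open>0\<close>, \<open>1\<close>, \<open>2\<close> belong to
  \<open>a\<close>, \<open>b\<close>, \<open>c\<close>. With \<open>x0 = x + z1\<close>,
  \<open>x1 = x + z2\<close> and \<open>x2 = x\<close>, the factor \<open>(z1 - z2)^k\<close>
  supplies the missing factors between \<open>a\<close> and \<open>b\<close>; the shifts by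
  \<open>k\<close> account for the pairs \<open>(a, c)\<close> and \<open>(b, c)\<close>.\<close>

lemma diff2_pow_Y_E:
  assumes abc: "a \<in> operators" "b \<in> operators" "c \<in> operators" and k: "compatible_order s k [b, c]"
    and B: "\<And>w. B w = (var_diff 0 2 ^^ k) ((var_diff 0 1 ^^ k) ((var_diff 1 2 ^^ k) (named_product [0, 1, 2] [a, b, c] w)))"
    and trunc: "\<And>w. trunc {0, 1, 2} (B w)" and e: "e 2 = m"
  shows "(diff2 ^^ k) (\<lambda>p q. Y_E s a (Y_E s b c q) p w m) p q =
    dres 0 2 (int k + p) (dres 1 2 (int k + q) (B w)) e"
proof -
  define X where "X w = (var_diff 1 2 ^^ k) (named_product [0, 1, 2] [a, b, c] w)" for w
  have "sect 1 2 (named_product [0, 1, 2] [a, b, c] w) e = (\<lambda>p q. a (product2 b c w p q) (e 0))" for w e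
    by (simp add: sect_def named_product_def product2_def)
  then have sectX: "sect 1 2 (X w) e = (\<lambda>p q. a ((diff2 ^^ k) (product2 b c w) p q) (e 0))" for w e
    unfolding X_def by (simp add: sect_var_diff_pow diff2_pow_additive[of "\<lambda>x. a x (e 0)", OF operator_add[OF abc(1)]])
  have finite_diag: "finite_diag ((diff2 ^^ k) (product2 b c w))" for w
    using k compatible_order_pair_iff[OF abc(2,3)] trunc2_imp_finite_diag by blast
  have fin: "finite_diag_in 1 2 (X w)" for w
    unfolding finite_diag_in_def sectX
    by (intro allI finite_diag_additive[where h = "\<lambda>x. a x n" for n, OF finite_diag] operator_zero[OF abc(1)])
  have prod: "product2 a (Y_E s b c q) w = sect 0 2 (dres 1 2 (int k + q) (X w)) e" for q w e
  proof (intro ext)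
    fix p' q'
    have "sect 0 2 (dres 1 2 (int k + q) (X w)) e p' q' =
        res2 (int k + q) (\<lambda>p q. a ((diff2 ^^ k) (product2 b c w) p q) p') q'"
      unfolding sect_def[of 0] dres_def sectX by simp
    also have "\<dots> = a (res2 (int k + q) ((diff2 ^^ k) (product2 b c w)) q') p'"
      by (rule res2_additive[where h = "\<lambda>x. a x p'", symmetric, OF finite_diag operator_add[OF abc(1)] operator_scale[OF abc(1)]])
    finally show "product2 a (Y_E s b c q) w p' q' = sect 0 2 (dres 1 2 (int k + q) (X w)) e p' q'"
      by (simp add: product2_def Y_E_eq[OF abc(2,3) k])
  qed
  define J where "J = int k + q"
  let ?L = "replicate k (0, 1) @ replicate k (0, 2) :: (nat \<times> nat) list"
  have BL: "B w = var_diffs ?L (X w)" for w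
    by (simp add: B X_def var_diffs_replicate)
  have "set ?L \<subseteq> offdiag {0, 1, 2}" by (auto simp: offdiag_def)
  then obtain L' where L': "set L' \<subseteq> offdiag ({0, 1, 2} - {1})"
    and "\<And>f j. finite_diag_in 1 2 f \<Longrightarrow> trunc {0, 1, 2} (var_diffs ?L f) \<Longrightarrow> j \<le> J \<Longrightarrow>
      trunc ({0, 1, 2} - {1}) (var_diffs L' (dres 1 2 j f))"
    using trunc_var_diffs_dres[of 1 "{0, 1, 2}" 2 ?L J] by auto
  then have L'X: "trunc {0, 2} (var_diffs L' (dres 1 2 j (X w)))" if "j \<le> J" for j w
    using fin trunc that unfolding BL by (simp add: insert_Diff_if)
  \<comment> \<open>The first summand makes \<open>a\<close> compatible with all modes whose order
    is at most \<open>J\<close>; the second supplies the factors \<open>x0 - x2\<close> contained in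
    \<open>B\<close>.\<close>
  define K where "K = length L' + k"
  have "{0, 1, 2} - {1} = {0, 2 :: nat}" by auto
  then have tr: "trunc {0, 2} ((var_diff 0 2 ^^ length L') (dres 1 2 j (X w)))" if "j \<le> J" for j w
    using trunc_var_diffs_pair[of 0 2 L' "{0, 2}" "dres 1 2 j (X w)"] L' L'X[OF that] by simp
  have "trunc {0, 2} ((var_diff 0 2 ^^ k) ((var_diff 0 2 ^^ length L') (dres 1 2 j (X w))))" if "j \<le> J" for j w
    by (rule trunc_var_diff_pow[OF tr[OF that]])
  then have trK: "trunc {0, 2} ((var_diff 0 2 ^^ K) (dres 1 2 j (X w)))" if "j \<le> J" for j w
    using that by (simp add: K_def funpow_add add.commute[of _ k])
  have out: "dres 1 2 j ((var_diff 0 2 ^^ K) (X w)) = (var_diff 0 2 ^^ K) (dres 1 2 j (X w))" for j w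
    by (rule dres_var_diff_other_pow) (simp_all add: fin del: One_nat_def)
  have F: "Y_E s a (Y_E s b c q) p w m = dres 0 2 (int K + p) (dres 1 2 (int k + q) ((var_diff 0 2 ^^ K) (X w))) e"
    if "int k + q \<le> J" for p q
  proof -
    have operators: "Y_E s b c q \<in> operators" by (rule Y_E_operator[OF abc(2,3) k])
    have K: "compatible_order s K [a, Y_E s b c q]"
      unfolding compatible_order_pair_iff[OF abc(1) operators] prod[where e = e]
      using trunc_imp_trunc2[OF trK[OF that]] by (simp add: sect_var_diff_pow[symmetric])
    show ?thesis
      unfolding Y_E_eq[OF abc(1) operators K] prod[where e = e] out
      by (simp add: dres_def[of 0] sect_var_diff_pow e del: One_nat_def)
  qed
  have "(diff2 ^^ k) (\<lambda>p q. Y_E s a (Y_E s b c q) p w m) p q =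
      dres 0 2 (int K + p) (dres 1 2 (int k + q) ((var_diff 0 1 ^^ k) ((var_diff 0 2 ^^ K) (X w)))) e"
    by (rule diff2_pow_dres[where V = "{0, 2}" and J = J])
      (simp_all add: fin finite_diag_in_var_diff_pow out trK F J_def del: One_nat_def)
  also have "(var_diff 0 1 ^^ k) ((var_diff 0 2 ^^ K) (X w)) = (var_diff 0 2 ^^ length L') (B w)"
    unfolding K_def funpow_add o_apply B X_def[symmetric] var_diff_pow_commute[of k 0 1 _ 0 2] ..
  also have "dres 1 2 (int k + q) \<dots> = (var_diff 0 2 ^^ length L') (dres 1 2 (int k + q) (B w))"
    by (rule dres_var_diff_other_pow) (simp_all add: trunc_imp_finite_diag_in[OF trunc] del: One_nat_def)
  \<comment> \<open>The surplus \<open>length L'\<close> factors lower the order from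
    \<open>int K + p\<close> to \<open>int k + p\<close>. The auxiliary exponent, which depended on
    \<open>q\<close>, has disappeared.\<close>
  also have "dres 0 2 (int K + p) \<dots> = dres 0 2 (int k + p) (dres 1 2 (int k + q) (B w))"
  proof -
    have "trunc ({0, 1, 2} - {1}) (dres 1 2 (int k + q) (B w))"
      by (rule trunc_dres[OF trunc]) simp_all
    then have "finite_diag_in 0 2 (dres 1 2 (int k + q) (B w))" by (rule trunc_imp_finite_diag_in) simp_all
    then show ?thesis by (subst dres_var_diff_uv_pow) (simp_all add: K_def del: One_nat_def)
  qed
  finally show ?thesis .
qed

text \<open>The counterpart for the other bracketing: the restriction now merges \<open>a\<close>
  with \<open>b\<close> before \<open>c\<close>, so \<open>x0 - x2\<close> equals
  \<open>z0 + z2\<close>. The missing factors lie between \<open>a\<close> and \<open>c\<close>, and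
  the auxiliary exponent belongs to the pair \<open>(1, 2)\<close>.\<close>

lemma sum2_pow_Y_E:
  assumes abc: "a \<in> operators" "b \<in> operators" "c \<in> operators" and k: "compatible_order s k [a, b]"
    and B: "\<And>w. B w = (var_diff 0 2 ^^ k) ((var_diff 0 1 ^^ k) ((var_diff 1 2 ^^ k) (named_product [0, 1, 2] [a, b, c] w)))"
    and trunc: "\<And>w. trunc {0, 1, 2} (B w)" and e: "e 2 = m"
  shows "(sum2 ^^ k) (\<lambda>p q. Y_E s (Y_E s a b p) c q w m) p q =
    dres 1 2 (int k + q) (dres 0 1 (int k + p) (B w)) e"
proof -
  define X where "X w = (var_diff 0 1 ^^ k) (named_product [0, 1, 2] [a, b, c] w)" for w
  have "sect 0 1 (named_product [0, 1, 2] [a, b, c] w) e = product2 a b (c w (e 2))" for w e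
    by (simp add: sect_def named_product_def product2_def)
  then have sectX: "sect 0 1 (X w) e = (diff2 ^^ k) (product2 a b (c w (e 2)))" for w e
    unfolding X_def by (simp add: sect_var_diff_pow)
  have finite_diag: "finite_diag ((diff2 ^^ k) (product2 a b w))" for w
    using k compatible_order_pair_iff[OF abc(1,2)] trunc2_imp_finite_diag by blast
  have fin: "finite_diag_in 0 1 (X w)" for w
    unfolding finite_diag_in_def sectX by (intro allI finite_diag)
  have prod: "product2 (Y_E s a b p) c w = sect 1 2 (dres 0 1 (int k + p) (X w)) e" for p w e
    unfolding sect_def[of 1] dres_def sectX by (simp add: product2_def Y_E_eq[OF abc(1,2) k] fun_eq_iff)
  define J where "J = int k + p"
  let ?L = "replicate k (1, 2) @ replicate k (0, 2) :: (nat \<times> nat) list"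
  have "var_diffs ?L (X w) = (var_diff 0 2 ^^ k) ((var_diff 1 2 ^^ k) (X w))" for w
    by (simp add: var_diffs_replicate)
  then have BL: "B w = var_diffs ?L (X w)" and BL': "B w = (var_diff 0 2 ^^ k) ((var_diff 1 2 ^^ k) (X w))" for w
    unfolding B X_def var_diff_pow_commute[of k 0 1 k 1 2] by simp_all
  have "set ?L \<subseteq> offdiag {0, 1, 2}" by (auto simp: offdiag_def)
  then obtain L' where L': "set L' \<subseteq> offdiag ({0, 1, 2} - {0})"
    and "\<And>f j. finite_diag_in 0 1 f \<Longrightarrow> trunc {0, 1, 2} (var_diffs ?L f) \<Longrightarrow> j \<le> J \<Longrightarrow>
      trunc ({0, 1, 2} - {0}) (var_diffs L' (dres 0 1 j f))"
    using trunc_var_diffs_dres[of 0 "{0, 1, 2}" 1 ?L J] by auto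
  then have L'X: "trunc {1, 2} (var_diffs L' (dres 0 1 j (X w)))" if "j \<le> J" for j w
    using fin trunc that unfolding BL by (simp add: insert_Diff_if)
  define K where "K = length L' + k"
  have "{0, 1, 2} - {0} = {1, 2 :: nat}" by auto
  then have tr: "trunc {1, 2} ((var_diff 1 2 ^^ length L') (dres 0 1 j (X w)))" if "j \<le> J" for j w
    using trunc_var_diffs_pair[of 1 2 L' "{1, 2}" "dres 0 1 j (X w)"] L' L'X[OF that] by simp
  have "trunc {1, 2} ((var_diff 1 2 ^^ k) ((var_diff 1 2 ^^ length L') (dres 0 1 j (X w))))" if "j \<le> J" for j w
    by (rule trunc_var_diff_pow[OF tr[OF that]])
  then have trK: "trunc {1, 2} ((var_diff 1 2 ^^ K) (dres 0 1 j (X w)))" if "j \<le> J" for j w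
    using that by (simp add: K_def funpow_add add.commute[of _ k])
  have out: "dres 0 1 j ((var_diff 1 2 ^^ K) (X w)) = (var_diff 1 2 ^^ K) (dres 0 1 j (X w))" for j w
    by (rule dres_var_diff_other_pow) (simp_all add: fin del: One_nat_def)
  have G: "Y_E s (Y_E s a b p) c q w m = dres 1 2 (int K + q) (dres 0 1 (int k + p) ((var_diff 1 2 ^^ K) (X w))) e"
    if "int k + p \<le> J" for p q
  proof -
    have operators: "Y_E s a b p \<in> operators" by (rule Y_E_operator[OF abc(1,2) k])
    have K: "compatible_order s K [Y_E s a b p, c]"
      unfolding compatible_order_pair_iff[OF operators abc(3)] prod[where e = e]
      using trunc_imp_trunc2[OF trK[OF that]] by (simp add: sect_var_diff_pow[symmetric])
    show ?thesis
      unfolding Y_E_eq[OF operators abc(3) K] prod[where e = e] out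
      by (simp add: dres_def[of 1] sect_var_diff_pow e del: One_nat_def)
  qed
  have "(sum2 ^^ k) (\<lambda>p q. Y_E s (Y_E s a b p) c q w m) p q =
      dres 1 2 (int K + q) (dres 0 1 (int k + p) ((var_diff 0 2 ^^ k) ((var_diff 1 2 ^^ K) (X w)))) e"
    by (rule sum2_pow_dres[where V = "{1, 2}" and J = J])
      (simp_all add: fin finite_diag_in_var_diff_pow out trK G J_def del: One_nat_def)
  also have "(var_diff 0 2 ^^ k) ((var_diff 1 2 ^^ K) (X w)) = (var_diff 1 2 ^^ length L') (B w)"
    unfolding K_def funpow_add o_apply BL' var_diff_pow_commute[of k 0 2 _ 1 2] ..
  also have "dres 0 1 (int k + p) \<dots> = (var_diff 1 2 ^^ length L') (dres 0 1 (int k + p) (B w))"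
    by (rule dres_var_diff_other_pow) (simp_all add: trunc_imp_finite_diag_in[OF trunc] del: One_nat_def)
  also have "dres 1 2 (int K + q) \<dots> = dres 1 2 (int k + q) (dres 0 1 (int k + p) (B w))"
  proof -
    have "trunc ({0, 1, 2} - {0}) (dres 0 1 (int k + p) (B w))"
      by (rule trunc_dres[OF trunc]) simp_all
    then have "finite_diag_in 1 2 (dres 0 1 (int k + p) (B w))" by (rule trunc_imp_finite_diag_in) simp_all
    then show ?thesis by (subst dres_var_diff_uv_pow) (simp_all add: K_def del: One_nat_def)
  qed
  finally show ?thesis .
qed

lemma vector_space_operator_scale: "vector_space (operator_scale s)"
  by unfold_locales (simp_all add: operator_scale_def fun_eq_iff scale_right_distrib scale_left_distrib)

lemma series_space_operator_scale: "series_space (operator_scale s)"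
  by (simp add: series_space_def vector_space_operator_scale)

text \<open>Evaluation at \<open>w\<close> and \<open>m\<close> is additive, hence commutes with
  finite sums; \<open>Sum_any\<close> over an infinite support would be zero regardless of the
  values, so the bound on \<open>F\<close> matters.\<close>

lemma subst_sum_apply:
  assumes "bounded_snd F"
  shows "subst_sum (operator_scale s) F p q w m = subst_sum s (\<lambda>p q. F p q w m) p q"
  unfolding subst_sum_def
  by (rule trans[OF Sum_any_additive[where h = "\<lambda>x. x w m",
          OF series_space.finite_subst_sum[OF series_space_operator_scale assms]]])
    (simp_all add: operator_scale_def)

text \<open>Under \<open>z1 = z0 + z2\<close> the factor \<open>(z1 - z2)^k\<close> becomes a shift
  in \<open>z0\<close>, while the prefactor \<open>z1^(-k)\<close> is cleared by
  \<open>(z0 + z2)^k\<close>. What remains is the substitution in a Taylor expansion with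
  nonnegative orders, so the exponent of weak associativity is \<open>k\<close> itself.\<close>

lemma weak_associativity_triple:
  assumes abc: "a \<in> operators" "b \<in> operators" "c \<in> operators"
    and k: "compatible_order s k [a, b]" "compatible_order s k [b, c]"
    and trunc: "\<And>w. trunc {0, 1, 2} ((var_diff 0 2 ^^ k) ((var_diff 0 1 ^^ k) ((var_diff 1 2 ^^ k) (named_product [0, 1, 2] [a, b, c] w))))"
  shows "weak_associativity (Y_E s) (operator_scale s) (Y_E s) k a b c"
proof -
  define F where "F = (\<lambda>p q. Y_E s a (Y_E s b c q) p)"
  define G where "G = (\<lambda>p q. Y_E s (Y_E s a b p) c q)"
  define B where "B w = (var_diff 0 2 ^^ k) ((var_diff 0 1 ^^ k) ((var_diff 1 2 ^^ k) (named_product [0, 1, 2] [a, b, c] w)))" for w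
  have zero: "0 \<in> operators" by (rule operator_I) auto
  have "compatible_order s 0 [a, 0]"
    unfolding compatible_order_pair_iff[OF abc(1) zero] by (simp add: product2_def operator_zero[OF abc(1)] trunc2_def)
  note Y0 = Y_E_eq[OF abc(1) zero this]
  have "(diff2 ^^ 0) (product2 a 0 w) = (\<lambda>p q. 0)" for w
    by (simp add: product2_def operator_zero[OF abc(1)])
  then have Y0: "Y_E s a 0 p = 0" for p
    unfolding fun_eq_iff Y0 by (simp only: res2_def scale_zero_right Sum_any.neutral zero_fun_apply simp_thms)
  have "F p q = 0" if "q < - int k" for p q
    unfolding F_def Y_E_neg[OF abc(2,3) k(2) that] by (rule Y0)
  then have bF: "bounded_snd F" unfolding bounded_snd_def by blast
  then have bF': "bounded_snd (\<lambda>p q. F p q w m)" for w m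
    unfolding bounded_snd_def by (metis zero_fun_apply)
  have "(sum2 ^^ k) (subst_sum (operator_scale s) F) p q w m = (sum2 ^^ k) G p q w m" for p q w m
  proof -
    define e :: "nat \<Rightarrow> int" where "e = (\<lambda>_. m)"
    have e: "e 2 = m" by (simp add: e_def)
    define f where "f = (\<lambda>p q. F p q w m)"
    define H where "H = (\<lambda>p q. dres 0 2 p (dres 1 2 (q + int k) (B w)) e)"
    have H: "(diff2 ^^ k) f = (\<lambda>p q. H (p + int k) q)"
      using diff2_pow_Y_E[where B = B and e = e, OF abc k(2) B_def trunc[folded B_def] e]
      by (simp add: f_def F_def H_def fun_eq_iff add.commute)
    have bf: "bounded_snd ((diff2 ^^ k) f)" unfolding f_def by (rule bounded_snd_diff2_pow[OF bF'])
    \<comment> \<open>\<open>H\<close> is \<open>(diff2 ^^ k) f\<close> multiplied by the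
      \<open>k\<close>-th power of the first variable, which the substitution turns into the factor
      \<open>(z0 + z2)^k\<close>.\<close>
    have subst_H: "subst_sum s H = (sum2 ^^ k) (subst_sum s ((diff2 ^^ k) f))"
      using subst_sum_shift_fst_pow[OF bf, of k] by (simp add: H)
    have "(sum2 ^^ k) (subst_sum (operator_scale s) F) p q w m =
        (sum2 ^^ k) (\<lambda>p q. subst_sum (operator_scale s) F p q w m) p q"
      using sum2_pow_additive[of "\<lambda>x. x w m" k "subst_sum (operator_scale s) F"] by (simp add: fun_eq_iff)
    also have "(\<lambda>p q. subst_sum (operator_scale s) F p q w m) = subst_sum s f"
      by (simp add: subst_sum_apply[OF bF] f_def)
    also have "\<dots> = (\<lambda>p q. subst_sum s ((diff2 ^^ k) f) (p + int k) (q + 0))"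
      using subst_sum_diff2_pow[OF bF', of k] by (simp add: f_def)
    also have "(sum2 ^^ k) \<dots> p q = (sum2 ^^ k) (subst_sum s ((diff2 ^^ k) f)) (p + int k) q"
      unfolding sum2_pow_shift by simp
    also have "\<dots> = subst_sum s H (p + int k) q"
      unfolding subst_H ..
    also have "\<dots> = subst_sum s (\<lambda>p q. dres 0 2 p (dres 1 2 q (B w)) e) (p + int k) (q + int k)"
      unfolding H_def by (rule subst_sum_shift_snd)
    also have "\<dots> = dres 1 2 (int k + q) (dres 0 1 (int k + p) (B w)) e"
      using subst_sum_dres[of "B w"] trunc[of w] by (simp add: B_def add.commute)
    also have "\<dots> = (sum2 ^^ k) (\<lambda>p q. G p q w m) p q"
      using sum2_pow_Y_E[where B = B and e = e, OF abc k(1) B_def trunc[folded B_def] e] by (simp add: G_def)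
    also have "\<dots> = (sum2 ^^ k) G p q w m"
      using sum2_pow_additive[of "\<lambda>x. x w m" k G] by (simp add: fun_eq_iff)
    finally show ?thesis .
  qed
  then show ?thesis
    unfolding weak_associativity_def series_space.binomial_mult_nat[OF series_space_operator_scale]
      F_def G_def by (simp add: fun_eq_iff)
qed

end

context series_space
begin

lemma compatible_order_pair_mono:
  assumes "a \<in> operators" "b \<in> operators" "compatible_order s k [a, b]" "k \<le> k'"
  shows "compatible_order s k' [a, b]"
proof -
  have "trunc2 ((diff2 ^^ (k' - k)) A)" if "trunc2 A" for A :: "int \<Rightarrow> int \<Rightarrow> 'w"
    using that bounded_fst_diff2 bounded_snd_diff2 unfolding trunc2_iff
    by (intro conjI funpow_preserves[of bounded_fst] funpow_preserves[of bounded_snd]) auto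
  then have "trunc2 ((diff2 ^^ (k' - k + k)) (product2 a b w))" for w
    using assms(3) unfolding compatible_order_pair_iff[OF assms(1,2)] funpow_add o_apply by blast
  then show ?thesis
    using assms(4) by (simp add: compatible_order_pair_iff[OF assms(1,2)])
qed

text \<open>All sufficiently large exponents are covered because one \<open>k\<close> must serve the
  triple and the pairs \<open>(a, b)\<close> and \<open>(b, c)\<close> at once.\<close>

lemma compatible_seq_triple:
  assumes abc: "a \<in> operators" "b \<in> operators" "c \<in> operators" and "compatible_seq s [a, b, c]"
  shows "\<exists>k0. \<forall>k\<ge>k0. \<forall>w. trunc {0, 1, 2} ((var_diff 0 2 ^^ k) ((var_diff 0 1 ^^ k) ((var_diff 1 2 ^^ k) (named_product [0, 1, 2] [a, b, c] w))))"
proof -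
  obtain k0 where k0: "compatible_order s k0 [a, b, c]" using assms(4) unfolding compatible_seq_def by blast
  let ?P = "concat (map (replicate k0) (pairs 3))"
  have upt: "[0..<3] = [0, 1, 2]"
    by (simp add: numeral_3_eq_3)
  moreover have "[Suc 0..<3] = [1, 2]" "[Suc 1..<3] = [2]" "[Suc 2..<3] = []"
    by (simp_all add: numeral_3_eq_3 numeral_2_eq_2)
  ultimately have pairs: "pairs 3 = [(0, 1), (0, 2), (1, 2)]"
    unfolding pairs_def by simp
  have "{..<3 :: nat} = set [0..<3]" by auto
  also have "\<dots> = {0, 1, 2}" unfolding upt by simp
  finally have lessThan: "{..<3 :: nat} = {0, 1, 2}" .
  have "set [a, b, c] \<subseteq> operators" "3 = length [a, b, c]" using abc by auto
  from k0[unfolded compatible_order_iff[OF this]]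
  have tr: "trunc {0, 1, 2} (var_diffs ?P (named_product [0, 1, 2] [a, b, c] w))" for w
    unfolding upt lessThan by blast
  have "trunc {0, 1, 2} ((var_diff 0 2 ^^ k) ((var_diff 0 1 ^^ k) ((var_diff 1 2 ^^ k) (named_product [0, 1, 2] [a, b, c] w))))" if le: "k0 \<le> k" for k w
  proof -
    obtain d where k: "k = k0 + d" using le_Suc_ex[OF le] by blast
    let ?R = "replicate d (0, 1) @ replicate d (0, 2) @ replicate d (1, 2) :: (nat \<times> nat) list"
    let ?L = "replicate k (1, 2) @ replicate k (0, 1) @ replicate k (0, 2) :: (nat \<times> nat) list"
    have "mset ?L = mset (?P @ ?R)"
      unfolding pairs k replicate_add by simp
    then have "var_diffs ?L (named_product [0, 1, 2] [a, b, c] w) = var_diffs (?P @ ?R) (named_product [0, 1, 2] [a, b, c] w)"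
      by (rule fun_cong[OF var_diffs_mset])
    also have "\<dots> = var_diffs ?R (var_diffs ?P (named_product [0, 1, 2] [a, b, c] w))"
      by (simp only: fold_append o_apply)
    finally have "var_diffs ?L (named_product [0, 1, 2] [a, b, c] w) = var_diffs ?R (var_diffs ?P (named_product [0, 1, 2] [a, b, c] w))" .
    moreover have "var_diffs ?L f = (var_diff 0 2 ^^ k) ((var_diff 0 1 ^^ k) ((var_diff 1 2 ^^ k) f))" for f :: "(nat \<Rightarrow> int) \<Rightarrow> 'w"
      by (simp only: fold_append o_apply var_diffs_replicate)
    ultimately show ?thesis using trunc_var_diffs[OF tr, of ?R w] by simp
  qed
  then show ?thesis by blast
qed

end

subsection \<open>Maximal compatible sets\<close>

locale maximal_compatible = series_space s for s :: "complex \<Rightarrow> 'w::ab_group_add \<Rightarrow> 'w" +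
  fixes M :: "('w \<Rightarrow> int \<Rightarrow> 'w) set"
  assumes compatible: "compatible_set s M"
    and maximal: "compatible_set s (insert c M) \<Longrightarrow> c \<in> M"
begin

lemma M_operator: "a \<in> M \<Longrightarrow> a \<in> operators"
  using compatible by (auto simp: compatible_set_def)

lemma compatible_seq_M: "set \<psi>s \<subseteq> M \<Longrightarrow> compatible_seq s \<psi>s"
  using compatible by (simp add: compatible_set_def)

lemma compatible_pair:
  assumes "a \<in> M" "b \<in> M" obtains k where "compatible_order s k [a, b]"
  using compatible_seq_M[of "[a, b]"] assms by (auto simp: compatible_seq_def)

text \<open>Induction on the part of a sequence not yet known to lie in \<open>M\<close>. At an
  occurrence of \<open>c\<close> the induction hypothesis allows any list over \<open>M\<close> in
  its place, in particular the empty list, a summand, or the two factors from which \<open>c\<close>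
  is made.\<close>

lemma maximal_memberI:
  assumes c: "c \<in> operators"
    and step: "\<And>pre post. set pre \<subseteq> M \<Longrightarrow> set post \<subseteq> insert c M \<Longrightarrow>
      (\<And>xs. set xs \<subseteq> M \<Longrightarrow> compatible_seq s (pre @ xs @ post)) \<Longrightarrow> compatible_seq s (pre @ c # post)"
  shows "c \<in> M"
proof (rule maximal)
  have "set qs \<subseteq> M \<Longrightarrow> set rs \<subseteq> insert c M \<Longrightarrow> compatible_seq s (qs @ rs)" for qs rs
  proof (induction rs arbitrary: qs)
    case Nil
    then show ?case by (simp add: compatible_seq_M)
  next
    case (Cons r rs)
    show ?case
    proof (cases "r \<in> M")
      case True
      then show ?thesis using Cons.IH[of "qs @ [r]"] Cons.prems by simp
    next
      case False
      then have r: "r = c" using Cons.prems by simp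
      have "compatible_seq s (qs @ xs @ rs)" if "set xs \<subseteq> M" for xs
        using Cons.IH[of "qs @ xs"] Cons.prems that by simp
      then show ?thesis unfolding r using Cons.prems by (intro step) auto
    qed
  qed
  from this[of "[]"] show "compatible_set s (insert c M)"
    using c M_operator by (auto simp: compatible_set_def)
qed

lemma post_operator: "c \<in> operators \<Longrightarrow> set post \<subseteq> insert c M \<Longrightarrow> set post \<subseteq> operators"
  using M_operator by auto

lemma pre_operator: "set pre \<subseteq> M \<Longrightarrow> set pre \<subseteq> operators"
  using M_operator by auto

lemma id_operator_M: "id_operator \<in> M"
proof (rule maximal_memberI[OF id_operator_operator])
  fix pre post assume "set pre \<subseteq> M" "set post \<subseteq> insert id_operator M"
    and "\<And>xs. set xs \<subseteq> M \<Longrightarrow> compatible_seq s (pre @ xs @ post)"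
  from this(3)[of "[]"] this(1,2) show "compatible_seq s (pre @ id_operator # post)"
    by (intro compatible_seq_insert_id pre_operator post_operator[OF id_operator_operator]) auto
qed

lemma add_M:
  assumes "a \<in> M" "b \<in> M" shows "a + b \<in> M"
proof -
  have operators: "a + b \<in> operators"
  proof (rule operator_I)
    show "\<exists>N. \<forall>n<N. (a + b) w n = 0" for w
    proof -
      obtain N N' where "\<forall>n<N. a w n = 0" "\<forall>n<N'. b w n = 0"
        using operator_truncated M_operator assms by meson
      then have "\<forall>n<min N N'. (a + b) w n = 0" by simp
      then show ?thesis by blast
    qed
  qed (use M_operator assms in \<open>simp_all add: operator_add operator_scale scale_right_distrib\<close>)
  show ?thesis
  proof (rule maximal_memberI[OF operators])
    fix pre post assume *: "set pre \<subseteq> M" "set post \<subseteq> insert (a + b) M"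
      "\<And>xs. set xs \<subseteq> M \<Longrightarrow> compatible_seq s (pre @ xs @ post)"
    show "compatible_seq s (pre @ (a + b) # post)"
      using *(3)[of "[a]"] *(3)[of "[b]"] assms
      by (intro compatible_seq_insert_add pre_operator[OF *(1)] post_operator[OF operators *(2)] M_operator operators) auto
  qed
qed

lemma scale_M:
  assumes "a \<in> M" shows "operator_scale s c a \<in> M"
proof -
  have operators: "operator_scale s c a \<in> operators"
  proof (rule operator_I)
    show "\<exists>N. \<forall>n<N. operator_scale s c a w n = 0" for w
      using operator_truncated[OF M_operator[OF assms], of w] by (auto simp: operator_scale_def)
  qed (use M_operator[OF assms] in \<open>simp_all add: operator_scale_def operator_add operator_scale scale_right_distrib scale_left_commute\<close>)
  show ?thesis
  proof (rule maximal_memberI[OF operators])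
    fix pre post assume *: "set pre \<subseteq> M" "set post \<subseteq> insert (operator_scale s c a) M"
      "\<And>xs. set xs \<subseteq> M \<Longrightarrow> compatible_seq s (pre @ xs @ post)"
    show "compatible_seq s (pre @ operator_scale s c a # post)"
      using *(3)[of "[a]"] assms
      by (intro compatible_seq_insert_scale pre_operator[OF *(1)] post_operator[OF operators *(2)] M_operator operators) auto
  qed
qed

lemma nth_product_M:
  assumes "a \<in> M" "b \<in> M" shows "nth_product s a n b \<in> M"
proof -
  obtain k where k: "compatible_order s k [a, b]" using compatible_pair[OF assms] .
  have operators: "nth_product s a n b \<in> operators" by (rule nth_product_operator[OF M_operator[OF assms(1)] M_operator[OF assms(2)] k])
  show ?thesis
  proof (rule maximal_memberI[OF operators])
    fix pre post assume *: "set pre \<subseteq> M" "set post \<subseteq> insert (nth_product s a n b) M"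
      "\<And>xs. set xs \<subseteq> M \<Longrightarrow> compatible_seq s (pre @ xs @ post)"
    show "compatible_seq s (pre @ nth_product s a n b # post)"
      using *(3)[of "[a, b]"] assms
      by (intro compatible_seq_insert_nth_product[OF _ _ _ _ _ k] pre_operator[OF *(1)] post_operator[OF operators *(2)] M_operator) auto
  qed
qed

sublocale Op: vector_space "operator_scale s"
  by (rule vector_space_operator_scale)

lemma zero_M: "0 \<in> M"
  using scale_M[OF id_operator_M, of 0] by simp

lemma subspace_M: "Op.subspace M"
  by (rule Op.subspaceI) (simp_all add: zero_M add_M scale_M)

lemma compatible_pairs:
  assumes "a \<in> M" "b \<in> M" "c \<in> M" "d \<in> M" "e \<in> M" "f \<in> M"
  obtains k where "compatible_order s k [a, b]" "compatible_order s k [c, d]" "compatible_order s k [e, f]"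
proof -
  obtain k1 k2 k3 where "compatible_order s k1 [a, b]" "compatible_order s k2 [c, d]" "compatible_order s k3 [e, f]"
    using compatible_pair assms by metis
  then show ?thesis
    by (intro that[of "k1 + k2 + k3"];
        elim compatible_order_pair_mono[OF M_operator M_operator, rotated 2]) (simp_all add: assms)
qed

lemma finite_diag_diff2_product2:
  assumes "a \<in> M" "b \<in> M" "compatible_order s k [a, b]" shows "finite_diag ((diff2 ^^ k) (product2 a b w))"
  using assms(3) compatible_order_pair_iff[OF assms(1,2)[THEN M_operator]] trunc2_imp_finite_diag by blast

section \<open>Bilinearity, truncation and vacuum properties on a maximal compatible set\<close>

lemma Y_E_add_right:
  assumes "a \<in> M" "b \<in> M" "c \<in> M"
  shows "Y_E s a (b + c) p = Y_E s a b p + Y_E s a c p"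
proof (intro ext)
  fix w m
  have M: "b + c \<in> M" by (rule add_M[OF assms(2,3)])
  obtain k where k: "compatible_order s k [a, b]" "compatible_order s k [a, c]" "compatible_order s k [a, b + c]"
    using compatible_pairs[of a b a c a "b + c"] assms M by blast
  have "product2 a (b + c) w = (\<lambda>p q. product2 a b w p q + product2 a c w p q)"
    by (simp add: product2_def operator_add[OF M_operator[OF assms(1)]])
  then show "Y_E s a (b + c) p w m = (Y_E s a b p + Y_E s a c p) w m"
    using k assms M by (simp add: Y_E_eq[of _ _ k] M_operator diff2_pow_add res2_add finite_diag_diff2_product2)
qed

lemma Y_E_add_left:
  assumes "a \<in> M" "b \<in> M" "c \<in> M"
  shows "Y_E s (a + b) c p = Y_E s a c p + Y_E s b c p"
proof (intro ext)
  fix w m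
  have M: "a + b \<in> M" by (rule add_M[OF assms(1,2)])
  obtain k where k: "compatible_order s k [a, c]" "compatible_order s k [b, c]" "compatible_order s k [a + b, c]"
    using compatible_pairs[of a c b c "a + b" c] assms M by blast
  have "product2 (a + b) c w = (\<lambda>p q. product2 a c w p q + product2 b c w p q)"
    by (simp add: product2_def)
  then show "Y_E s (a + b) c p w m = (Y_E s a c p + Y_E s b c p) w m"
    using k assms M by (simp add: Y_E_eq[of _ _ k] M_operator diff2_pow_add res2_add finite_diag_diff2_product2)
qed

lemma diff2_pow_scale: "(diff2 ^^ k) (\<lambda>p q. s c (f p q)) = (\<lambda>p q. s c ((diff2 ^^ k) f p q))"
  by (rule diff2_pow_additive) (rule scale_right_distrib)

lemma res2_scale: "finite_diag f \<Longrightarrow> res2 j (\<lambda>p q. s c (f p q)) m = s c (res2 j f m)"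
  by (rule res2_additive[symmetric]) (simp_all add: scale_right_distrib scale_left_commute)

lemma Y_E_scale_right:
  assumes "a \<in> M" "b \<in> M"
  shows "Y_E s a (operator_scale s c b) p = operator_scale s c (Y_E s a b p)"
proof (intro ext)
  fix w m
  have M: "operator_scale s c b \<in> M" by (rule scale_M[OF assms(2)])
  obtain k where k: "compatible_order s k [a, b]" "compatible_order s k [a, operator_scale s c b]"
    using compatible_pairs[of a b a b a "operator_scale s c b"] assms M by blast
  have "product2 a (operator_scale s c b) w = (\<lambda>p q. s c (product2 a b w p q))"
    by (simp add: product2_def operator_scale_def operator_scale[OF M_operator[OF assms(1)]])
  then show "Y_E s a (operator_scale s c b) p w m = operator_scale s c (Y_E s a b p) w m"
    using k assms M
    by (simp add: Y_E_eq[of _ _ k] M_operator diff2_pow_scale res2_scale finite_diag_diff2_product2 operator_scale_def[of s c "Y_E s a b p"])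
qed

lemma Y_E_scale_left:
  assumes "a \<in> M" "b \<in> M"
  shows "Y_E s (operator_scale s c a) b p = operator_scale s c (Y_E s a b p)"
proof (intro ext)
  fix w m
  have M: "operator_scale s c a \<in> M" by (rule scale_M[OF assms(1)])
  obtain k where k: "compatible_order s k [a, b]" "compatible_order s k [operator_scale s c a, b]"
    using compatible_pairs[of a b a b "operator_scale s c a" b] assms M by blast
  have "product2 (operator_scale s c a) b w = (\<lambda>p q. s c (product2 a b w p q))"
    by (simp add: product2_def operator_scale_def)
  then show "Y_E s (operator_scale s c a) b p w m = operator_scale s c (Y_E s a b p) w m"
    using k assms M
    by (simp add: Y_E_eq[of _ _ k] M_operator diff2_pow_scale res2_scale finite_diag_diff2_product2 operator_scale_def[of s c "Y_E s a b p"])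
qed

lemma Y_E_truncated:
  assumes "a \<in> M" "b \<in> M" shows "\<exists>N. \<forall>p<N. Y_E s a b p = 0"
proof -
  obtain k where "compatible_order s k [a, b]" using compatible_pair[OF assms] .
  then have "\<forall>p. p < - int k \<longrightarrow> Y_E s a b p = 0" using Y_E_neg[OF assms[THEN M_operator]] by blast
  then show ?thesis by blast
qed

lemma Y_E_id_left:
  assumes "b \<in> M" shows "Y_E s id_operator b = id_operator b"
proof (intro ext)
  fix p w m
  have f: "product2 id_operator b w = (\<lambda>p q. if p = 0 then b w q else 0)" for w
    by (auto simp: product2_def id_operator_def)
  have "trunc2 (product2 id_operator b w)" for w
  proof -
    obtain N where "\<forall>n<N. b w n = 0" using operator_truncated[OF M_operator[OF assms]] by blast
    then have "\<forall>p q. p < min 0 N \<or> q < min 0 N \<longrightarrow> product2 id_operator b w p q = 0" by (auto simp: f)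
    then show ?thesis unfolding trunc2_def by blast
  qed
  then have 0: "compatible_order s 0 [id_operator, b]"
    by (simp add: compatible_order_pair_iff[OF id_operator_operator M_operator[OF assms]])
  have "Y_E s id_operator b p w m = res2 p (product2 id_operator b w) m"
    by (simp add: Y_E_eq[OF id_operator_operator M_operator[OF assms] 0])
  also have "\<dots> = Sum_any (\<lambda>n. if n = 0 then s (zchoose n p) (b w (m + p - n)) else 0)"
    unfolding res2_def f by (rule Sum_any.cong) simp
  also have "\<dots> = id_operator b p w m"
    by (simp add: zchoose_0_left id_operator_def)
  finally show "Y_E s id_operator b p w m = id_operator b p w m" .
qed

text \<open>Taylor's formula: acting on the identity, \<open>a\<close> yields
  \<open>a(x + z)\<close>. Both creation properties are its terms of negative and of zeroth order in
  \<open>z\<close>.\<close>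

lemma Y_E_id_right:
  assumes "a \<in> M" shows "Y_E s a id_operator p w m = s (zchoose (m + p) p) (a w (m + p))"
proof -
  have f: "product2 a id_operator w = (\<lambda>p q. if q = 0 then a w p else 0)" for w
    using operator_zero[OF M_operator[OF assms]] by (auto simp: product2_def id_operator_def fun_eq_iff)
  have "trunc2 (product2 a id_operator w)" for w
  proof -
    obtain N where "\<forall>n<N. a w n = 0" using operator_truncated[OF M_operator[OF assms]] by blast
    then have "\<forall>p q. p < min 0 N \<or> q < min 0 N \<longrightarrow> product2 a id_operator w p q = 0" by (auto simp: f)
    then show ?thesis unfolding trunc2_def by blast
  qed
  then have 0: "compatible_order s 0 [a, id_operator]"
    by (simp add: compatible_order_pair_iff[OF M_operator[OF assms] id_operator_operator])
  have "Y_E s a id_operator p w m = res2 p (product2 a id_operator w) m"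
    by (simp add: Y_E_eq[OF M_operator[OF assms] id_operator_operator 0])
  also have "\<dots> = Sum_any (\<lambda>n. if n = m + p then s (zchoose n p) (a w n) else 0)"
    unfolding res2_def f by (rule Sum_any.cong) simp
  finally show ?thesis by (simp only: Sum_any.delta)
qed

lemma weak_associativity_M:
  assumes "a \<in> M" "b \<in> M" "c \<in> M"
  shows "\<exists>l. weak_associativity (Y_E s) (operator_scale s) (Y_E s) l a b c"
proof -
  have operators: "a \<in> operators" "b \<in> operators" "c \<in> operators" using assms M_operator by auto
  obtain k1 where k1: "compatible_order s k1 [a, b]" "compatible_order s k1 [b, c]"
    using compatible_pairs[of a b b c a b] assms by blast
  obtain k0 where "\<forall>k\<ge>k0. \<forall>w. trunc {0, 1, 2} ((var_diff 0 2 ^^ k) ((var_diff 0 1 ^^ k) ((var_diff 1 2 ^^ k) (named_product [0, 1, 2] [a, b, c] w))))"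
    using compatible_seq_triple[OF operators compatible_seq_M] assms by auto
  then have "\<And>w. trunc {0, 1, 2} ((var_diff 0 2 ^^ (k1 + k0)) ((var_diff 0 1 ^^ (k1 + k0)) ((var_diff 1 2 ^^ (k1 + k0)) (named_product [0, 1, 2] [a, b, c] w))))"
    by (meson le_add2)
  moreover have "compatible_order s (k1 + k0) [a, b]" "compatible_order s (k1 + k0) [b, c]"
    by (auto intro: compatible_order_pair_mono operators k1)
  ultimately show ?thesis using weak_associativity_triple[OF operators] by blast
qed

section \<open>Membership in a subspace under powers of \<open>z0 + z2\<close>\<close>

lemma sum2_pow_mem:
  assumes "Op.subspace U" "\<And>p q. f p q \<in> U"
  shows "(sum2 ^^ k) f p q \<in> U"
proof (induction k arbitrary: p q)
  case (Suc k)
  show ?case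
    unfolding funpow.simps o_apply sum2_def[of "(sum2 ^^ k) f"]
    by (rule Op.subspace_add[OF assms(1) Suc Suc])
qed (simp only: funpow_0 assms(2))

text \<open>The coefficient of \<open>sum2 G\<close> at \<open>p\<close> and \<open>q + 1\<close> is
  \<open>G (p - 1) (q + 1) + G p q\<close>, so \<open>G p q\<close> is obtained recursively from
  smaller \<open>p\<close>. The recursion starts where \<open>G\<close> vanishes.\<close>

lemma sum2_mem_cancel:
  assumes U: "Op.subspace U" and b: "bounded_fst G" and "\<And>p q. sum2 G p q \<in> U"
  shows "G p q \<in> U"
proof -
  obtain N where N: "\<And>p q. p < N \<Longrightarrow> G p q = 0" using b by (auto simp: bounded_fst_def)
  have *: "G (N + int n - 1) q \<in> U" for n q
  proof (induction n arbitrary: q)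
    case 0
    have "G (N + int 0 - 1) q = 0" by (rule N) simp
    then show ?case using Op.subspace_0[OF U] by (simp only:)
  next
    case (Suc n)
    have idx: "N + int (Suc n) - 1 - 1 = N + int n - 1" "q + 1 - 1 = q" by simp_all
    have eq: "sum2 G (N + int (Suc n) - 1) (q + 1) - G (N + int n - 1) (q + 1) = G (N + int (Suc n) - 1) q"
      unfolding sum2_def idx by (rule add_diff_cancel_left')
    show ?case
      using Op.subspace_diff[OF U assms(3)[of "N + int (Suc n) - 1" "q + 1"] Suc[of "q + 1"]]
      unfolding eq .
  qed
  show ?thesis
  proof (cases "p < N")
    case True
    show ?thesis unfolding N[OF True] by (rule Op.subspace_0[OF U])
  next
    case False
    then have eq: "p = N + int (nat (p - N + 1)) - 1" by simp
    show ?thesis by (subst eq) (rule *)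
  qed
qed

lemma sum2_pow_mem_cancel:
  assumes U: "Op.subspace U" and b: "bounded_fst G" and "\<And>p q. (sum2 ^^ k) G p q \<in> U"
  shows "G p q \<in> U"
  using b assms(3)
proof (induction k arbitrary: G p q)
  case (Suc k)
  obtain N where "\<And>p q. p < N \<Longrightarrow> G p q = 0" using Suc.prems(1) by (auto simp: bounded_fst_def)
  then have "\<forall>p<N. \<forall>q. sum2 G p q = 0" unfolding sum2_def by (auto simp: fun_eq_iff)
  then have "bounded_fst (sum2 G)" unfolding bounded_fst_def by blast
  moreover have "(sum2 ^^ k) (sum2 G) p q \<in> U" for p q
    using Suc.prems(2)[of p q] unfolding funpow_Suc_right o_apply .
  ultimately have "sum2 G p q \<in> U" for p q by (rule Suc.IH)
  then show ?case by (rule sum2_mem_cancel[OF U Suc.prems(1)])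
qed (simp only: funpow_0)

end

section \<open>Existence of a maximal compatible set\<close>

context series_space
begin

text \<open>Compatibility is a condition on finite sequences. Any such sequence in the union of a
  chain already lies in one member, so the union is again compatible.\<close>

lemma exists_maximal_compatible:
  assumes "compatible_set s S"
  shows "\<exists>M. S \<subseteq> M \<and> maximal_compatible s M"
proof -
  let ?A = "{T. S \<subseteq> T \<and> compatible_set s T}"
  have "\<exists>M\<in>?A. \<forall>X\<in>?A. M \<subseteq> X \<longrightarrow> X = M"
  proof (rule subset_Zorn_nonempty)
    show "?A \<noteq> {}" using assms by blast
  next
    fix C assume C: "C \<noteq> {}" "subset.chain ?A C"
    then have CA: "C \<subseteq> ?A" by (auto simp: subset.chain_def)
    have "compatible_seq s \<psi>s" if \<psi>s: "set \<psi>s \<subseteq> \<Union>C" for \<psi>s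
    proof -
      obtain T where "T \<in> C" "set \<psi>s \<subseteq> T"
        using finite_subset_Union_chain[OF _ \<psi>s C] by auto
      then show ?thesis using CA by (auto simp: compatible_set_def)
    qed
    moreover have "\<Union>C \<subseteq> operators" using CA by (auto simp: compatible_set_def)
    moreover have "S \<subseteq> \<Union>C" using C(1) CA by blast
    ultimately show "\<Union>C \<in> ?A" by (auto simp: compatible_set_def)
  qed
  then obtain M where "M \<in> ?A" and max: "\<forall>X\<in>?A. M \<subseteq> X \<longrightarrow> X = M" by (rule bexE)
  then have M: "S \<subseteq> M" "compatible_set s M" by simp_all
  have "maximal_compatible s M"
  proof unfold_locales
    show "compatible_set s M" by (rule M(2))
    show "c \<in> M" if "compatible_set s (insert c M)" for c
    proof -
      have "insert c M \<in> ?A" using that M(1) by blast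
      with max have "insert c M = M" by blast
      then show ?thesis by blast
    qed
  qed
  then show ?thesis using M(1) by blast
qed

end

section \<open>The span of the iterated products\<close>

context maximal_compatible
begin

context
  fixes S U :: "('w \<Rightarrow> int \<Rightarrow> 'w) set"
  assumes S: "S \<subseteq> M" and U: "U = iterated_product_span s S"
begin

lemma iterated_product_M: "fst ` set ps \<subseteq> S \<Longrightarrow> iterated_product s ps \<in> M"
  using S by (induction ps) (auto simp: id_operator_M nth_product_M)

lemma iterated_product_defined_S: "fst ` set ps \<subseteq> S \<Longrightarrow> iterated_product_defined s ps"
proof (induction ps)
  case (Cons p ps)
  then have "fst p \<in> M" "iterated_product s ps \<in> M" using S iterated_product_M by auto
  then show ?case using Cons compatible_seq_M[of "[fst p, iterated_product s ps]"] by (cases p) auto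
qed simp

lemma U_span: "U = Op.span {iterated_product s ps | ps. fst ` set ps \<subseteq> S}"
  by (simp add: U iterated_product_span_def)

lemma subspace_U: "Op.subspace U"
  unfolding U_span by (rule Op.subspace_span)

lemma iterated_product_U: "fst ` set ps \<subseteq> S \<Longrightarrow> iterated_product s ps \<in> U"
  unfolding U_span by (intro Op.span_base) auto

lemma U_minimal:
  assumes "Op.subspace T" "\<And>ps. fst ` set ps \<subseteq> S \<Longrightarrow> iterated_product s ps \<in> T"
  shows "U \<subseteq> T"
  unfolding U_span by (rule Op.span_minimal) (use assms in auto)

lemma U_M: "U \<subseteq> M"
  by (rule U_minimal[OF subspace_M iterated_product_M])

lemma id_operator_U: "id_operator \<in> U"
  using iterated_product_U[of "[]"] by simp

lemma Y_E_zero: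
  assumes "a \<in> M" shows "Y_E s a 0 p = 0" "Y_E s 0 a p = 0"
  using Y_E_scale_right[OF assms zero_M, of 0 p] Y_E_scale_left[OF zero_M assms, of 0 p]
  unfolding Op.scale_zero_left by this

text \<open>Multiplying by a generator prepends a factor to an iterated product. Linearity of
  \<open>Y_E\<close> has been shown on \<open>M\<close>, so membership in \<open>M\<close> is
  carried along in the subspace.\<close>

lemma Y_E_S_U:
  assumes "a \<in> S" "b \<in> U" shows "Y_E s a b p \<in> U"
proof -
  have a: "a \<in> M" using assms S by blast
  have "U \<subseteq> {b \<in> M. \<forall>p. Y_E s a b p \<in> U}"
  proof (rule U_minimal)
    show "Op.subspace {b \<in> M. \<forall>p. Y_E s a b p \<in> U}"
    proof (rule Op.subspaceI)
      show "0 \<in> {b \<in> M. \<forall>p. Y_E s a b p \<in> U}"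
        by (simp only: mem_Collect_eq zero_M Y_E_zero(1)[OF a] Op.subspace_0[OF subspace_U] simp_thms)
      show "x + y \<in> {b \<in> M. \<forall>p. Y_E s a b p \<in> U}" if "x \<in> {b \<in> M. \<forall>p. Y_E s a b p \<in> U}" "y \<in> {b \<in> M. \<forall>p. Y_E s a b p \<in> U}" for x y
        using that by (simp only: mem_Collect_eq add_M Y_E_add_right[OF a] Op.subspace_add[OF subspace_U] simp_thms)
      show "operator_scale s c x \<in> {b \<in> M. \<forall>p. Y_E s a b p \<in> U}" if "x \<in> {b \<in> M. \<forall>p. Y_E s a b p \<in> U}" for c x
        using that by (simp only: mem_Collect_eq scale_M Y_E_scale_right[OF a] Op.subspace_scale[OF subspace_U] simp_thms)
    qed
    fix ps :: "(('w \<Rightarrow> int \<Rightarrow> 'w) \<times> int) list" assume ps: "fst ` set ps \<subseteq> S"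
    have "Y_E s a (iterated_product s ps) p \<in> U" for p
      using iterated_product_U[of "(a, - p - 1) # ps"] ps assms(1) by (simp add: Y_E_def)
    then show "iterated_product s ps \<in> {b \<in> M. \<forall>p. Y_E s a b p \<in> U}"
      using iterated_product_M[OF ps] by blast
  qed
  then show ?thesis using assms(2) by blast
qed

text \<open>Weak associativity expresses \<open>(z\<^sub>0 + z\<^sub>2)\<^sup>l Y(Y(a, z\<^sub>0) c, z\<^sub>2) b\<close> by elements of \<open>U\<close>, and the
  power of \<open>z\<^sub>0 + z\<^sub>2\<close> can be cancelled because \<open>Y(a, z\<^sub>0) c\<close> is truncated in \<open>z\<^sub>0\<close>.\<close>

lemma Y_E_Y_E_U:
  assumes a: "a \<in> S" and c: "c \<in> M" and b: "b \<in> U" and IH: "\<And>q. Y_E s c b q \<in> U"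
  shows "Y_E s (Y_E s a c p) b q \<in> U"
proof -
  have M: "a \<in> M" "b \<in> M" using a b S U_M by auto
  define G where "G = (\<lambda>p q. Y_E s (Y_E s a c p) b q)"
  define F where "F = (\<lambda>p q. Y_E s a (Y_E s c b q) p)"
  obtain l where "weak_associativity (Y_E s) (operator_scale s) (Y_E s) l a c b"
    using weak_associativity_M[OF M(1) c M(2)] by blast
  then have eq: "(sum2 ^^ l) (subst_sum (operator_scale s) F) = (sum2 ^^ l) G"
    unfolding weak_associativity_def series_space.binomial_mult_nat[OF series_space_operator_scale]
      F_def G_def .
  have "subst_sum (operator_scale s) F p q \<in> U" for p q
    unfolding subst_sum_def Sum_any.expand_set F_def
    by (intro Op.subspace_sum[OF subspace_U] Op.subspace_scale[OF subspace_U] Y_E_S_U a IH)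
  then have mem: "(sum2 ^^ l) G p q \<in> U" for p q
    unfolding eq[symmetric] by (rule sum2_pow_mem[OF subspace_U])
  obtain N where N: "\<And>p. p < N \<Longrightarrow> Y_E s a c p = 0" using Y_E_truncated[OF M(1) c] by blast
  have "G p q = 0" if "p < N" for p q
    unfolding G_def N[OF that] by (rule Y_E_zero(2)[OF M(2)])
  then have "bounded_fst G" unfolding bounded_fst_def by blast
  from sum2_pow_mem_cancel[OF subspace_U this mem] have "G p q \<in> U" .
  then show ?thesis by (simp only: G_def)
qed

text \<open>Weak associativity peels off the first factor. It calls on the remaining factors at
  every exponent, so \<open>q\<close> varies in the induction.\<close>

lemma Y_E_iterated_product_U:
  assumes "b \<in> U" "fst ` set ps \<subseteq> S" shows "Y_E s (iterated_product s ps) b q \<in> U"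
  using assms(2)
proof (induction ps arbitrary: q)
  case Nil
  have "b \<in> M" using assms U_M by blast
  then show ?case
    using assms Op.subspace_0[OF subspace_U] by (simp add: Y_E_id_left id_operator_def[of b])
next
  case (Cons p ps)
  obtain a n where p: "p = (a, n)" by (cases p)
  have "Y_E s (Y_E s a (iterated_product s ps) (- n - 1)) b q \<in> U"
    using Cons p by (intro Y_E_Y_E_U assms iterated_product_M) auto
  then show ?case by (simp add: p Y_E_def[of s a])
qed

lemma Y_E_U:
  assumes "a \<in> U" "b \<in> U" shows "Y_E s a b p \<in> U"
proof -
  have b: "b \<in> M" using assms U_M by blast
  have "U \<subseteq> {a \<in> M. \<forall>p. Y_E s a b p \<in> U}"
  proof (rule U_minimal)
    show "Op.subspace {a \<in> M. \<forall>p. Y_E s a b p \<in> U}"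
    proof (rule Op.subspaceI)
      show "0 \<in> {a \<in> M. \<forall>p. Y_E s a b p \<in> U}"
        by (simp only: mem_Collect_eq zero_M Y_E_zero(2)[OF b] Op.subspace_0[OF subspace_U] simp_thms)
      show "x + y \<in> {a \<in> M. \<forall>p. Y_E s a b p \<in> U}" if "x \<in> {a \<in> M. \<forall>p. Y_E s a b p \<in> U}" "y \<in> {a \<in> M. \<forall>p. Y_E s a b p \<in> U}" for x y
        using that by (simp only: mem_Collect_eq add_M Y_E_add_left[OF _ _ b] Op.subspace_add[OF subspace_U] simp_thms)
      show "operator_scale s c x \<in> {a \<in> M. \<forall>p. Y_E s a b p \<in> U}" if "x \<in> {a \<in> M. \<forall>p. Y_E s a b p \<in> U}" for c x
        using that by (simp only: mem_Collect_eq scale_M Y_E_scale_left[OF _ b] Op.subspace_scale[OF subspace_U] simp_thms)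
    qed
    show "iterated_product s ps \<in> {a \<in> M. \<forall>p. Y_E s a b p \<in> U}" if "fst ` set ps \<subseteq> S" for ps
      using iterated_product_M[OF that] Y_E_iterated_product_U[OF assms(2) that] by blast
  qed
  then show ?thesis using assms(1) by blast
qed

lemma weak_axiomatic_U: "weak_axiomatic_G1_vertex_algebra (operator_scale s) U (Y_E s) id_operator"
proof
  note M = subsetD[OF U_M]
  show "Op.subspace U" by (rule subspace_U)
  show "id_operator \<in> U" by (rule id_operator_U)
  show "linear_between (operator_scale s) U (operator_scale s) U (\<lambda>v. Y_E s u v p)" if "u \<in> U" for u p
    unfolding linear_between_def
    by (intro conjI ballI allI Y_E_U Y_E_add_right Y_E_scale_right M that) assumption+
  show "linear_between (operator_scale s) U (operator_scale s) U (\<lambda>u. Y_E s u v p)" if "v \<in> U" for v p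
    unfolding linear_between_def
    by (intro conjI ballI allI Y_E_U Y_E_add_left Y_E_scale_left M that) assumption+
  show "lower_truncated (Y_E s u v)" if "u \<in> U" "v \<in> U" for u v
    unfolding lower_truncated_def by (rule Y_E_truncated[OF M[OF that(1)] M[OF that(2)]])
  show "Y_E s id_operator v = id_operator v" if "v \<in> U" for v
    by (rule Y_E_id_left[OF M[OF that]])
  show "Y_E s v id_operator p = 0" if "v \<in> U" "p < 0" for v p
    using that(2) by (simp add: fun_eq_iff Y_E_id_right[OF M[OF that(1)]])
  show "Y_E s v id_operator 0 = v" if "v \<in> U" for v
    by (simp add: fun_eq_iff Y_E_id_right[OF M[OF that]])
  show "\<exists>l. weak_associativity (Y_E s) (operator_scale s) (Y_E s) l u v w" if "u \<in> U" "v \<in> U" "w \<in> U" for u v w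
    by (rule weak_associativity_M[OF M[OF that(1)] M[OF that(2)] M[OF that(3)]])
qed

lemma weak_axiomatic_module_U:
  "weak_axiomatic_G1_vertex_algebra_module (operator_scale s) U (Y_E s) id_operator s UNIV (\<lambda>\<alpha>. \<alpha>)"
proof -
  interpret A: weak_axiomatic_G1_vertex_algebra "operator_scale s" U "Y_E s" id_operator
    by (rule weak_axiomatic_U)
  have operators: "a \<in> operators" if "a \<in> U" for a using that U_M M_operator by blast
  show ?thesis
  proof
    show "subspace UNIV" by (rule subspace_UNIV)
    show "linear_between s UNIV s UNIV (\<lambda>w. v w p)" if "v \<in> U" for v p
      using operators[OF that] by (simp add: linear_between_def operator_add operator_scale)
    show "linear_between (operator_scale s) U s UNIV (\<lambda>v. v w p)" for w p
      by (simp add: linear_between_def operator_scale_def)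
    show "lower_truncated (v w)" if "v \<in> U" for v w
      using operator_truncated[OF operators[OF that]] by (simp add: lower_truncated_def)
    show "\<exists>l. weak_associativity (Y_E s) s (\<lambda>\<alpha>. \<alpha>) l u v w" if uv: "u \<in> U" "v \<in> U" for u v w
    proof -
      obtain k where "compatible_order s k [u, v]"
        using compatible_pair[OF subsetD[OF U_M uv(1)] subsetD[OF U_M uv(2)]] .
      then show ?thesis by (rule weak_associativity_pair[OF operators[OF uv(1)] operators[OF uv(2)]])
    qed
  qed simp
qed

end

end

theorem theorem5p25:
  fixes s :: "complex \<Rightarrow> 'w::ab_group_add \<Rightarrow> 'w"
    and S U :: "('w \<Rightarrow> int \<Rightarrow> 'w) set"
  assumes "vector_space s"
    and "S \<subseteq> G1_vertex_operators s"
    and "compatible_set s S"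
    and "U = iterated_product_span s S"
  shows "(\<forall>ps. fst ` set ps \<subseteq> S \<longrightarrow>
            iterated_product_defined s ps \<and> iterated_product s ps \<in> weak_G1_vertex_operators s)
       \<and> U \<subseteq> weak_G1_vertex_operators s
       \<and> (\<forall>\<alpha>\<in>U. \<forall>\<beta>\<in>U. compatible_seq s [\<alpha>, \<beta>])
       \<and> weak_axiomatic_G1_vertex_algebra (operator_scale s) U (Y_E s) id_operator
       \<and> weak_axiomatic_G1_vertex_algebra_module (operator_scale s) U (Y_E s) id_operator
           s UNIV (\<lambda>\<alpha>. \<alpha>)"
proof -
  have "series_space s" using assms(1) by (simp add: series_space_def)
  then obtain M where M: "S \<subseteq> M" "maximal_compatible s M"
    using series_space.exists_maximal_compatible[OF _ assms(3)] by blast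
  interpret maximal_compatible s M by (rule M(2))
  \<comment> \<open>Since \<open>M\<close> is closed under linear combinations and products, it
    contains the whole span; every pair in \<open>U\<close> is then compatible.\<close>
  have UM: "U \<subseteq> M" by (rule U_M[OF M(1) assms(4)])
  have "iterated_product_defined s ps \<and> iterated_product s ps \<in> operators" if "fst ` set ps \<subseteq> S" for ps
    using iterated_product_defined_S[OF M(1) assms(4) that]
      M_operator[OF iterated_product_M[OF M(1) assms(4) that]] by blast
  moreover have "compatible_seq s [\<alpha>, \<beta>]" if "\<alpha> \<in> U" "\<beta> \<in> U" for \<alpha> \<beta>
    using that UM by (intro compatible_seq_M) auto
  moreover have "U \<subseteq> operators" using UM M_operator by blast
  ultimately show ?thesis
    using weak_axiomatic_U[OF M(1) assms(4)] weak_axiomatic_module_U[OF M(1) assms(4)] by blast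
qed

end
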